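(* Let $\Omega\subset\mathbb{H}$ be a circular domain and let $f=f_0+f_v$, $g=g_0+g_v\in\mathcal{SEM}(\Omega)\setminus\mathcal{SEM}_{\mathbb{R}}(\Omega)$. The characteristic polynomial of the $\mathcal{SEM}_{\mathbb{R}}(\Omega)$-linear operator $\mathcal{S}_{f,g}:\mathcal{SEM}(\Omega)\to\mathcal{SEM}(\Omega)$, $\mathcal{S}_{f,g}(\chi)=f*\chi+\chi*g$, is $$p(\lambda)=(f_{0}+g_{0}-\lambda)^{2}[(f_{0}+g_{0}-\lambda)^{2}+2(f_{v}^{s}+g_{v}^{s})]+(f_{v}^{s}-g_{v}^{s})^{2}.$$ In particular $\mathcal{S}_{f,g}$ is an isomorphism if and only if $$(f_{0}+g_{0})^{2}[(f_{0}+g_{0})^{2}+2(f_{v}^{s}+g_{v}^{s})]+(f_{v}^{s}-g_{v}^{s})^{2}\not\equiv 0.$$ Moreover, the rank of $\mathcal{S}_{f,g}$ is always strictly greater than $1$.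
   Context: $\mathbb{H}$ denotes the quaternions, $\mathbb{S}=\{q\in\mathbb{H}: q^2=-1\}$, and $\mathbb{C}_I=\mathbb{R}+I\mathbb{R}$ for $I\in\mathbb{S}$. For $q=x+Iy$ put $\mathbb{S}_q=\{x+Jy: J\in\mathbb{S}\}$. A domain (connected open set) $\Omega\subset\mathbb{H}$ is circular if $\mathbb{S}_q\subset\Omega$ for all $q\in\Omega$. A function $f$ on a circular open set $\Omega$ is slice regular ($f\in\mathcal{SR}(\Omega)$) if $f(x+Iy)=F_1(x,y)+IF_2(x,y)$ for all $x+Iy\in\Omega$ ($x,y\in\mathbb{R}$, $I\in\mathbb{S}$), with $\mathbb{H}$-valued $F_1$ even in $y$ and $F_2$ odd in $y$, and each restriction $f|_{\Omega\cap\mathbb{C}_I}$ is real differentiable with $\frac12(\partial_x+I\partial_y)f|_{\Omega\cap\mathbb{C}_I}\equiv0$. The $*$-product is $(f*g)(q)=0$ if $f(q)=0$ and $(f*g)(q)=f(q)\,g(f(q)^{-1}qf(q))$ otherwise. $f$ is slice preserving if $f(\Omega\cap\mathbb{C}_I)\subset\mathbb{C}_I$ for every $I\in\mathbb{S}$. A function $f$ is slice semi-regular on $\Omega$ ($f\in\mathcal{SEM}(\Omega)$) if there is a circular open $\widetilde\Omega\subseteq\Omega$ with $f\in\mathcal{SR}(\widetilde\Omega)$ and each point of $\Omega\setminus\widetilde\Omega$ is a pole or a removable singularity; i.e. $\Omega\setminus\widetilde\Omega$ consists of isolated real points and isolated spheres $\mathbb{S}_p$, near each of which $\Delta_p^m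 f$ extends slice regularly for some integer $m\ge0$, where $\Delta_p(q)=q^2-2\mathrm{Re}(p)q+|p|^2$. Functions agreeing where both are defined are identified. $\mathcal{SEM}_{\mathbb{R}}(\Omega)$ is the subset of slice preserving elements; it is a field and the center of the algebra $(\mathcal{SEM}(\Omega),+,* )$, which is a 4-dimensional vector space over it: for an orthonormal basis $(1,I,J,K)$ of $\mathbb{H}$, each $f$ is uniquely $f_0+f_1I+f_2J+f_3K$ with $f_\ell\in\mathcal{SEM}_{\mathbb{R}}(\Omega)$. Set $f^c=f_0-(f_1I+f_2J+f_3K)$, $f^s=f*f^c=f_0^2+f_1^2+f_2^2+f_3^2$, $f_0=(f+f^c)/2$, $f_v=f-f_0$, so $f_v^s=(f_v)^s=f_1^2+f_2^2+f_3^2$. Rank, isomorphism and characteristic polynomial $p(\lambda)=\det(\mathcal{S}_{f,g}-\lambda)$ are over the field $\mathcal{SEM}_{\mathbb{R}}(\Omega)$. *)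

theory Defs
  imports
    "HOL-Analysis.Analysis"
    "HOL-Algebra.UnivPoly"
    "HOL-Algebra.Embedded_Algebras"
    "HOL-Combinatorics.Permutations"
begin

section \<open>Quaternions\<close>

datatype quat = Quat (qre: real) (qim1: real) (qim2: real) (qim3: real)

lemma quat_eq_iff:
  "x = y \<longleftrightarrow> qre x = qre y \<and> qim1 x = qim1 y \<and> qim2 x = qim2 y \<and> qim3 x = qim3 y"
  by (auto intro: quat.expand)

instantiation quat :: real_vector
begin

definition "0 = Quat 0 0 0 0"
definition "x + y = Quat (qre x + qre y) (qim1 x + qim1 y) (qim2 x + qim2 y) (qim3 x + qim3 y)"
definition "- x = Quat (- qre x) (- qim1 x) (- qim2 x) (- qim3 x)"
definition "x - y = Quat (qre x - qre y) (qim1 x - qim1 y) (qim2 x - qim2 y) (qim3 x - qim3 y)"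
definition "r *\<^sub>R x = Quat (r * qre x) (r * qim1 x) (r * qim2 x) (r * qim3 x)"

instance
  by standard
    (simp_all add: quat_eq_iff zero_quat_def plus_quat_def uminus_quat_def minus_quat_def
      scaleR_quat_def algebra_simps)

end

lemma quat_sel_real_vector [simp]:
  "qre 0 = 0" "qim1 0 = 0" "qim2 0 = 0" "qim3 0 = 0"
  "qre (x + y) = qre x + qre y" "qim1 (x + y) = qim1 x + qim1 y"
  "qim2 (x + y) = qim2 x + qim2 y" "qim3 (x + y) = qim3 x + qim3 y"
  "qre (- x) = - qre x" "qim1 (- x) = - qim1 x" "qim2 (- x) = - qim2 x" "qim3 (- x) = - qim3 x"
  "qre (x - y) = qre x - qre y" "qim1 (x - y) = qim1 x - qim1 y"
  "qim2 (x - y) = qim2 x - qim2 y" "qim3 (x - y) = qim3 x - qim3 y"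
  "qre (r *\<^sub>R x) = r * qre x" "qim1 (r *\<^sub>R x) = r * qim1 x"
  "qim2 (r *\<^sub>R x) = r * qim2 x" "qim3 (r *\<^sub>R x) = r * qim3 x"
  by (simp_all add: zero_quat_def plus_quat_def uminus_quat_def minus_quat_def scaleR_quat_def)

instantiation quat :: real_div_algebra
begin

definition "1 = Quat 1 0 0 0"

definition "x * y = Quat
  (qre x * qre y - qim1 x * qim1 y - qim2 x * qim2 y - qim3 x * qim3 y)
  (qre x * qim1 y + qim1 x * qre y + qim2 x * qim3 y - qim3 x * qim2 y)
  (qre x * qim2 y - qim1 x * qim3 y + qim2 x * qre y + qim3 x * qim1 y)
  (qre x * qim3 y + qim1 x * qim2 y - qim2 x * qim1 y + qim3 x * qre y)"

definition "inverse x =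
  inverse ((qre x)\<^sup>2 + (qim1 x)\<^sup>2 + (qim2 x)\<^sup>2 + (qim3 x)\<^sup>2)
    *\<^sub>R Quat (qre x) (- qim1 x) (- qim2 x) (- qim3 x)"

definition "x div (y::quat) = x * inverse y"

instance
proof
  fix x y z :: quat and r :: real
  show "x * y * z = x * (y * z)" "(x + y) * z = x * z + y * z" "x * (y + z) = x * y + x * z"
    "r *\<^sub>R x * y = r *\<^sub>R (x * y)" "x * r *\<^sub>R y = r *\<^sub>R (x * y)"
    by (simp_all add: quat_eq_iff times_quat_def algebra_simps)
  show "1 * x = x" "x * 1 = x" "(0::quat) \<noteq> 1"
    by (simp_all add: quat_eq_iff times_quat_def one_quat_def)
  show "x div y = x * inverse y"
    by (rule divide_quat_def)
  show "inverse (0::quat) = 0"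
    by (simp add: quat_eq_iff inverse_quat_def)
  show "inverse x * x = 1" "x * inverse x = 1" if "x \<noteq> 0"
  proof -
    define n where "n = (qre x)\<^sup>2 + (qim1 x)\<^sup>2 + (qim2 x)\<^sup>2 + (qim3 x)\<^sup>2"
    have "n \<noteq> 0"
      using that unfolding n_def quat_eq_iff
      by (simp add: add_nonneg_eq_0_iff)
    then have *: "inverse n * n = 1" by simp
    show "inverse x * x = 1" "x * inverse x = 1"
      using * unfolding inverse_quat_def n_def[symmetric]
      by (simp_all add: quat_eq_iff times_quat_def one_quat_def algebra_simps)
        (simp_all add: n_def power2_eq_square algebra_simps)
  qed
qed

end

instantiation quat :: real_normed_div_algebra
begin

definition "norm x = sqrt ((qre x)\<^sup>2 + (qim1 x)\<^sup>2 + (qim2 x)\<^sup>2 + (qim3 x)\<^sup>2)"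
definition "sgn x = x /\<^sub>R norm (x::quat)"
definition "dist x y = norm (x - y :: quat)"
definition "(uniformity :: (quat \<times> quat) filter) = (INF e\<in>{0<..}. principal {(x, y). dist x y < e})"
definition "open (U :: quat set) \<longleftrightarrow> (\<forall>x\<in>U. eventually (\<lambda>(x', y). x' = x \<longrightarrow> y \<in> U) uniformity)"

instance
proof
  fix x y :: quat and r :: real
  have prod: "norm z = norm (qre z, qim1 z, qim2 z, qim3 z)" for z :: quat
    by (simp add: norm_quat_def norm_prod_def add.assoc)
  show "norm x = 0 \<longleftrightarrow> x = 0"
    unfolding prod by (simp add: quat_eq_iff zero_prod_def)
  show "norm (x + y) \<le> norm x + norm y"
    unfolding prod
    using norm_triangle_ineq[of "(qre x, qim1 x, qim2 x, qim3 x)" "(qre y, qim1 y, qim2 y, qim3 y)"]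
    by simp
  show "norm (r *\<^sub>R x) = \<bar>r\<bar> * norm x"
    unfolding prod
    using norm_scaleR[of r "(qre x, qim1 x, qim2 x, qim3 x)"] by simp
  show "norm (x * y) = norm x * norm y"
    unfolding norm_quat_def real_sqrt_mult[symmetric]
    by (rule arg_cong[where f = sqrt]) (simp add: times_quat_def power2_eq_square algebra_simps)
qed (rule sgn_quat_def dist_quat_def open_quat_def uniformity_quat_def)+

end


section \<open>Slice regular functions\<close>

definition imag_units :: "quat set" where
  "imag_units = {q. q\<^sup>2 = -1}"

definition slice_pt :: "quat \<Rightarrow> real \<Rightarrow> real \<Rightarrow> quat" where
  "slice_pt I x y = of_real x + I * of_real y"

definition slice :: "quat \<Rightarrow> quat set" where
  "slice I = {slice_pt I x y | x y. True}"

definition sphere_of :: "quat \<Rightarrow> quat set" where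
  "sphere_of q = {slice_pt J x y | J x y. J \<in> imag_units \<and> (\<exists>I\<in>imag_units. q = slice_pt I x y)}"

definition circular :: "quat set \<Rightarrow> bool" where
  "circular D \<longleftrightarrow> (\<forall>q\<in>D. sphere_of q \<subseteq> D)"

definition circular_domain :: "quat set \<Rightarrow> bool" where
  "circular_domain D \<longleftrightarrow> open D \<and> connected D \<and> circular D"

text \<open>
  The components of a slice function on \<open>D\<close> only matter at those \<open>(x, y)\<close> with \<open>x + I y \<in> D\<close>; this set
  is symmetric in \<open>y\<close> when \<open>D\<close> is circular, so the parity conditions can be imposed globally
  (extend by \<open>0\<close>).
\<close>
definition slice_function :: "quat set \<Rightarrow> (quat \<Rightarrow> quat) \<Rightarrow> bool" where
  "slice_function D f \<longleftrightarrow> (\<exists>F1 F2 :: real \<Rightarrow> real \<Rightarrow> quat.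
     (\<forall>x y. F1 x (- y) = F1 x y) \<and> (\<forall>x y. F2 x (- y) = - F2 x y) \<and>
     (\<forall>I\<in>imag_units. \<forall>x y. slice_pt I x y \<in> D \<longrightarrow> f (slice_pt I x y) = F1 x y + I * F2 x y))"

definition slice_regular :: "quat set \<Rightarrow> (quat \<Rightarrow> quat) \<Rightarrow> bool" where
  "slice_regular D f \<longleftrightarrow> slice_function D f \<and>
     (\<forall>I\<in>imag_units. \<forall>x y. slice_pt I x y \<in> D \<longrightarrow>
       (\<exists>f'. ((\<lambda>(u, v). f (slice_pt I u v)) has_derivative f') (at (x, y)) \<and>
             (1/2) *\<^sub>R (f' (1, 0) + I * f' (0, 1)) = 0))"

definition star_prod :: "(quat \<Rightarrow> quat) \<Rightarrow> (quat \<Rightarrow> quat) \<Rightarrow> quat \<Rightarrow> quat" where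
  "star_prod f g q = (if f q = 0 then 0 else f q * g (inverse (f q) * q * f q))"

definition slice_preserving :: "quat set \<Rightarrow> (quat \<Rightarrow> quat) \<Rightarrow> bool" where
  "slice_preserving D f \<longleftrightarrow> (\<forall>I\<in>imag_units. f ` (D \<inter> slice I) \<subseteq> slice I)"


section \<open>Slice semi-regular functions\<close>

definition Delta :: "quat \<Rightarrow> quat \<Rightarrow> quat" where
  "Delta p q = q\<^sup>2 - of_real (2 * qre p) * q + of_real ((norm p)\<^sup>2)"

text \<open>
  A semi-regular function on \<open>W\<close> is represented by a pair \<open>(D, f)\<close>, where \<open>D\<close> is the set on which it is
  given as a slice regular function; the values of \<open>f\<close> outside \<open>D\<close> are irrelevant.
  The condition \<open>U - sphere_of p \<subseteq> D\<close> says that \<open>sphere_of p\<close> (a single point if \<open>p\<close> is real) is isolated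
  in \<open>W - D\<close>.  As \<open>Delta p\<close> is slice preserving, its \<open>*\<close>-product with \<open>f\<close> is the pointwise product.
\<close>
definition semi_regular :: "quat set \<Rightarrow> (quat set \<times> (quat \<Rightarrow> quat)) set" where
  "semi_regular W = {(D, f). D \<subseteq> W \<and> open D \<and> circular D \<and> slice_regular D f \<and>
     (\<forall>p\<in>W - D. \<exists>U m h. open U \<and> circular U \<and> p \<in> U \<and> U \<subseteq> W \<and> U - sphere_of p \<subseteq> D \<and>
        slice_regular U h \<and> (\<forall>q\<in>U - sphere_of p. h q = Delta p q ^ m * f q))}"

definition sem_eq ::
  "quat set \<Rightarrow> ((quat set \<times> (quat \<Rightarrow> quat)) \<times> (quat set \<times> (quat \<Rightarrow> quat))) set" where
  "sem_eq W = {((A, f), (B, g)). (A, f) \<in> semi_regular W \<and> (B, g) \<in> semi_regular W \<and>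
     (\<forall>q\<in>A \<inter> B. f q = g q)}"

type_synonym sem = "(quat set \<times> (quat \<Rightarrow> quat)) set"

definition sem_class :: "quat set \<Rightarrow> quat set \<Rightarrow> (quat \<Rightarrow> quat) \<Rightarrow> sem" where
  "sem_class W D f = sem_eq W `` {(D, f)}"

definition sem_const :: "quat set \<Rightarrow> quat \<Rightarrow> sem" where
  "sem_const W c = sem_class W W (\<lambda>_. c)"

definition SEM :: "quat set \<Rightarrow> sem ring" where
  "SEM W = \<lparr>
     carrier = semi_regular W // sem_eq W,
     mult = (\<lambda>X Y. \<Union>(A, f)\<in>X. \<Union>(B, g)\<in>Y. sem_class W (A \<inter> B) (star_prod f g)),
     one = sem_const W 1,
     zero = sem_const W 0,
     add = (\<lambda>X Y. \<Union>(A, f)\<in>X. \<Union>(B, g)\<in>Y. sem_class W (A \<inter> B) (\<lambda>q. f q + g q))\<rparr>"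

definition SEM_R :: "quat set \<Rightarrow> sem set" where
  "SEM_R W = {X \<in> carrier (SEM W). \<exists>(D, f)\<in>X. slice_preserving D f}"

text \<open>
  The regular conjugate is defined through the coordinates with respect to the standard basis
  \<open>1, i, j, k\<close>; any other orthonormal basis \<open>1, I, J, K\<close> gives the same function.
\<close>
definition sem_conj :: "quat set \<Rightarrow> sem \<Rightarrow> sem" where
  "sem_conj W f = (THE c. \<exists>f0\<in>SEM_R W. \<exists>f1\<in>SEM_R W. \<exists>f2\<in>SEM_R W. \<exists>f3\<in>SEM_R W.
     let v = f1 \<otimes>\<^bsub>SEM W\<^esub> sem_const W (Quat 0 1 0 0) \<oplus>\<^bsub>SEM W\<^esub>
             f2 \<otimes>\<^bsub>SEM W\<^esub> sem_const W (Quat 0 0 1 0) \<oplus>\<^bsub>SEM W\<^esub>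
             f3 \<otimes>\<^bsub>SEM W\<^esub> sem_const W (Quat 0 0 0 1)
     in f = f0 \<oplus>\<^bsub>SEM W\<^esub> v \<and> c = f0 \<ominus>\<^bsub>SEM W\<^esub> v)"

definition sem_symm :: "quat set \<Rightarrow> sem \<Rightarrow> sem" where
  "sem_symm W f = f \<otimes>\<^bsub>SEM W\<^esub> sem_conj W f"

definition sem_scal :: "quat set \<Rightarrow> sem \<Rightarrow> sem" where
  "sem_scal W f = sem_const W (1/2) \<otimes>\<^bsub>SEM W\<^esub> (f \<oplus>\<^bsub>SEM W\<^esub> sem_conj W f)"

definition sem_vec :: "quat set \<Rightarrow> sem \<Rightarrow> sem" where
  "sem_vec W f = f \<ominus>\<^bsub>SEM W\<^esub> sem_scal W f"

definition sylvester :: "quat set \<Rightarrow> sem \<Rightarrow> sem \<Rightarrow> sem \<Rightarrow> sem" where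
  "sylvester W f g h = f \<otimes>\<^bsub>SEM W\<^esub> h \<oplus>\<^bsub>SEM W\<^esub> h \<otimes>\<^bsub>SEM W\<^esub> g"


section \<open>Linear operators on a ring over a subfield\<close>

text \<open>
  \<open>R\<close> is a ring and \<open>K\<close> a subfield of \<open>R\<close>, so that \<open>R\<close> is a (left) vector space over \<open>K\<close>, as in the
  theory of embedded algebras.
\<close>

definition linear_op :: "('a, 'b) ring_scheme \<Rightarrow> 'a set \<Rightarrow> ('a \<Rightarrow> 'a) \<Rightarrow> bool" where
  "linear_op R K T \<longleftrightarrow> T \<in> carrier R \<rightarrow> carrier R \<and>
     (\<forall>x\<in>carrier R. \<forall>y\<in>carrier R. T (x \<oplus>\<^bsub>R\<^esub> y) = T x \<oplus>\<^bsub>R\<^esub> T y) \<and>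
     (\<forall>a\<in>K. \<forall>x\<in>carrier R. T (a \<otimes>\<^bsub>R\<^esub> x) = a \<otimes>\<^bsub>R\<^esub> T x)"

definition linear_iso :: "('a, 'b) ring_scheme \<Rightarrow> 'a set \<Rightarrow> ('a \<Rightarrow> 'a) \<Rightarrow> bool" where
  "linear_iso R K T \<longleftrightarrow> linear_op R K T \<and> bij_betw T (carrier R) (carrier R)"

definition op_rank :: "('a, 'b) ring_scheme \<Rightarrow> 'a set \<Rightarrow> ('a \<Rightarrow> 'a) \<Rightarrow> nat" where
  "op_rank R K T = (THE n. ring.dimension R n K (T ` carrier R))"

definition is_basis :: "('a, 'b) ring_scheme \<Rightarrow> 'a set \<Rightarrow> 'a list \<Rightarrow> bool" where
  "is_basis R K Us \<longleftrightarrow> ring.independent R K Us \<and> ring.Span R K Us = carrier R"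

definition coords :: "('a, 'b) ring_scheme \<Rightarrow> 'a set \<Rightarrow> 'a list \<Rightarrow> 'a \<Rightarrow> 'a list" where
  "coords R K Us v = (THE Ks. set Ks \<subseteq> K \<and> length Ks = length Us \<and> ring.combine R Ks Us = v)"

definition op_matrix ::
  "('a, 'b) ring_scheme \<Rightarrow> 'a set \<Rightarrow> 'a list \<Rightarrow> ('a \<Rightarrow> 'a) \<Rightarrow> nat \<Rightarrow> nat \<Rightarrow> 'a" where
  "op_matrix R K Us T i j = coords R K Us (T (Us ! j)) ! i"

definition cring_det :: "('a, 'b) ring_scheme \<Rightarrow> nat \<Rightarrow> (nat \<Rightarrow> nat \<Rightarrow> 'a) \<Rightarrow> 'a" where
  "cring_det R n A = (\<Oplus>\<^bsub>R\<^esub>p\<in>{p. p permutes {..<n}}.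
     (let t = (\<Otimes>\<^bsub>R\<^esub>i\<in>{..<n}. A i (p i)) in if evenperm p then t else \<ominus>\<^bsub>R\<^esub> t))"

text \<open>
  The polynomial \<open>det (T - X)\<close> in \<open>K[X]\<close>; it does not depend on the basis chosen.
\<close>
definition op_charpoly :: "('a, 'b) ring_scheme \<Rightarrow> 'a set \<Rightarrow> ('a \<Rightarrow> 'a) \<Rightarrow> nat \<Rightarrow> 'a" where
  "op_charpoly R K T =
     (let P = UP (R\<lparr>carrier := K\<rparr>);
          Us = (SOME Us. is_basis R K Us)
      in cring_det P (length Us)
           (\<lambda>i j. monom P (op_matrix R K Us T i j) 0 \<ominus>\<^bsub>P\<^esub> (if i = j then monom P \<one>\<^bsub>R\<^esub> 1 else \<zero>\<^bsub>P\<^esub>)))"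

end

theory Submission
  imports
    Defs
    "HOL-Complex_Analysis.Complex_Analysis"
    "Jordan_Normal_Form.Determinant"
begin

text \<open>
A slice function sends \<open>x + I y\<close> to \<open>F1 x y + I F2 x y\<close>.  Reading \<open>F1 + i F2\<close> as a quaternion with
complex coordinates gives its \<^emph>\<open>stem function\<close>, a function of the complex variable \<open>x + i y\<close> that
commutes with conjugation.  In these terms slice regularity says that the four coordinates are
holomorphic, and the star product is the pointwise product of complexified quaternions
(\<open>slice_regular_imp_holomorphic\<close>, \<open>holomorphic_imp_slice_regular\<close>, \<open>star_prod_lift\<close>).  A power of
\<open>\<Delta>\<^sub>p\<close> clears a pole along a sphere exactly when a power of \<open>(w - z) (w - cnj z)\<close> clears the poles of
the coordinates, so semi-regular functions correspond to stem functions with meromorphic coordinates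
(\<open>semi_regular_imp_meromorphic_stem\<close>, \<open>meromorphic_stem_imp_semi_regular\<close>).

Fix a point of the complex profile of the domain and expand the stem function there in a Laurent
series.  The domain is connected, so the identity principle shows that the expansion determines the
class of the function.  This embeds the ring of semi-regular functions into the quaternions over the
field of formal Laurent series.  The image consists of the quaternions whose coordinates lie in a
certain subfield (closed under inverses because \<open>1/\<psi>\<close> is meromorphic with \<open>\<psi>\<close>), and slice preserving
functions correspond to the scalars (\<open>SEM_coords\<close>).  Ring axioms, the field property and the coordinate
formulas for conjugation and symmetrization are all read off from this embedding.

What remains is linear algebra over a field, done in \<open>sylvester_operator\<close>.  Let \<open>s = f\<^sub>0 + g\<^sub>0\<close>, let \<open>a\<close>
and \<open>b\<close> be the squared lengths of the vector parts \<open>u\<close> and \<open>v\<close> of \<open>f\<close> and \<open>g\<close>, and put \<open>Y x = u x + x v\<close>,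
so that the operator is \<open>s + Y\<close>.
  \<^item> Since \<open>u\<^sup>2 = - a\<close> and \<open>v\<^sup>2 = - b\<close>, the operator \<open>Z = Y\<^sup>2 + a + b\<close> is \<open>x \<mapsto> 2 u x v\<close> and \<open>Z\<^sup>2 = 4 a b\<close>.
    Therefore \<open>(s + Y) (s - Y) (s\<^sup>2 + a + b + Z) = (s\<^sup>2 + a + b)\<^sup>2 - 4 a b\<close>, which is the constant
    term of the claimed polynomial.  This yields the inverse whenever that constant is not zero.
  \<^item> The determinant of the operator in the basis \<open>1, i, j, k\<close> is that constant.  The characteristic
    polynomial is the same determinant with \<open>s - X\<close> in place of \<open>s\<close>, and any other basis gives a
    similar matrix.
  \<^item> If the rank were at most one, all \<open>2 \<times> 2\<close> minors of the matrix would vanish.  This forces \<open>s = 0\<close>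
    and then \<open>u = v = 0\<close>, whereas \<open>u \<noteq> 0\<close> for an \<open>f\<close> that is not slice preserving.
\<close>

hide_const (open) Polynomial.monom Polynomial.coeff

section \<open>Quaternions over a commutative ring\<close>

text \<open>
The coefficient ring varies: complex numbers for the values of stem functions, formal Laurent series
for germs, and polynomials over these for characteristic polynomials.
\<close>

datatype 'a ham = Ham (h0: 'a) (h1: 'a) (h2: 'a) (h3: 'a)

lemma ham_eq_iff: "x = y \<longleftrightarrow> h0 x = h0 y \<and> h1 x = h1 y \<and> h2 x = h2 y \<and> h3 x = h3 y"
  by (auto intro: ham.expand)

instantiation ham :: (comm_ring_1) ring_1
begin

definition "0 = Ham 0 0 0 0"
definition "1 = Ham 1 0 0 0"
definition "x + y = Ham (h0 x + h0 y) (h1 x + h1 y) (h2 x + h2 y) (h3 x + h3 y)"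
definition "- x = Ham (- h0 x) (- h1 x) (- h2 x) (- h3 x)"
definition "x - y = Ham (h0 x - h0 y) (h1 x - h1 y) (h2 x - h2 y) (h3 x - h3 y)"
definition "x * y = Ham
  (h0 x * h0 y - h1 x * h1 y - h2 x * h2 y - h3 x * h3 y)
  (h0 x * h1 y + h1 x * h0 y + h2 x * h3 y - h3 x * h2 y)
  (h0 x * h2 y - h1 x * h3 y + h2 x * h0 y + h3 x * h1 y)
  (h0 x * h3 y + h1 x * h2 y - h2 x * h1 y + h3 x * h0 y)"

instance
  by standard
    (simp_all add: ham_eq_iff zero_ham_def one_ham_def plus_ham_def uminus_ham_def minus_ham_def
      times_ham_def algebra_simps)

end

lemma ham_sel_simps [simp]:
  "h0 0 = 0" "h1 0 = 0" "h2 0 = 0" "h3 0 = 0"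
  "h0 1 = 1" "h1 1 = 0" "h2 1 = 0" "h3 1 = 0"
  "h0 (x + y) = h0 x + h0 y" "h1 (x + y) = h1 x + h1 y"
  "h2 (x + y) = h2 x + h2 y" "h3 (x + y) = h3 x + h3 y"
  "h0 (- x) = - h0 x" "h1 (- x) = - h1 x" "h2 (- x) = - h2 x" "h3 (- x) = - h3 x"
  "h0 (x - y) = h0 x - h0 y" "h1 (x - y) = h1 x - h1 y"
  "h2 (x - y) = h2 x - h2 y" "h3 (x - y) = h3 x - h3 y"
  by (simp_all add: zero_ham_def one_ham_def plus_ham_def uminus_ham_def minus_ham_def)

lemma ham_sel_times:
  "h0 (x * y) = h0 x * h0 y - h1 x * h1 y - h2 x * h2 y - h3 x * h3 y"
  "h1 (x * y) = h0 x * h1 y + h1 x * h0 y + h2 x * h3 y - h3 x * h2 y"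
  "h2 (x * y) = h0 x * h2 y - h1 x * h3 y + h2 x * h0 y + h3 x * h1 y"
  "h3 (x * y) = h0 x * h3 y + h1 x * h2 y - h2 x * h1 y + h3 x * h0 y"
  by (simp_all add: times_ham_def)

definition scal :: "'a::comm_ring_1 \<Rightarrow> 'a ham" where
  "scal a = Ham a 0 0 0"

lemma scal_sel [simp]:
  "h0 (scal a) = a" "h1 (scal a) = 0" "h2 (scal a) = 0" "h3 (scal a) = 0"
  by (simp_all add: scal_def)

lemma scal_simps [simp]: "scal 0 = 0" "scal 1 = 1"
  by (simp_all add: ham_eq_iff)

lemma scal_hom:
  "scal (a + b) = scal a + scal b" "scal (a * b) = scal a * scal b"
  "scal (- a) = - scal a" "scal (a - b) = scal a - scal b"
  by (simp_all add: ham_eq_iff ham_sel_times)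

lemma scal_left_commute: "scal a * (scal b * x) = scal b * (scal a * x)"
  by (simp add: ham_eq_iff ham_sel_times algebra_simps)

lemma scal_mult_sel [simp]:
  "h0 (scal a * x) = a * h0 x" "h1 (scal a * x) = a * h1 x"
  "h2 (scal a * x) = a * h2 x" "h3 (scal a * x) = a * h3 x"
  by (simp_all add: ham_sel_times)

lemma scal_eq_iff [simp]: "scal a = scal b \<longleftrightarrow> a = b"
  by (simp add: ham_eq_iff)

definition ham_coord :: "nat \<Rightarrow> 'a ham \<Rightarrow> 'a" where
  "ham_coord i x = [h0 x, h1 x, h2 x, h3 x] ! i"

definition ham_unit :: "nat \<Rightarrow> 'a::comm_ring_1 ham" where
  "ham_unit j = Ham (of_bool (j = 0)) (of_bool (j = 1)) (of_bool (j = 2)) (of_bool (j = 3))"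

lemma less_4_cases: "i < 4 \<longleftrightarrow> i = 0 \<or> i = 1 \<or> i = 2 \<or> i = (3::nat)"
  by auto

lemma sum_lessThan_4: "(\<Sum>i<4. t i) = t 0 + t 1 + t 2 + t (3::nat)" for t :: "nat \<Rightarrow> 'a::comm_monoid_add"
  by (simp add: numeral_eq_Suc add.assoc)

lemma ham_coord_simps [simp]:
  "ham_coord 0 x = h0 x" "ham_coord 1 x = h1 x" "ham_coord (Suc 0) x = h1 x"
  "ham_coord 2 x = h2 x" "ham_coord 3 x = h3 x"
  by (simp_all add: ham_coord_def)

lemma ham_unit_sel [simp]:
  "h0 (ham_unit j) = of_bool (j = 0)" "h1 (ham_unit j) = of_bool (j = 1)"
  "h2 (ham_unit j) = of_bool (j = 2)" "h3 (ham_unit j) = of_bool (j = 3)"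
  by (simp_all add: ham_unit_def)

lemma ham_coord_linear:
  assumes "i < 4"
  shows "ham_coord i (x + y) = ham_coord i x + ham_coord i y" "ham_coord i (scal a * x) = a * ham_coord i x" "ham_coord i 0 = 0"
    "ham_coord i (ham_unit j) = of_bool (i = j)"
  using assms by (auto simp: less_4_cases)

lemma ham_coord_sum: "i < 4 \<Longrightarrow> ham_coord i (\<Sum>x\<in>A. t x) = (\<Sum>x\<in>A. ham_coord i (t x))"
  by (induction A rule: infinite_finite_induct) (auto simp: ham_coord_linear)

lemma ham_expansion: "x = (\<Sum>j<4. scal (ham_coord j x) * ham_unit j)"
  by (simp add: sum_lessThan_4 ham_eq_iff)

definition hvec :: "'a::comm_ring_1 ham \<Rightarrow> 'a ham" where
  "hvec x = Ham 0 (h1 x) (h2 x) (h3 x)"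

text \<open>
The symmetrization \<open>x\<^sub>v * x\<^sub>v\<^sup>c\<close> of the vector part, written as a scalar.
\<close>

definition vnorm :: "'a::comm_ring_1 ham \<Rightarrow> 'a" where
  "vnorm x = (h1 x)\<^sup>2 + (h2 x)\<^sup>2 + (h3 x)\<^sup>2"

definition sylv :: "'a::comm_ring_1 ham \<Rightarrow> 'a ham \<Rightarrow> 'a ham \<Rightarrow> 'a ham" where
  "sylv f g x = f * x + x * g"

lemma hvec_sel [simp]: "h0 (hvec x) = 0" "h1 (hvec x) = h1 x" "h2 (hvec x) = h2 x" "h3 (hvec x) = h3 x"
  by (simp_all add: hvec_def)

text \<open>
The value of the characteristic polynomial at \<open>0\<close>; it is the determinant of \<open>sylv f g\<close> by \<open>det_sylv\<close>
below.
\<close>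

definition sylv_det :: "'a::comm_ring_1 ham \<Rightarrow> 'a ham \<Rightarrow> 'a" where
  "sylv_det f g = (h0 f + h0 g)\<^sup>2 * ((h0 f + h0 g)\<^sup>2 + 2 * (vnorm f + vnorm g)) + (vnorm f - vnorm g)\<^sup>2"

text \<open>
The operator \<open>(s - Y) (s\<^sup>2 + a + b + Z)\<close>, where \<open>Y x = u x + x v\<close> and \<open>Z x = 2 u x v\<close> for the vector parts
\<open>u\<close>, \<open>v\<close> of \<open>f\<close>, \<open>g\<close>.  It plays the role of the adjugate of \<open>sylv f g\<close>.
\<close>

definition sylv_adj :: "'a::comm_ring_1 ham \<Rightarrow> 'a ham \<Rightarrow> 'a ham \<Rightarrow> 'a ham" where
  "sylv_adj f g x =
     (let s = h0 f + h0 g;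
          y = scal (s\<^sup>2 + vnorm f + vnorm g) * x + scal 2 * (hvec f * x * hvec g)
      in scal s * y - sylv (hvec f) (hvec g) y)"

lemma sylv_scal_add: "sylv f g x = scal (h0 f + h0 g) * x + sylv (hvec f) (hvec g) x"
  by (simp add: sylv_def ham_eq_iff ham_sel_times algebra_simps)

text \<open>
The identity \<open>(s - Y) (s + Y) = s\<^sup>2 - Y\<^sup>2\<close>, with \<open>Y\<^sup>2\<close> evaluated by \<open>u\<^sup>2 = - a\<close> and \<open>v\<^sup>2 = - b\<close>.
\<close>

lemma sylv_conj_mult:
  fixes f g x :: "'a::comm_ring_1 ham"
  defines "s \<equiv> h0 f + h0 g"
  defines "c \<equiv> s\<^sup>2 + vnorm f + vnorm g"
  shows "scal s * sylv f g x - sylv (hvec f) (hvec g) (sylv f g x) =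
         scal c * x - scal 2 * (hvec f * x * hvec g)"
    and "sylv f g (scal s * x - sylv (hvec f) (hvec g) x) =
         scal c * x - scal 2 * (hvec f * x * hvec g)"
  by (simp_all add: sylv_scal_add[of f g] s_def c_def)
    (simp_all add: vnorm_def sylv_def ham_eq_iff ham_sel_times algebra_simps power2_eq_square)

lemma double_sandwich:
  fixes f g x :: "'a::comm_ring_1 ham"
  shows "hvec f * (hvec f * x * hvec g) * hvec g = scal (vnorm f * vnorm g) * x"
proof -
  have sq: "hvec z * hvec z = scal (- vnorm z)" for z :: "'a ham"
    by (simp add: ham_eq_iff ham_sel_times vnorm_def power2_eq_square algebra_simps)
  have comm: "x * scal b = scal b * x" for b
    by (simp add: ham_eq_iff ham_sel_times algebra_simps)
  have "hvec f * (hvec f * x * hvec g) * hvec g = (hvec f * hvec f) * (x * (hvec g * hvec g))"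
    by (simp only: mult.assoc)
  also have "\<dots> = scal (- vnorm f) * (scal (- vnorm g) * x)"
    by (simp only: sq comm)
  also have "\<dots> = scal (vnorm f * vnorm g) * x"
    by (simp add: ham_eq_iff algebra_simps)
  finally show ?thesis .
qed

definition qconj :: "'a::comm_ring_1 ham \<Rightarrow> 'a ham" where
  "qconj x = Ham (h0 x) (- h1 x) (- h2 x) (- h3 x)"

lemma hvec_times_qconj: "hvec x * qconj (hvec x) = scal (vnorm x)"
  by (simp add: qconj_def ham_eq_iff ham_sel_times vnorm_def power2_eq_square algebra_simps)

lemma sylv_linear:
  "sylv f g (x + y) = sylv f g x + sylv f g y" "sylv f g (scal a * x) = scal a * sylv f g x"
  "sylv f g (x - y) = sylv f g x - sylv f g y" "sylv f g 0 = 0"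
  by (simp_all add: sylv_def ham_eq_iff ham_sel_times algebra_simps)

lemma sylv_adj:
  fixes f g x :: "'a::comm_ring_1 ham"
  shows "sylv f g (sylv_adj f g x) = scal (sylv_det f g) * x" (is ?A)
    and "sylv_adj f g (sylv f g x) = scal (sylv_det f g) * x" (is ?B)
proof -
  define s where "s = h0 f + h0 g"
  define c where "c = s\<^sup>2 + vnorm f + vnorm g"
  define z where "z y = scal 2 * (hvec f * y * hvec g)" for y
  have zz: "z (z y) = scal (4 * vnorm f * vnorm g) * y" for y
  proof -
    have "z (z y) = scal 4 * (hvec f * (hvec f * y * hvec g) * hvec g)"
      by (simp add: z_def ham_eq_iff ham_sel_times algebra_simps)
    then show ?thesis unfolding double_sandwich by (simp add: scal_hom mult.assoc)
  qed
  have z_lin: "z (scal b * y) = scal b * z y" "z (u - y) = z u - z y" "z (u + y) = z u + z y" for b u y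
    by (simp_all add: z_def ham_eq_iff ham_sel_times algebra_simps)
  have d: "sylv_det f g = c * c - 4 * vnorm f * vnorm g"
    by (simp add: sylv_det_def c_def s_def power2_eq_square algebra_simps)
  have fact: "scal c * (scal c * y - z y) + z (scal c * y - z y) = scal (sylv_det f g) * y" for y
    by (simp add: z_lin zz d scal_hom algebra_simps)
  have sylv_z: "sylv (hvec f) (hvec g) (z u) = z (sylv (hvec f) (hvec g) u)" for u
  proof -
    have c2: "u * scal 2 = scal 2 * u" for u :: "'a ham"
      by (simp add: ham_eq_iff ham_sel_times algebra_simps)
    show ?thesis
      by (simp add: z_def sylv_def distrib_left distrib_right mult.assoc[symmetric] c2)
  qed
  have adj: "sylv_adj f g y = scal s * (scal c * y + z y) - sylv (hvec f) (hvec g) (scal c * y + z y)" for y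
    by (simp add: sylv_adj_def s_def c_def z_def Let_def)
  have "sylv f g (sylv_adj f g x) = scal c * (scal c * x + z x) - z (scal c * x + z x)"
    unfolding adj s_def c_def z_def by (rule sylv_conj_mult(2))
  also have "\<dots> = scal (sylv_det f g) * x"
    by (simp add: z_lin zz d scal_hom algebra_simps mult.assoc)
  finally show ?A .
  have "sylv_adj f g (sylv f g x) =
      scal c * (scal s * sylv f g x - sylv (hvec f) (hvec g) (sylv f g x)) +
      z (scal s * sylv f g x - sylv (hvec f) (hvec g) (sylv f g x))"
    unfolding adj
    by (simp add: sylv_linear sylv_z z_lin distrib_left right_diff_distrib scal_left_commute[of s c])
  also have "scal s * sylv f g x - sylv (hvec f) (hvec g) (sylv f g x) = scal c * x - z x"
    unfolding s_def c_def z_def by (rule sylv_conj_mult(1))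
  also note fact
  finally show ?B .
qed

text \<open>
The columns of the matrix of the operator are its values on \<open>1, i, j, k\<close>.
\<close>

lemma sylv_entries:
  assumes "i < 4"
  shows "(\<Sum>l<4. ham_coord i (sylv f g (ham_unit l)) * ham_coord l x) = ham_coord i (sylv f g x)"
proof -
  have sum: "sylv f g (\<Sum>l<4. scal (ham_coord l x) * ham_unit l) = (\<Sum>l<4. scal (ham_coord l x) * sylv f g (ham_unit l))"
    by (simp add: sum_lessThan_4 sylv_linear)
  have "ham_coord i (sylv f g x) = ham_coord i (\<Sum>l<4. scal (ham_coord l x) * sylv f g (ham_unit l))"
    unfolding sum[symmetric] by (simp flip: ham_expansion)
  also have "\<dots> = (\<Sum>l<4. ham_coord i (sylv f g (ham_unit l)) * ham_coord l x)"
    using assms by (simp add: ham_coord_sum ham_coord_linear mult.commute)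
  finally show ?thesis by (rule sym)
qed

text \<open>
In the basis \<open>1, i, j, k\<close> the matrix is
\<open>s\<close> on the diagonal, \<open>p = u + v\<close> in the first column and \<open>- p\<close> in the first row, and the cross product with
\<open>d = u - v\<close> in the remaining block.  Proportional columns make all \<open>2 \<times> 2\<close> minors vanish.  The minors on
the diagonal give \<open>s\<^sup>2 = - p\<^sub>i\<^sup>2 = - d\<^sub>i\<^sup>2\<close>; two further ones give \<open>s d\<^sub>3 = p\<^sub>1 p\<^sub>2\<close> and \<open>s d\<^sub>3 = - p\<^sub>1 p\<^sub>2\<close>.
Hence \<open>s = 0\<close>, and then \<open>p = d = 0\<close>.  Sums of squares may vanish nontrivially here, so an argument by
positivity is not available.
\<close>

lemma sylv_not_rank_one:
  fixes f g w :: "'a::field_char_0 ham"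
  assumes "\<And>j. j < 4 \<Longrightarrow> \<exists>k. sylv f g (ham_unit j) = scal k * w"
  shows "f = scal (h0 f)"
proof -
  define s p1 p2 p3 d1 d2 d3
    where defs: "s = h0 f + h0 g" "p1 = h1 f + h1 g" "p2 = h2 f + h2 g" "p3 = h3 f + h3 g"
      "d1 = h1 f - h1 g" "d2 = h2 f - h2 g" "d3 = h3 f - h3 g"
  obtain k0 k1 k2 k3 where k: "sylv f g (ham_unit 0) = scal k0 * w" "sylv f g (ham_unit 1) = scal k1 * w"
      "sylv f g (ham_unit 2) = scal k2 * w" "sylv f g (ham_unit 3) = scal k3 * w"
    using assms[of 0] assms[of 1] assms[of 2] assms[of 3] by auto
  have c0: "s = k0 * h0 w" "p1 = k0 * h1 w" "p2 = k0 * h2 w" "p3 = k0 * h3 w"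
    using k(1) by (simp_all add: ham_eq_iff sylv_def ham_sel_times defs algebra_simps)
  have c1: "- p1 = k1 * h0 w" "s = k1 * h1 w" "d3 = k1 * h2 w" "- d2 = k1 * h3 w"
    using k(2) by (simp_all add: ham_eq_iff sylv_def ham_sel_times defs algebra_simps)
  have c2: "- p2 = k2 * h0 w" "- d3 = k2 * h1 w" "s = k2 * h2 w" "d1 = k2 * h3 w"
    using k(3) by (simp_all add: ham_eq_iff sylv_def ham_sel_times defs algebra_simps)
  have c3: "- p3 = k3 * h0 w" "d2 = k3 * h1 w" "- d1 = k3 * h2 w" "s = k3 * h3 w"
    using k(4) by (simp_all add: ham_eq_iff sylv_def ham_sel_times defs algebra_simps)
  have minor: "a * d = b * c" if "a = i * x" "b = i * y" "c = k * x" "d = k * y" for a b c d i k x y :: 'a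
    using that by simp
  have m: "s * s = p1 * - p1" "s * s = p2 * - p2" "s * s = p3 * - p3"
      "s * s = d1 * - d1" "s * s = d2 * - d2" "s * s = d3 * - d3"
    using minor[OF c0(1,2) c1(1,2)] minor[OF c0(1,3) c2(1,3)] minor[OF c0(1,4) c3(1,4)]
      minor[OF c2(3,4) c3(3,4)] minor[OF c1(2,4) c3(2,4)] minor[OF c1(2,3) c2(2,3)]
    by (simp_all add: mult.commute)
  have n: "s * - d3 = p1 * - p2" "s * d3 = p2 * - p1"
    using minor[OF c0(1,2) c2(1,2)] minor[OF c0(1,3) c1(1,3)] by (simp_all add: mult.commute)
  have "s = 0"
  proof (rule ccontr)
    assume "s \<noteq> 0"
    have "s * d3 + s * d3 = 0" using n by (simp add: mult.commute)
    then have "2 * (s * d3) = 0" by (simp only: mult_2)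
    then have "d3 = 0" using \<open>s \<noteq> 0\<close> by simp
    then show False using m(6) \<open>s \<noteq> 0\<close> by simp
  qed
  then have "p1 = 0" "p2 = 0" "p3 = 0" "d1 = 0" "d2 = 0" "d3 = 0"
    using m by auto
  then have "p1 + d1 = 0" "p2 + d2 = 0" "p3 + d3 = 0" by simp_all
  then have "2 * h1 f = 0" "2 * h2 f = 0" "2 * h3 f = 0"
    unfolding defs by (simp_all add: algebra_simps)
  then show ?thesis by (simp add: ham_eq_iff)
qed

section \<open>The determinant of the Sylvester operator\<close>

lemma sum_lessThan_3: "(\<Sum>i<3. t i) = t 0 + t 1 + t (2::nat)" for t :: "nat \<Rightarrow> 'a::comm_monoid_add"
  by (simp add: numeral_eq_Suc add.assoc)

lemma mat_delete_index':
  assumes "A \<in> carrier_mat (Suc n) (Suc n)" "i < n" "j < n"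
  shows "mat_delete A k l $$ (i, j) = A $$ (if i < k then i else Suc i, if j < l then j else Suc j)"
  using assms by (auto simp: mat_delete_def)

lemma det_2:
  fixes A :: "'a::comm_ring_1 mat"
  assumes A: "A \<in> carrier_mat 2 2"
  shows "det A = A $$ (0,0) * A $$ (1,1) - A $$ (0,1) * A $$ (1,0)"
proof -
  have A': "A \<in> carrier_mat (Suc 1) (Suc 1)" using A by (simp add: numeral_2_eq_2)
  have md: "mat_delete A 0 l \<in> carrier_mat 1 1" for l
    using mat_delete_carrier[of A 2 2 0 l] A by simp
  have d: "det (mat_delete A 0 l) = mat_delete A 0 l $$ (0, 0)" for l
    using det_single[of "mat_delete A 0 l"] md by simp
  have sum2: "(\<Sum>i<2. t i) = t 0 + t (1::nat)" for t :: "nat \<Rightarrow> 'a"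
    by (simp add: numeral_eq_Suc)
  show ?thesis
    unfolding laplace_expansion_row[OF A, of 0, simplified] sum2 cofactor_def d
    by (simp add: mat_delete_index'[OF A'])
qed

lemma det_3:
  fixes A :: "'a::comm_ring_1 mat"
  assumes A: "A \<in> carrier_mat 3 3"
  shows "det A =
    A $$ (0,0) * (A $$ (1,1) * A $$ (2,2) - A $$ (1,2) * A $$ (2,1))
  - A $$ (0,1) * (A $$ (1,0) * A $$ (2,2) - A $$ (1,2) * A $$ (2,0))
  + A $$ (0,2) * (A $$ (1,0) * A $$ (2,1) - A $$ (1,1) * A $$ (2,0))"
proof -
  have A': "A \<in> carrier_mat (Suc 2) (Suc 2)" using A by simp
  have md: "mat_delete A 0 l \<in> carrier_mat 2 2" for l
    using mat_delete_carrier[of A 3 3 0 l] A by simp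
  show ?thesis
    unfolding laplace_expansion_row[OF A, of 0, simplified] sum_lessThan_3 cofactor_def det_2[OF md]
    by (simp add: mat_delete_index'[OF A'] numeral_2_eq_2 algebra_simps)
qed

lemma det_4:
  fixes A :: "'a::comm_ring_1 mat"
  assumes A: "A \<in> carrier_mat 4 4"
  shows "det A =
    A $$ (0,0) * (A $$ (1,1) * (A $$ (2,2) * A $$ (3,3) - A $$ (2,3) * A $$ (3,2))
                - A $$ (1,2) * (A $$ (2,1) * A $$ (3,3) - A $$ (2,3) * A $$ (3,1))
                + A $$ (1,3) * (A $$ (2,1) * A $$ (3,2) - A $$ (2,2) * A $$ (3,1)))
  - A $$ (0,1) * (A $$ (1,0) * (A $$ (2,2) * A $$ (3,3) - A $$ (2,3) * A $$ (3,2))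
                - A $$ (1,2) * (A $$ (2,0) * A $$ (3,3) - A $$ (2,3) * A $$ (3,0))
                + A $$ (1,3) * (A $$ (2,0) * A $$ (3,2) - A $$ (2,2) * A $$ (3,0)))
  + A $$ (0,2) * (A $$ (1,0) * (A $$ (2,1) * A $$ (3,3) - A $$ (2,3) * A $$ (3,1))
                - A $$ (1,1) * (A $$ (2,0) * A $$ (3,3) - A $$ (2,3) * A $$ (3,0))
                + A $$ (1,3) * (A $$ (2,0) * A $$ (3,1) - A $$ (2,1) * A $$ (3,0)))
  - A $$ (0,3) * (A $$ (1,0) * (A $$ (2,1) * A $$ (3,2) - A $$ (2,2) * A $$ (3,1))
                - A $$ (1,1) * (A $$ (2,0) * A $$ (3,2) - A $$ (2,2) * A $$ (3,0))
                + A $$ (1,2) * (A $$ (2,0) * A $$ (3,1) - A $$ (2,1) * A $$ (3,0)))"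
proof -
  have A': "A \<in> carrier_mat (Suc 3) (Suc 3)" using A by simp
  have md: "mat_delete A 0 l \<in> carrier_mat 3 3" for l
    using mat_delete_carrier[of A 4 4 0 l] A by simp
  show ?thesis
    unfolding laplace_expansion_row[OF A, of 0, simplified] sum_lessThan_4 cofactor_def det_3[OF md]
    by (simp add: mat_delete_index'[OF A'] eval_nat_numeral algebra_simps)
qed

text \<open>
In terms of \<open>s\<close>, \<open>p = u + v\<close> and \<open>d = u - v\<close> the determinant is
\<open>s\<^sup>2 (s\<^sup>2 + |p|\<^sup>2 + |d|\<^sup>2) + (p \<bullet> d)\<^sup>2\<close>, and \<open>|p|\<^sup>2 + |d|\<^sup>2 = 2 (a + b)\<close>, \<open>p \<bullet> d = a - b\<close>.  The ring is
arbitrary so that \<open>s\<close> may be replaced by \<open>s - X\<close>.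
\<close>

lemma det_sylv:
  fixes f g :: "'a::comm_ring_1 ham"
  shows "det (mat 4 4 (\<lambda>(i, j). ham_coord i (sylv f g (ham_unit j)))) = sylv_det f g"
proof -
  define s p1 p2 p3 d1 d2 d3
    where defs: "s = h0 f + h0 g" "p1 = h1 f + h1 g" "p2 = h2 f + h2 g" "p3 = h3 f + h3 g"
      "d1 = h1 f - h1 g" "d2 = h2 f - h2 g" "d3 = h3 f - h3 g"
  define M where "M = mat 4 4 (\<lambda>(i, j). ham_coord i (sylv f g (ham_unit j)))"
  have M: "M \<in> carrier_mat 4 4" by (simp add: M_def)
  have e: 
    "M $$ (0, 0) = s" "M $$ (0, 1) = - p1"
    "M $$ (0, 2) = - p2" "M $$ (0, 3) = - p3"
    "M $$ (1, 0) = p1" "M $$ (1, 1) = s"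
    "M $$ (1, 2) = - d3" "M $$ (1, 3) = d2"
    "M $$ (2, 0) = p2" "M $$ (2, 1) = d3"
    "M $$ (2, 2) = s" "M $$ (2, 3) = - d1"
    "M $$ (3, 0) = p3" "M $$ (3, 1) = - d2"
    "M $$ (3, 2) = d1" "M $$ (3, 3) = s"
    by (simp_all add: M_def sylv_def ham_sel_times defs algebra_simps)
  have "det M =
      s\<^sup>2 * (s\<^sup>2 + (p1\<^sup>2 + p2\<^sup>2 + p3\<^sup>2 + d1\<^sup>2 + d2\<^sup>2 + d3\<^sup>2)) + (p1 * d1 + p2 * d2 + p3 * d3)\<^sup>2"
    unfolding det_4[OF M] e by (simp add: algebra_simps power2_eq_square)
  also have "p1\<^sup>2 + p2\<^sup>2 + p3\<^sup>2 + d1\<^sup>2 + d2\<^sup>2 + d3\<^sup>2 = 2 * (vnorm f + vnorm g)"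
    unfolding defs vnorm_def by (simp add: algebra_simps power2_eq_square)
  also have "p1 * d1 + p2 * d2 + p3 * d3 = vnorm f - vnorm g"
    unfolding defs vnorm_def by (simp add: algebra_simps power2_eq_square)
  finally show ?thesis by (simp add: sylv_det_def defs M_def)
qed

section \<open>Rings and polynomial rings with a model in a type class\<close>

text \<open>
An injective homomorphism into a type-class ring whose image is closed under negation.  The ring axioms
are pulled back along it, so that identities in a carrier-based ring can be checked by computations
in a type.
\<close>

locale ring_model =
  fixes S :: "('a, 'b) ring_scheme" (structure) and h :: "'a \<Rightarrow> 'r::ring_1"
  assumes model_add_closed: "x \<in> carrier S \<Longrightarrow> y \<in> carrier S \<Longrightarrow> x \<oplus> y \<in> carrier S"
    and model_mult_closed: "x \<in> carrier S \<Longrightarrow> y \<in> carrier S \<Longrightarrow> x \<otimes> y \<in> carrier S"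
    and model_zero_closed: "\<zero> \<in> carrier S"
    and model_one_closed: "\<one> \<in> carrier S"
    and h_add: "x \<in> carrier S \<Longrightarrow> y \<in> carrier S \<Longrightarrow> h (x \<oplus> y) = h x + h y"
    and h_mult: "x \<in> carrier S \<Longrightarrow> y \<in> carrier S \<Longrightarrow> h (x \<otimes> y) = h x * h y"
    and h_zero: "h \<zero> = 0"
    and h_one: "h \<one> = 1"
    and h_inj: "inj_on h (carrier S)"
    and model_neg: "x \<in> carrier S \<Longrightarrow> \<exists>y\<in>carrier S. h y = - h x"
begin

lemmas model_closed = model_add_closed model_mult_closed model_zero_closed model_one_closed
lemmas h_hom = h_add h_mult h_zero h_one

lemma h_eqI: "h x = h y \<Longrightarrow> x \<in> carrier S \<Longrightarrow> y \<in> carrier S \<Longrightarrow> x = y"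
  using h_inj by (auto dest: inj_onD)

lemma ring_S: "ring S"
proof (rule ringI)
  show "abelian_group S"
  proof (rule abelian_groupI)
    fix x assume x: "x \<in> carrier S"
    then obtain y where "y \<in> carrier S" "h y = - h x" using model_neg by blast
    then show "\<exists>y\<in>carrier S. y \<oplus> x = \<zero>"
      using x by (intro bexI[of _ y] h_eqI) (simp_all add: h_hom model_closed)
  qed (auto intro!: h_eqI simp: h_hom model_closed algebra_simps)
  show "monoid S"
    by (rule monoidI) (auto intro!: h_eqI simp: h_hom model_closed algebra_simps)
qed (auto intro!: h_eqI simp: h_hom model_closed algebra_simps)

end

sublocale ring_model \<subseteq> ring S
  by (rule ring_S)

context ring_model
begin

lemma h_a_inv: "x \<in> carrier S \<Longrightarrow> h (\<ominus> x) = - h x"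
  using h_add[of x "\<ominus> x"] r_neg[of x] h_zero
  by (simp add: eq_neg_iff_add_eq_0 add.commute)

lemma h_minus: "x \<in> carrier S \<Longrightarrow> y \<in> carrier S \<Longrightarrow> h (x \<ominus> y) = h x - h y"
  by (simp add: a_minus_def h_add h_a_inv)

lemma h_nat_pow: "x \<in> carrier S \<Longrightarrow> h (x [^] (n::nat)) = h x ^ n"
  by (induction n) (simp_all add: h_one h_mult power_commutes)

lemma h_add_pow: "x \<in> carrier S \<Longrightarrow> h ([(n::nat)] \<cdot> x) = of_nat n * h x"
  by (induction n) (simp_all add: h_zero h_add algebra_simps)

lemma h_finsum:
  assumes "finite A" "t \<in> A \<rightarrow> carrier S"
  shows "h (finsum S t A) = (\<Sum>x\<in>A. h (t x))"
  using assms by (induction A) (simp_all add: h_zero h_add)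

lemma h_eq_iff: "x \<in> carrier S \<Longrightarrow> y \<in> carrier S \<Longrightarrow> h x = h y \<longleftrightarrow> x = y"
  using h_eqI by auto

end

locale comm_ring_model = ring_model S h
  for S :: "('a, 'b) ring_scheme" (structure) and h :: "'a \<Rightarrow> 'r::comm_ring_1"
begin

lemma cring_S: "cring S"
  by (intro cring.intro ring_S comm_monoid.intro monoid_axioms comm_monoid_axioms.intro)
     (auto intro!: h_eqI simp: h_mult mult.commute)

end

sublocale comm_ring_model \<subseteq> cring S
  by (rule cring_S)

context comm_ring_model
begin

lemma h_finprod:
  assumes "finite A" "t \<in> A \<rightarrow> carrier S"
  shows "h (finprod S t A) = (\<Prod>x\<in>A. h (t x))"
  using assms by (induction A) (simp_all add: h_one h_mult)

text \<open>
Both determinants are given by the Leibniz formula, which a homomorphism respects term by term.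
\<close>

lemma h_cring_det:
  assumes A: "\<And>i j. i < n \<Longrightarrow> j < n \<Longrightarrow> A i j \<in> carrier S"
  shows "h (cring_det S n A) = det (mat n n (\<lambda>(i, j). h (A i j)))"
    and "cring_det S n A \<in> carrier S"
proof -
  define P where "P = {p. p permutes {..<n}}"
  define t where "t p = (let t = (\<Otimes>i\<in>{..<n}. A i (p i)) in if evenperm p then t else \<ominus> t)" for p
  have fin: "finite P" unfolding P_def by (rule finite_permutations) simp
  have mem: "A i (p i) \<in> carrier S" if "p \<in> P" "i < n" for p i
    using that A permutes_in_image[of p "{..<n}" i] by (auto simp: P_def)
  have t: "t p \<in> carrier S" if "p \<in> P" for p
    using mem[OF that] by (auto simp: t_def Let_def intro!: finprod_closed)
  have ht: "h (t p) = signof p * (\<Prod>i<n. h (A i (p i)))" if "p \<in> P" for p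
  proof -
    have m: "(\<lambda>i. A i (p i)) \<in> {..<n} \<rightarrow> carrier S" using mem[OF that] by auto
    have "h (\<Otimes>i\<in>{..<n}. A i (p i)) = (\<Prod>i<n. h (A i (p i)))"
      by (rule h_finprod[OF _ m]) simp
    then show ?thesis
      using finprod_closed[OF m] by (simp add: t_def Let_def h_a_inv sign_def)
  qed
  have det_eq: "cring_det S n A = finsum S t P"
    unfolding cring_det_def P_def t_def[abs_def] ..
  show "cring_det S n A \<in> carrier S"
    unfolding det_eq using t by (intro finsum_closed) auto
  have "h (cring_det S n A) = (\<Sum>p\<in>P. signof p * (\<Prod>i<n. h (A i (p i))))"
    unfolding det_eq using t ht by (subst h_finsum[OF fin]) (auto intro: sum.cong)
  also have "\<dots> = (\<Sum>p\<in>P. signof p * (\<Prod>i = 0..<n. mat n n (\<lambda>(i, j). h (A i j)) $$ (i, p i)))"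
  proof (intro sum.cong refl arg_cong2[where f = "(*)"] prod.cong)
    fix p i assume "p \<in> P" "i \<in> {0..<n}"
    moreover from this have "p i < n" using permutes_in_image[of p "{..<n}" i] by (simp add: P_def)
    ultimately show "h (A i (p i)) = mat n n (\<lambda>(i, j). h (A i j)) $$ (i, p i)" by simp
  qed auto
  also have "\<dots> = det (mat n n (\<lambda>(i, j). h (A i j)))"
    by (simp add: det_def P_def atLeast0LessThan)
  finally show "h (cring_det S n A) = det (mat n n (\<lambda>(i, j). h (A i j)))" .
qed

text \<open>
The homomorphism \<open>K[X] \<rightarrow> 'r[X]\<close> induced by \<open>h\<close>, from polynomials as bounded sequences to the polynomial
type.
\<close>

definition poly_model :: "(nat \<Rightarrow> 'a) \<Rightarrow> 'r poly" where
  "poly_model p = Abs_poly (\<lambda>n. h (p n))"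

lemma coeff_poly_model:
  assumes "p \<in> carrier (UP S)"
  shows "Polynomial.coeff (poly_model p) n = h (p n)"
proof -
  obtain N where "bound \<zero> N p" using assms by (auto simp: UP_def up_def)
  then have "h (p n) = 0" if "n > N" for n
    using bound.bound[of \<zero> N p n] that by (simp add: h_zero)
  then have "\<forall>\<^sub>\<infinity>n. h (p n) = 0"
    unfolding MOST_nat by blast
  then show ?thesis by (simp add: poly_model_def Abs_poly_inverse)
qed

lemma coeff_UP: "p \<in> carrier (UP S) \<Longrightarrow> up_ring.coeff (UP S) p = p"
  by (simp add: UP_def)

lemma UP_apply_closed: "p \<in> carrier (UP S) \<Longrightarrow> p n \<in> carrier S"
  unfolding UP_def by (simp add: mem_upD)

lemma poly_model_monom:
  assumes "c \<in> carrier S"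
  shows "poly_model (monom (UP S) c n) = Polynomial.monom (h c) n"
proof (rule poly_eqI)
  interpret UP_ring S "UP S" by unfold_locales
  fix m
  have "monom (UP S) c n m = (if n = m then c else \<zero>)"
    using coeff_monom[OF assms, of n m] coeff_UP[OF monom_closed[OF assms]] by simp
  then show "Polynomial.coeff (poly_model (monom (UP S) c n)) m = Polynomial.coeff (Polynomial.monom (h c) n) m"
    using assms by (simp add: coeff_poly_model h_zero)
qed

lemma poly_model_comm_ring_model: "comm_ring_model (UP S) poly_model"
proof -
  interpret UP_ring S "UP S" by unfold_locales
  interpret P: ring "UP S" by (rule UP_ring)
  note [simp] = coeff_poly_model
  have add: "poly_model (p \<oplus>\<^bsub>UP S\<^esub> q) = poly_model p + poly_model q"
    if p: "p \<in> carrier (UP S)" "q \<in> carrier (UP S)" for p q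
  proof (rule poly_eqI)
    fix n
    have "(p \<oplus>\<^bsub>UP S\<^esub> q) n = p n \<oplus> q n"
      using coeff_add[OF p, of n] p by (simp add: coeff_UP)
    moreover have "p n \<in> carrier S" "q n \<in> carrier S"
      using p by (simp_all add: UP_apply_closed)
    ultimately show "Polynomial.coeff (poly_model (p \<oplus>\<^bsub>UP S\<^esub> q)) n
      = Polynomial.coeff (poly_model p + poly_model q) n"
      using p by (simp add: h_add)
  qed
  have mult: "poly_model (p \<otimes>\<^bsub>UP S\<^esub> q) = poly_model p * poly_model q"
    if p: "p \<in> carrier (UP S)" "q \<in> carrier (UP S)" for p q
  proof (rule poly_eqI)
    fix n
    have mem: "p m \<in> carrier S" "q m \<in> carrier S" for m
      using p by (simp_all add: UP_apply_closed)
    have "(p \<otimes>\<^bsub>UP S\<^esub> q) n = (\<Oplus>i\<in>{..n}. p i \<otimes> q (n - i))"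
      using coeff_mult[OF p, of n] p by (simp add: coeff_UP)
    then show "Polynomial.coeff (poly_model (p \<otimes>\<^bsub>UP S\<^esub> q)) n
      = Polynomial.coeff (poly_model p * poly_model q) n"
      using p mem by (simp add: h_finsum h_mult Polynomial.coeff_mult)
  qed
  have zero: "poly_model \<zero>\<^bsub>UP S\<^esub> = 0"
    using coeff_zero by (intro poly_eqI) (simp add: coeff_UP h_zero)
  have one: "poly_model \<one>\<^bsub>UP S\<^esub> = 1"
    using coeff_one by (intro poly_eqI) (simp add: coeff_UP h_zero h_one)
  have inj: "inj_on poly_model (carrier (UP S))"
  proof (rule inj_onI)
    fix p q assume p: "p \<in> carrier (UP S)" "q \<in> carrier (UP S)" "poly_model p = poly_model q"
    show "p = q"
    proof
      fix n
      have "h (p n) = h (q n)" using p by (metis coeff_poly_model)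
      then show "p n = q n" using p by (intro h_eqI) (simp_all add: UP_apply_closed)
    qed
  qed
  have neg: "\<exists>q\<in>carrier (UP S). poly_model q = - poly_model p" if p: "p \<in> carrier (UP S)" for p
  proof (rule bexI[of _ "\<ominus>\<^bsub>UP S\<^esub> p"])
    show "poly_model (\<ominus>\<^bsub>UP S\<^esub> p) = - poly_model p"
      using add[OF p P.a_inv_closed[OF p]] P.r_neg[OF p] zero
      by (simp add: eq_neg_iff_add_eq_0 add.commute)
  qed (use p in auto)
  show ?thesis
  proof (unfold_locales, goal_cases)
    case (1 x y) then show ?case by (rule UP_a_closed)
  next
    case (2 x y) then show ?case by (rule UP_mult_closed)
  next
    case 3 show ?case by (rule UP_zero_closed)
  next
    case 4 show ?case by (rule UP_one_closed)
  qed (fact add mult zero one inj neg)+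
qed

end

section \<open>Quaternion algebras over a subfield\<close>

lemma mat_mult_entry:
  assumes "A \<in> carrier_mat n m" "B \<in> carrier_mat m k" "i < n" "j < k"
  shows "(A * B) $$ (i, j) = (\<Sum>l<m. A $$ (i, l) * B $$ (l, j))"
  using assms by (auto simp: scalar_prod_def atLeast0LessThan intro: sum.cong)

definition pencil :: "nat \<Rightarrow> (nat \<Rightarrow> nat \<Rightarrow> 'a::comm_ring_1) \<Rightarrow> 'a poly mat" where
  "pencil n A = mat n n (\<lambda>(i, j). [:A i j:] - (if i = j then [:0, 1:] else 0))"

lemma sum_pCons_const: "(\<Sum>x\<in>A. [:t x:]) = [:\<Sum>x\<in>A. t x:]"
  by (induction A rule: infinite_finite_induct) auto

text \<open>
If \<open>N B = B A\<close> with \<open>B\<close> invertible, then \<open>(N - X) B = B (A - X)\<close>; take determinants and cancel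
\<open>det B\<close>.
\<close>

lemma det_pencil_similar:
  fixes A N B D :: "nat \<Rightarrow> nat \<Rightarrow> 'a::field"
  assumes BD: "\<And>i j. i < n \<Longrightarrow> j < n \<Longrightarrow> (\<Sum>l<n. B i l * D l j) = of_bool (i = j)"
    and NB: "\<And>i j. i < n \<Longrightarrow> j < n \<Longrightarrow> (\<Sum>l<n. N i l * B l j) = (\<Sum>l<n. B i l * A l j)"
  shows "det (pencil n A) = det (pencil n N)"
proof -
  define cst :: "(nat \<Rightarrow> nat \<Rightarrow> 'a) \<Rightarrow> 'a poly mat" where "cst M = mat n n (\<lambda>(i, j). [:M i j:])" for M
  have [simp]: "cst M \<in> carrier_mat n n" "pencil n M \<in> carrier_mat n n" for M
    by (simp_all add: cst_def pencil_def)
  have "cst B * cst D = 1\<^sub>m n"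
  proof (rule eq_matI)
    fix i j assume "i < dim_row (1\<^sub>m n)" "j < dim_col (1\<^sub>m n)"
    then have ij: "i < n" "j < n" by auto
    have "(cst B * cst D) $$ (i, j) = (\<Sum>l<n. [:B i l * D l j:])"
      using ij by (subst mat_mult_entry[of _ n n _ n]) (auto simp: cst_def mult.commute intro: sum.cong)
    then show "(cst B * cst D) $$ (i, j) = 1\<^sub>m n $$ (i, j)"
      using ij by (simp add: sum_pCons_const BD one_pCons)
  qed (simp_all add: cst_def)
  moreover have "det (cst B * cst D) = det (cst B) * det (cst D)"
    by (rule det_mult[of _ n]) simp_all
  ultimately have "det (cst B) * det (cst D) = 1" by simp
  then have nz: "det (cst B) \<noteq> 0" by auto
  have "cst B * pencil n A = pencil n N * cst B"
  proof (rule eq_matI)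
    fix i j assume "i < dim_row (pencil n N * cst B)" "j < dim_col (pencil n N * cst B)"
    then have ij: "i < n" "j < n" by (auto simp: cst_def pencil_def)
    have "(cst B * pencil n A) $$ (i, j) = (\<Sum>l<n. [:B i l:] * ([:A l j:] - (if l = j then [:0, 1:] else 0)))"
      using ij by (subst mat_mult_entry[of _ n n _ n]) (auto simp: cst_def pencil_def)
    also have "\<dots> = (\<Sum>l<n. [:B i l * A l j:] - (if l = j then [:0, B i j:] else 0))"
      by (intro sum.cong) auto
    also have "\<dots> = [:\<Sum>l<n. B i l * A l j:] - [:0, B i j:]"
      using ij by (simp add: sum_subtractf sum_pCons_const)
    also have "(\<Sum>l<n. B i l * A l j) = (\<Sum>l<n. N i l * B l j)"
      using NB[OF ij] by simp
    also have "[:\<Sum>l<n. N i l * B l j:] - [:0, B i j:] =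
        (\<Sum>l<n. [:N i l * B l j:] - (if i = l then [:0, B i j:] else 0))"
      using ij by (simp add: sum_subtractf sum_pCons_const)
    also have "\<dots> = (\<Sum>l<n. ([:N i l:] - (if i = l then [:0, 1:] else 0)) * [:B l j:])"
      by (intro sum.cong) (auto simp: algebra_simps)
    also have "\<dots> = (pencil n N * cst B) $$ (i, j)"
      using ij by (subst mat_mult_entry[of _ n n _ n]) (auto simp: cst_def pencil_def)
    finally show "(cst B * pencil n A) $$ (i, j) = (pencil n N * cst B) $$ (i, j)" .
  qed (auto simp: cst_def pencil_def)
  moreover have "det (cst B * pencil n A) = det (cst B) * det (pencil n A)"
      "det (pencil n N * cst B) = det (pencil n N) * det (cst B)"
    by (rule det_mult[of _ n]; simp)+
  ultimately have "det (cst B) * det (pencil n A) = det (pencil n N) * det (cst B)"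
    by metis
  then show ?thesis using nz by simp
qed

text \<open>
Subtracting \<open>X\<close> on the diagonal is the same as replacing the scalar part of \<open>f\<close> by \<open>f\<^sub>0 - X\<close>, hence the
formula is an instance of \<open>det_sylv\<close> over the polynomial ring.
\<close>

lemma det_pencil_sylv:
  fixes f g :: "'a::field ham"
  shows "det (pencil 4 (\<lambda>i j. ham_coord i (sylv f g (ham_unit j)))) =
    ([:h0 f + h0 g:] - [:0, 1:])\<^sup>2 * (([:h0 f + h0 g:] - [:0, 1:])\<^sup>2 + [:2 * (vnorm f + vnorm g):])
      + [:(vnorm f - vnorm g)\<^sup>2:]"
proof -
  \<comment> \<open>the indeterminate is absorbed into the scalar part of \<open>f\<close>\<close>
  define f' where "f' = Ham ([:h0 f:] - [:0, 1:]) [:h1 f:] [:h2 f:] [:h3 f:]"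
  define g' where "g' = Ham [:h0 g:] [:h1 g:] [:h2 g:] [:h3 g:]"
  have "[:ham_coord i (sylv f g (ham_unit j)):] - (if i = j then [:0, 1:] else 0) = ham_coord i (sylv f' g' (ham_unit j))"
    if "i < 4" "j < 4" for i j
    using that by (auto simp: less_4_cases f'_def g'_def sylv_def ham_sel_times)
  then have "pencil 4 (\<lambda>i j. ham_coord i (sylv f g (ham_unit j))) = mat 4 4 (\<lambda>(i, j). ham_coord i (sylv f' g' (ham_unit j)))"
    unfolding pencil_def by (intro eq_matI) auto
  then have "det (pencil 4 (\<lambda>i j. ham_coord i (sylv f g (ham_unit j)))) = sylv_det f' g'"
    by (simp add: det_sylv)
  moreover have "h0 f' + h0 g' = [:h0 f + h0 g:] - [:0, 1:]"
    by (simp add: f'_def g'_def)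
  moreover have "vnorm f' = [:vnorm f:]" "vnorm g' = [:vnorm g:]"
    by (simp_all add: f'_def g'_def vnorm_def power2_eq_square)
  moreover have "2 * ([:vnorm f:] + [:vnorm g:]) = [:2 * (vnorm f + vnorm g):]"
    by (simp add: numeral_poly)
  moreover have "([:vnorm f:] - [:vnorm g:])\<^sup>2 = [:(vnorm f - vnorm g)\<^sup>2:]"
    by (simp add: power2_eq_square)
  ultimately show ?thesis by (simp only: sylv_det_def)
qed

lemma monom_Suc0: "Polynomial.monom (c :: 'c::comm_semiring_1) (Suc 0) = [:0, c:]"
  by (simp add: Polynomial.monom_Suc monom_0)

text \<open>
A ring \<open>R\<close> with a subset \<open>K\<close>, identified by \<open>\<Psi>\<close> with the quaternions over a subfield \<open>F\<close> and its
scalars.  The target may be taken over any field containing \<open>F\<close>; this freedom allows a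
field of functions to be realized inside a fixed type.
\<close>

locale quaternion_coords = ring_model R \<Psi>
  for R :: "('a, 'b) ring_scheme" (structure) and \<Psi> :: "'a \<Rightarrow> 'f::field_char_0 ham" +
  fixes K :: "'a set" and F :: "'f set"
  assumes image: "\<Psi> ` carrier R = {q. h0 q \<in> F \<and> h1 q \<in> F \<and> h2 q \<in> F \<and> h3 q \<in> F}"
    and K_eq: "K = {x \<in> carrier R. \<exists>a. \<Psi> x = scal a}"
    and F_0: "0 \<in> F" and F_1: "1 \<in> F"
    and F_add: "a \<in> F \<Longrightarrow> b \<in> F \<Longrightarrow> a + b \<in> F"
    and F_mult: "a \<in> F \<Longrightarrow> b \<in> F \<Longrightarrow> a * b \<in> F"
    and F_uminus: "a \<in> F \<Longrightarrow> - a \<in> F"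
    and F_inverse: "a \<in> F \<Longrightarrow> inverse a \<in> F"
begin

text \<open>
The quaternions over \<open>F\<close>, that is, the image of \<open>\<Psi>\<close>.
\<close>

definition HF :: "'f ham set" where
  "HF = {q. h0 q \<in> F \<and> h1 q \<in> F \<and> h2 q \<in> F \<and> h3 q \<in> F}"

definition \<kappa> :: "'a \<Rightarrow> 'f" where
  "\<kappa> x = h0 (\<Psi> x)"

definition elem :: "'f ham \<Rightarrow> 'a" where
  "elem q = inv_into (carrier R) \<Psi> q"

lemma elem: "q \<in> HF \<Longrightarrow> elem q \<in> carrier R" "q \<in> HF \<Longrightarrow> \<Psi> (elem q) = q"
  using image by (auto simp: elem_def HF_def intro: inv_into_into f_inv_into_f)

lemma \<Psi>_in_HF: "x \<in> carrier R \<Longrightarrow> \<Psi> x \<in> HF"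
  using image by (auto simp: HF_def)

lemma F_diff: "a \<in> F \<Longrightarrow> b \<in> F \<Longrightarrow> a - b \<in> F"
  using F_add[of a "- b"] F_uminus[of b] by simp

lemmas F_closed = F_0 F_1 F_add F_mult F_uminus F_inverse F_diff

lemma HF_closed:
  "x \<in> HF \<Longrightarrow> y \<in> HF \<Longrightarrow> x * y \<in> HF" "x \<in> HF \<Longrightarrow> y \<in> HF \<Longrightarrow> x + y \<in> HF"
  "x \<in> HF \<Longrightarrow> y \<in> HF \<Longrightarrow> x - y \<in> HF" "c \<in> F \<Longrightarrow> scal c \<in> HF" "x \<in> HF \<Longrightarrow> hvec x \<in> HF"
  "ham_unit j \<in> HF" "x \<in> HF \<Longrightarrow> h0 x \<in> F" "x \<in> HF \<Longrightarrow> vnorm x \<in> F"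
  by (auto simp: HF_def ham_sel_times F_closed vnorm_def power2_eq_square of_bool_def)

lemma sylv_adj_in_HF:
  assumes "f \<in> HF" "g \<in> HF" "x \<in> HF"
  shows "sylv_adj f g x \<in> HF"
proof -
  have "1 + 1 \<in> F" by (intro F_closed)
  then have "2 \<in> F" by simp
  then show ?thesis
    using assms by (auto simp: sylv_adj_def sylv_def Let_def power2_eq_square intro!: HF_closed F_closed)
qed

lemma K_subset: "K \<subseteq> carrier R"
  by (auto simp: K_eq)

lemma \<Psi>_K: "x \<in> K \<Longrightarrow> \<Psi> x = scal (\<kappa> x)"
  by (auto simp: K_eq \<kappa>_def)

lemma K_iff: "x \<in> K \<longleftrightarrow> x \<in> carrier R \<and> \<Psi> x = scal (h0 (\<Psi> x))"
  by (auto simp: K_eq)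

lemma K_I: "x \<in> carrier R \<Longrightarrow> \<Psi> x = scal a \<Longrightarrow> x \<in> K" "\<Psi> x = scal a \<Longrightarrow> \<kappa> x = a"
  by (auto simp: K_eq \<kappa>_def)

lemma K_model: "comm_ring_model (R\<lparr>carrier := K\<rparr>) \<kappa>"
proof -
  have add: "x \<oplus> y \<in> K \<and> \<kappa> (x \<oplus> y) = \<kappa> x + \<kappa> y" if "x \<in> K" "y \<in> K" for x y
  proof -
    have "x \<in> carrier R" "y \<in> carrier R" using that K_subset by auto
    moreover have "\<Psi> (x \<oplus> y) = scal (\<kappa> x + \<kappa> y)"
      using calculation that by (simp add: h_add \<Psi>_K scal_hom)
    ultimately show ?thesis using K_I by simp
  qed
  have mult: "x \<otimes> y \<in> K \<and> \<kappa> (x \<otimes> y) = \<kappa> x * \<kappa> y" if "x \<in> K" "y \<in> K" for x y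
  proof -
    have "x \<in> carrier R" "y \<in> carrier R" using that K_subset by auto
    moreover have "\<Psi> (x \<otimes> y) = scal (\<kappa> x * \<kappa> y)"
      using calculation that by (simp add: h_mult \<Psi>_K scal_hom)
    ultimately show ?thesis using K_I by simp
  qed
  have neg': "\<ominus> x \<in> K \<and> \<kappa> (\<ominus> x) = - \<kappa> x" if "x \<in> K" for x
  proof -
    have "x \<in> carrier R" using that K_subset by auto
    moreover have "\<Psi> (\<ominus> x) = scal (- \<kappa> x)"
      using calculation that by (simp add: h_a_inv \<Psi>_K scal_hom)
    ultimately show ?thesis using K_I by simp
  qed
  have zero: "\<zero> \<in> K" "\<kappa> \<zero> = 0" using K_I[of \<zero> 0] h_zero by simp_all
  have one: "\<one> \<in> K" "\<kappa> \<one> = 1" using K_I[of \<one> 1] h_one by simp_all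
  have inj: "inj_on \<kappa> K"
  proof (rule inj_onI)
    fix x y assume "x \<in> K" "y \<in> K" "\<kappa> x = \<kappa> y"
    then show "x = y" using K_subset by (intro h_eqI) (auto simp: \<Psi>_K)
  qed
  have neg: "\<exists>y\<in>K. \<kappa> y = - \<kappa> x" if "x \<in> K" for x
    using neg'[OF that] by blast
  show ?thesis
    by unfold_locales (simp_all add: add mult zero one inj neg)
qed

sublocale Km: comm_ring_model "R\<lparr>carrier := K\<rparr>" \<kappa>
  by (rule K_model)

lemma K_inverse:
  assumes "x \<in> K" "x \<noteq> \<zero>"
  shows "elem (scal (inverse (\<kappa> x))) \<in> K" "x \<otimes> elem (scal (inverse (\<kappa> x))) = \<one>"
proof -
  have x: "x \<in> carrier R" "\<Psi> x = scal (\<kappa> x)" using assms K_subset \<Psi>_K by auto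
  have "\<kappa> x \<in> F" using \<Psi>_in_HF[OF x(1)] by (simp add: HF_def \<kappa>_def)
  then have i: "scal (inverse (\<kappa> x)) \<in> HF" by (intro HF_closed F_closed)
  then show "elem (scal (inverse (\<kappa> x))) \<in> K" by (simp add: K_iff elem)
  have "\<kappa> x \<noteq> 0" using assms x h_eqI[of x \<zero>] by (auto simp: h_zero)
  then show "x \<otimes> elem (scal (inverse (\<kappa> x))) = \<one>"
    using x i by (intro h_eqI) (simp_all add: h_hom elem model_closed flip: scal_hom(2))
qed

lemma subfield_K: "subfield K R"
proof (rule subfield_iff(1))
  let ?K = "R\<lparr>carrier := K\<rparr>"
  have "\<zero> \<noteq> \<one>" using h_zero h_one by auto
  have "Units ?K = carrier ?K - {\<zero>\<^bsub>?K\<^esub>}"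
  proof (rule equalityI; rule subsetI)
    fix x assume x: "x \<in> Units ?K"
    then obtain y where y: "x \<in> K" "y \<in> K" "y \<otimes> x = \<one>" unfolding Units_def by (simp, blast)
    have "x \<noteq> \<zero>"
    proof
      assume "x = \<zero>"
      then show False using y(3) \<open>\<zero> \<noteq> \<one>\<close> r_null[of y] y(2) K_subset by auto
    qed
    with y show "x \<in> carrier ?K - {\<zero>\<^bsub>?K\<^esub>}" by simp
  next
    fix x assume "x \<in> carrier ?K - {\<zero>\<^bsub>?K\<^esub>}"
    then have x: "x \<in> K" "x \<noteq> \<zero>" by auto
    note i = K_inverse[OF x]
    have "elem (scal (inverse (\<kappa> x))) \<otimes> x = \<one>"
      using Km.m_comm[of x "elem (scal (inverse (\<kappa> x)))"] i x(1) by simp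
    then show "x \<in> Units ?K"
      unfolding Units_def using i x(1) by (simp, blast)
  qed
  then show "field ?K" by (rule Km.cring_fieldI)
  show "K \<subseteq> carrier R" by (rule K_subset)
qed

definition std_basis :: "'a list" where
  "std_basis = map (\<lambda>j. elem (ham_unit j)) [0..<4]"

lemma std_basis:
  "length std_basis = 4" "set std_basis \<subseteq> carrier R"
  "j < 4 \<Longrightarrow> \<Psi> (std_basis ! j) = ham_unit j" "j < 4 \<Longrightarrow> std_basis ! j \<in> carrier R"
  by (auto simp: std_basis_def elem HF_closed)

lemma \<Psi>_combine:
  assumes "length Ks = length Us" "set Ks \<subseteq> K" "set Us \<subseteq> carrier R"
  shows "\<Psi> (combine Ks Us) = (\<Sum>i<length Us. scal (\<kappa> (Ks ! i)) * \<Psi> (Us ! i))"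
  using assms
proof (induction Ks Us rule: list_induct2)
  case Nil
  then show ?case by (simp add: h_zero)
next
  case (Cons k Ks u Us)
  have "set Ks \<subseteq> carrier R" "k \<in> carrier R" using Cons.prems K_subset by auto
  then have "\<Psi> (combine (k # Ks) (u # Us)) = scal (\<kappa> k) * \<Psi> u + \<Psi> (combine Ks Us)"
    using Cons.prems by (simp add: h_add h_mult \<Psi>_K)
  also have "\<dots> = scal (\<kappa> k) * \<Psi> u + (\<Sum>i<length Us. scal (\<kappa> (Ks ! i)) * \<Psi> (Us ! i))"
    using Cons by simp
  also have "\<dots> = (\<Sum>i<length (u # Us). scal (\<kappa> ((k # Ks) ! i)) * \<Psi> ((u # Us) ! i))"
    by (simp add: sum.lessThan_Suc_shift del: sum.lessThan_Suc)
  finally show ?case .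
qed

lemma is_basis_std_basis: "is_basis R K std_basis"
  unfolding is_basis_def
proof
  show "independent K std_basis"
  proof (rule ccontr)
    assume "dependent K std_basis"
    then obtain Ks where Ks: "length Ks = length std_basis" "combine Ks std_basis = \<zero>" "set Ks \<subseteq> K" "set Ks \<noteq> {\<zero>}"
      using dependent_imp_non_trivial_combine[OF subfield_K std_basis(2)] by blast
    have eq: "(\<Sum>i<4. scal (\<kappa> (Ks ! i)) * ham_unit i) = (0 :: 'f ham)"
      using \<Psi>_combine[OF Ks(1,3) std_basis(2)] Ks(2) by (simp add: std_basis h_zero)
    have "Ks ! i = \<zero>" if "i < 4" for i
    proof -
      have "ham_coord i (\<Sum>i<4. scal (\<kappa> (Ks ! i)) * ham_unit i :: 'f ham) = \<kappa> (Ks ! i)"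
        using that by (auto simp: less_4_cases sum_lessThan_4)
      then have "\<kappa> (Ks ! i) = 0" using eq that by (simp add: ham_coord_linear)
      moreover have "Ks ! i \<in> K" using Ks(1,3) that std_basis(1) by (auto simp: subset_iff)
      ultimately show ?thesis
        by (intro h_eqI) (use K_subset in \<open>auto simp: \<Psi>_K h_zero\<close>)
    qed
    then have "set Ks = {\<zero>}"
      using Ks(1) std_basis(1) by (auto simp: set_conv_nth intro!: exI[of _ 0])
    with Ks(4) show False by simp
  qed
  show "Span K std_basis = carrier R"
  proof
    show "Span K std_basis \<subseteq> carrier R"
      using Span_in_carrier[of K std_basis] K_subset std_basis(2) by auto
    show "carrier R \<subseteq> Span K std_basis"
    proof
      fix x assume x: "x \<in> carrier R"
      define Ks where "Ks = map (\<lambda>i. elem (scal (ham_coord i (\<Psi> x)))) [0..<4]"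
      have HF: "scal (ham_coord i (\<Psi> x)) \<in> HF" if "i < 4" for i
        using \<Psi>_in_HF[OF x] that by (auto simp: less_4_cases HF_def F_0)
      have Ks: "set Ks \<subseteq> K" "length Ks = length std_basis"
        using HF by (auto simp: Ks_def K_iff elem std_basis(1))
      have "\<Psi> (combine Ks std_basis) = (\<Sum>i<4. scal (ham_coord i (\<Psi> x)) * ham_unit i)"
        using \<Psi>_combine[OF Ks(2,1) std_basis(2)] HF by (simp add: std_basis Ks_def elem \<kappa>_def)
      also have "\<dots> = \<Psi> x" by (rule ham_expansion[symmetric])
      finally have "combine Ks std_basis = x"
        using Ks K_subset std_basis(2) x by (intro h_eqI combine_in_carrier) auto
      then show "x \<in> Span K std_basis"
        using Span_mem_iff_length_version[OF subfield_K std_basis(2)] Ks by auto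
    qed
  qed
qed

lemma dimension_carrier: "dimension 4 K (carrier R)"
  using is_basis_std_basis dimension_independent[of K std_basis] by (simp add: is_basis_def std_basis(1))

lemma length_basis: "is_basis R K Us \<Longrightarrow> length Us = 4"
  using independent_length_eq_dimension[OF subfield_K dimension_carrier, of Us]
    independent_in_carrier[of K Us]
  by (auto simp: is_basis_def)

lemma coords:
  assumes "is_basis R K Us" "v \<in> carrier R"
  shows "set (coords R K Us v) \<subseteq> K" "length (coords R K Us v) = 4"
    "\<Psi> v = (\<Sum>i<4. scal (\<kappa> (coords R K Us v ! i)) * \<Psi> (Us ! i))"
proof -
  have Us: "independent K Us" "Span K Us = carrier R" "length Us = 4" "set Us \<subseteq> carrier R"
    using assms length_basis independent_in_carrier[of K Us] by (auto simp: is_basis_def)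
  have "\<exists>!Ks. set Ks \<subseteq> K \<and> length Ks = length Us \<and> combine Ks Us = v"
    using unique_decomposition[OF subfield_K Us(1), of v] assms(2) Us(2) by (auto simp: eq_commute)
  from theI'[OF this] have *: "set (coords R K Us v) \<subseteq> K \<and> length (coords R K Us v) = length Us \<and>
      combine (coords R K Us v) Us = v"
    unfolding coords_def .
  then show "set (coords R K Us v) \<subseteq> K" "length (coords R K Us v) = 4" using Us(3) by auto
  show "\<Psi> v = (\<Sum>i<4. scal (\<kappa> (coords R K Us v ! i)) * \<Psi> (Us ! i))"
    using \<Psi>_combine[of "coords R K Us v" Us] * Us by simp
qed

sublocale Pm: comm_ring_model "UP (R\<lparr>carrier := K\<rparr>)" Km.poly_model
  by (rule Km.poly_model_comm_ring_model)

lemma poly_monom: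
  assumes "c \<in> K"
  shows "monom (UP (R\<lparr>carrier := K\<rparr>)) c n \<in> carrier (UP (R\<lparr>carrier := K\<rparr>))"
    and "Km.poly_model (monom (UP (R\<lparr>carrier := K\<rparr>)) c n) = Polynomial.monom (\<kappa> c) n"
proof -
  interpret UP_ring "R\<lparr>carrier := K\<rparr>" "UP (R\<lparr>carrier := K\<rparr>)" by unfold_locales
  show "monom (UP (R\<lparr>carrier := K\<rparr>)) c n \<in> carrier (UP (R\<lparr>carrier := K\<rparr>))"
    using assms by (intro monom_closed) simp
  show "Km.poly_model (monom (UP (R\<lparr>carrier := K\<rparr>)) c n) = Polynomial.monom (\<kappa> c) n"
    using assms by (intro Km.poly_model_monom) simp
qed

lemma not_in_K: "x \<in> carrier R \<Longrightarrow> x \<notin> K \<Longrightarrow> \<Psi> x \<noteq> scal (h0 (\<Psi> x))"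
  by (metis K_I(1))

lemma one_in_K: "\<one> \<in> K"
  using K_I[of \<one> 1] h_one by simp

lemma \<kappa>_one: "\<kappa> \<one> = 1"
  by (simp add: \<kappa>_def h_one)

text \<open>
The basis in the definition of the characteristic polynomial is an arbitrary choice.  Its coordinate
matrix \<open>B\<close> with respect to \<open>1, i, j, k\<close> is invertible, because the standard basis can be expanded in it,
and it intertwines the two matrices of the operator.
\<close>

lemma poly_model_charpoly:
  assumes T: "T \<in> carrier R \<rightarrow> carrier R"
    and \<Psi>_T: "\<And>x. x \<in> carrier R \<Longrightarrow> \<Psi> (T x) = sylv \<phi> \<gamma> (\<Psi> x)"
  shows "op_charpoly R K T \<in> carrier (UP (R\<lparr>carrier := K\<rparr>))"
    and "Km.poly_model (op_charpoly R K T) = det (pencil 4 (\<lambda>i j. ham_coord i (sylv \<phi> \<gamma> (ham_unit j))))"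
proof -
  let ?P = "UP (R\<lparr>carrier := K\<rparr>)"
  define Us where "Us = (SOME Us. is_basis R K Us)"
  have Us: "is_basis R K Us"
    unfolding Us_def using is_basis_std_basis by (rule someI)
  then have len: "length Us = 4" by (rule length_basis)
  have Us_in: "Us ! j \<in> carrier R" if "j < 4" for j
    using Us len that independent_in_carrier[of K Us] by (auto simp: is_basis_def subset_iff)
  define M where "M = op_matrix R K Us T"
  have T_in: "T (Us ! j) \<in> carrier R" if "j < 4" for j
    using funcset_mem[OF T Us_in[OF that]] .
  have M: "M i j \<in> K" if "i < 4" "j < 4" for i j
    using coords(1,2)[OF Us T_in[OF that(2)]] that(1) nth_mem[of i]
    by (auto simp: M_def op_matrix_def subset_iff)
  have exp_T: "\<Psi> (T (Us ! j)) = (\<Sum>l<4. scal (\<kappa> (M l j)) * \<Psi> (Us ! l))" if "j < 4" for j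
    using coords(3)[OF Us T_in[OF that]] by (simp add: M_def op_matrix_def)
  define ent where "ent i j = monom ?P (M i j) 0 \<ominus>\<^bsub>?P\<^esub>
      (if i = j then monom ?P \<one> 1 else \<zero>\<^bsub>?P\<^esub>)" for i j
  have ent: "ent i j \<in> carrier ?P"
    "Km.poly_model (ent i j) = [:\<kappa> (M i j):] - (if i = j then [:0, 1:] else 0)" if "i < 4" "j < 4" for i j
    using M[OF that] one_in_K
    by (auto simp: ent_def Pm.h_minus Pm.h_zero poly_monom \<kappa>_one monom_0 monom_Suc0 intro!: Pm.minus_closed)
  have cp: "op_charpoly R K T = cring_det ?P 4 ent"
    unfolding op_charpoly_def Let_def Us_def[symmetric] len ent_def[abs_def] M_def by (rule refl)
  show "op_charpoly R K T \<in> carrier ?P"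
    unfolding cp by (rule Pm.h_cring_det(2)) (rule ent)
  have "Km.poly_model (op_charpoly R K T) = det (mat 4 4 (\<lambda>(i, j). Km.poly_model (ent i j)))"
    unfolding cp by (rule Pm.h_cring_det(1)) (rule ent)
  also have "mat 4 4 (\<lambda>(i, j). Km.poly_model (ent i j)) = pencil 4 (\<lambda>i j. \<kappa> (M i j))"
    unfolding pencil_def by (intro eq_matI) (auto simp: ent)
  also have "det \<dots> = det (pencil 4 (\<lambda>i j. ham_coord i (sylv \<phi> \<gamma> (ham_unit j))))"
  proof (rule det_pencil_similar[where B = "\<lambda>i j. ham_coord i (\<Psi> (Us ! j))" and
        D = "\<lambda>l k. \<kappa> (coords R K Us (std_basis ! k) ! l)"])
    fix i j :: nat assume ij: "i < 4" "j < 4"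
    have "ham_unit j = (\<Sum>l<4. scal (\<kappa> (coords R K Us (std_basis ! j) ! l)) * \<Psi> (Us ! l))"
      using coords(3)[OF Us std_basis(4)[OF ij(2)]] std_basis(3)[OF ij(2)] by simp
    then have "of_bool (i = j) = ham_coord i (\<Sum>l<4. scal (\<kappa> (coords R K Us (std_basis ! j) ! l)) * \<Psi> (Us ! l))"
      using ham_coord_linear(4)[OF ij(1), of j] by metis
    then show "(\<Sum>l<4. ham_coord i (\<Psi> (Us ! l)) * \<kappa> (coords R K Us (std_basis ! j) ! l)) = of_bool (i = j)"
      using ij by (simp add: ham_coord_sum ham_coord_linear mult.commute)
    have "(\<Sum>l<4. ham_coord i (sylv \<phi> \<gamma> (ham_unit l)) * ham_coord l (\<Psi> (Us ! j))) = ham_coord i (sylv \<phi> \<gamma> (\<Psi> (Us ! j)))"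
      by (rule sylv_entries[OF ij(1)])
    also have "\<dots> = ham_coord i (\<Psi> (T (Us ! j)))"
      using \<Psi>_T[OF Us_in[OF ij(2)]] by simp
    also have "\<dots> = (\<Sum>l<4. ham_coord i (\<Psi> (Us ! l)) * \<kappa> (M l j))"
      unfolding exp_T[OF ij(2)] using ij by (simp add: ham_coord_sum ham_coord_linear mult.commute)
    finally show "(\<Sum>l<4. ham_coord i (sylv \<phi> \<gamma> (ham_unit l)) * ham_coord l (\<Psi> (Us ! j))) =
      (\<Sum>l<4. ham_coord i (\<Psi> (Us ! l)) * \<kappa> (M l j))" .
  qed
  finally show "Km.poly_model (op_charpoly R K T) = det (pencil 4 (\<lambda>i j. ham_coord i (sylv \<phi> \<gamma> (ham_unit j))))" .
qed

lemma sylv_linear_op: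
  assumes T: "T \<in> carrier R \<rightarrow> carrier R"
    and \<Psi>_T: "\<And>x. x \<in> carrier R \<Longrightarrow> \<Psi> (T x) = sylv \<phi> \<gamma> (\<Psi> x)"
  shows "linear_op R K T"
  unfolding linear_op_def
proof (intro conjI ballI)
  fix x y assume "x \<in> carrier R" "y \<in> carrier R"
  then show "T (x \<oplus> y) = T x \<oplus> T y"
    using T funcset_mem[OF T] by (intro h_eqI) (simp_all add: h_add \<Psi>_T sylv_linear)
next
  fix a x assume "a \<in> K" "x \<in> carrier R"
  moreover from this have "a \<in> carrier R" using K_subset by auto
  ultimately show "T (a \<otimes> x) = a \<otimes> T x"
    using T funcset_mem[OF T]
    by (intro h_eqI) (simp_all add: h_mult \<Psi>_T \<Psi>_K sylv_linear)
qed (fact T)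

text \<open>
If the operator is onto, preimages of \<open>1, i, j, k\<close> are the columns of a right inverse of its matrix, so
the determinant is not zero.  Conversely the adjugate divided by the determinant is a two-sided
inverse; it preserves the quaternions over \<open>F\<close>.
\<close>

lemma sylv_iso_iff:
  assumes T: "T \<in> carrier R \<rightarrow> carrier R"
    and \<Psi>_T: "\<And>x. x \<in> carrier R \<Longrightarrow> \<Psi> (T x) = sylv \<phi> \<gamma> (\<Psi> x)"
    and HF: "\<phi> \<in> HF" "\<gamma> \<in> HF"
  shows "linear_iso R K T \<longleftrightarrow> sylv_det \<phi> \<gamma> \<noteq> 0"
proof
  assume "linear_iso R K T"
  then have surj: "T ` carrier R = carrier R"
    by (auto simp: linear_iso_def bij_betw_def)
  have "\<exists>x. x \<in> carrier R \<and> T x = std_basis ! j" if "j < 4" for j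
    using std_basis(4)[OF that] surj by (metis imageE)
  then obtain y where y: "j < 4 \<Longrightarrow> y j \<in> carrier R" "j < 4 \<Longrightarrow> T (y j) = std_basis ! j" for j
    by metis
  define N D where "N = mat 4 4 (\<lambda>(i, j). ham_coord i (sylv \<phi> \<gamma> (ham_unit j)))"
    and "D = mat 4 4 (\<lambda>(i, j). ham_coord i (\<Psi> (y j)))"
  have ND: "N \<in> carrier_mat 4 4" "D \<in> carrier_mat 4 4" by (simp_all add: N_def D_def)
  have "N * D = 1\<^sub>m 4"
  proof (rule eq_matI)
    fix i j assume "i < dim_row (1\<^sub>m 4)" "j < dim_col (1\<^sub>m 4)"
    then have ij: "i < 4" "j < 4" by auto
    have "(N * D) $$ (i, j) = (\<Sum>l<4. ham_coord i (sylv \<phi> \<gamma> (ham_unit l)) * ham_coord l (\<Psi> (y j)))"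
      using ij by (subst mat_mult_entry[OF ND]) (auto simp: N_def D_def)
    also have "\<dots> = ham_coord i (\<Psi> (T (y j)))"
      using sylv_entries[OF ij(1), of \<phi> \<gamma> "\<Psi> (y j)"] \<Psi>_T[OF y(1)[OF ij(2)]] by simp
    also have "\<dots> = of_bool (i = j)"
      using y(2)[OF ij(2)] std_basis(3)[OF ij(2)] ij(1) by (simp add: ham_coord_linear)
    finally show "(N * D) $$ (i, j) = 1\<^sub>m 4 $$ (i, j)" using ij by simp
  qed (simp_all add: N_def D_def)
  then have "det N * det D = 1"
    using det_mult[OF ND] by simp
  then show "sylv_det \<phi> \<gamma> \<noteq> 0"
    using det_sylv[of \<phi> \<gamma>] by (auto simp: N_def)
next
  define \<delta> where "\<delta> = sylv_det \<phi> \<gamma>"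
  assume "sylv_det \<phi> \<gamma> \<noteq> 0"
  then have \<delta>: "\<delta> \<noteq> 0" by (simp add: \<delta>_def)
  have cancel: "scal (inverse \<delta>) * (scal \<delta> * x) = x" for x
    using \<delta> by (simp add: ham_eq_iff)
  have "inj_on T (carrier R)"
  proof (rule inj_onI)
    fix x y assume xy: "x \<in> carrier R" "y \<in> carrier R" "T x = T y"
    then have "sylv \<phi> \<gamma> (\<Psi> x) = sylv \<phi> \<gamma> (\<Psi> y)" using \<Psi>_T by metis
    then have "scal \<delta> * \<Psi> x = scal \<delta> * \<Psi> y" unfolding \<delta>_def by (metis sylv_adj(2))
    then have "\<Psi> x = \<Psi> y" using cancel by metis
    with xy show "x = y" by (intro h_eqI)
  qed
  moreover have "T ` carrier R = carrier R"
  proof (rule equalityI; rule subsetI)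
    fix y assume y: "y \<in> carrier R"
    \<comment> \<open>the determinant is a coordinate of a composition of maps that preserve \<open>HF\<close>\<close>
    have "\<delta> \<in> F"
    proof -
      have "sylv_adj \<phi> \<gamma> (sylv \<phi> \<gamma> 1) = scal \<delta> * 1" unfolding \<delta>_def by (rule sylv_adj(2))
      moreover have "1 \<in> HF" using \<Psi>_in_HF[of \<one>] h_one by simp
      then have "sylv_adj \<phi> \<gamma> (sylv \<phi> \<gamma> 1) \<in> HF"
        using HF by (auto simp: sylv_def intro!: sylv_adj_in_HF HF_closed)
      ultimately show ?thesis by (simp add: HF_def)
    qed
    then have inv: "scal (inverse \<delta>) \<in> HF" by (intro HF_closed F_closed)
    define q where "q = scal (inverse \<delta>) * sylv_adj \<phi> \<gamma> (\<Psi> y)"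
    have q: "q \<in> HF" unfolding q_def by (rule HF_closed(1)[OF inv sylv_adj_in_HF[OF HF \<Psi>_in_HF[OF y]]])
    have "sylv \<phi> \<gamma> q = \<Psi> y"
      unfolding q_def sylv_linear sylv_adj(1) using cancel by (simp add: \<delta>_def)
    then have "\<Psi> (T (elem q)) = \<Psi> y"
      using q by (simp add: \<Psi>_T elem)
    then have "T (elem q) = y"
      using y elem(1)[OF q] T by (intro h_eqI) auto
    then show "y \<in> T ` carrier R" using elem(1)[OF q] by blast
  qed (use T in auto)
  ultimately show "linear_iso R K T"
    using sylv_linear_op[OF T \<Psi>_T] by (simp add: linear_iso_def bij_betw_def)
qed

text \<open>
The rank is defined as a unique number; this supplies its existence.
\<close>

lemma image_dimension:
  assumes lin: "linear_op R K T"
  obtains n where "dimension n K (T ` carrier R)"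
proof -
  have T: "T \<in> carrier R \<rightarrow> carrier R"
    and add: "x \<in> carrier R \<Longrightarrow> y \<in> carrier R \<Longrightarrow> T (x \<oplus> y) = T x \<oplus> T y"
    and smult: "a \<in> K \<Longrightarrow> x \<in> carrier R \<Longrightarrow> T (a \<otimes> x) = a \<otimes> T x" for a x y
    using lin by (auto simp: linear_op_def)
  have zK: "\<zero> \<in> K" using K_I[of \<zero> 0] h_zero by simp
  have T0: "T \<zero> = \<zero>"
    using smult[OF zK zero_closed] funcset_mem[OF T zero_closed] by simp
  have T_combine: "T (combine Ks Us) = combine Ks (map T Us)"
    if "set Ks \<subseteq> K" "set Us \<subseteq> carrier R" "length Ks = length Us" for Ks Us
    using that(3,1,2)
  proof (induction Ks Us rule: list_induct2)
    case (Cons k Ks u Us)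
    then have "combine Ks Us \<in> carrier R" "k \<in> carrier R" "u \<in> carrier R"
      using K_subset by (auto intro!: combine_in_carrier)
    then show ?case using Cons by (simp add: add smult)
  qed (simp add: T0)
  have mapE: "set (map T std_basis) \<subseteq> carrier R" using T std_basis(2) by auto
  have "T ` carrier R = Span K (map T std_basis)"
  proof (rule equalityI; rule subsetI)
    fix v assume "v \<in> T ` carrier R"
    then obtain x where x: "x \<in> Span K std_basis" "v = T x" using is_basis_std_basis by (auto simp: is_basis_def)
    then obtain Ks where "set Ks \<subseteq> K" "length Ks = length std_basis" "x = combine Ks std_basis"
      using Span_mem_iff_length_version[OF subfield_K std_basis(2)] by auto
    then show "v \<in> Span K (map T std_basis)"
      unfolding Span_mem_iff_length_version[OF subfield_K mapE]
      using x T_combine[of Ks std_basis] std_basis(2) by auto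
  next
    fix v assume "v \<in> Span K (map T std_basis)"
    then obtain Ks where Ks: "set Ks \<subseteq> K" "length Ks = length std_basis" "v = combine Ks (map T std_basis)"
      unfolding Span_mem_iff_length_version[OF subfield_K mapE] by auto
    then have "v = T (combine Ks std_basis)" using T_combine[of Ks std_basis] std_basis(2) by auto
    moreover have "combine Ks std_basis \<in> carrier R"
      using Ks K_subset std_basis(2) by (intro combine_in_carrier) auto
    ultimately show "v \<in> T ` carrier R" by blast
  qed
  moreover obtain Vs where "independent K Vs" "Span K Vs = Span K (map T std_basis)"
    using filter_base[OF subfield_K mapE] by metis
  ultimately show ?thesis
    using that dimension_independent by metis
qed

text \<open>
If the image had dimension at most one, the values on the basis \<open>1, i, j, k\<close> would be proportional to
one element.
\<close>

lemma sylv_rank: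
  assumes T: "T \<in> carrier R \<rightarrow> carrier R"
    and \<Psi>_T: "\<And>x. x \<in> carrier R \<Longrightarrow> \<Psi> (T x) = sylv \<phi> \<gamma> (\<Psi> x)"
    and \<phi>: "\<phi> \<noteq> scal (h0 \<phi>)"
  shows "1 < op_rank R K T"
proof -
  obtain n where n: "dimension n K (T ` carrier R)"
    using image_dimension[OF sylv_linear_op[OF T \<Psi>_T]] by blast
  then have rank: "op_rank R K T = n"
    unfolding op_rank_def by (rule the_equality) (rule dimension_is_inj[OF subfield_K _ n])
  have "n \<noteq> 0 \<and> n \<noteq> 1"
  proof (rule ccontr)
    assume n01: "\<not> (n \<noteq> 0 \<and> n \<noteq> 1)"
    have "\<exists>w\<in>carrier R. \<forall>v\<in>T ` carrier R. \<exists>k\<in>K. v = k \<otimes> w"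
    proof (cases "n = 0")
      case True
      then have "T ` carrier R = {\<zero>}" using n dimension_zero[OF subfield_K] by simp
      then show ?thesis using one_in_K by (intro bexI[of _ \<zero>] ballI bexI[of _ \<one>]) auto
    next
      case False
      then have "dimension (Suc 0) K (T ` carrier R)" using n n01 by simp
      then obtain w E' where w: "w \<in> carrier R" "dimension 0 K E'" "T ` carrier R = line_extension K w E'"
        using dimension_backwards[OF subfield_K] by blast
      have "E' = {\<zero>}" using dimension_zero[OF subfield_K w(2)] .
      have "\<exists>k\<in>K. v = k \<otimes> w" if "v \<in> T ` carrier R" for v
      proof -
        have "v \<in> line_extension K w {\<zero>}" using that w(3) \<open>E' = {\<zero>}\<close> by simp
        then obtain k where "k \<in> K" "v = k \<otimes> w \<oplus> \<zero>"
          unfolding line_extension_mem_iff by blast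
        then show ?thesis using w(1) K_subset by (intro bexI[of _ k]) auto
      qed
      then show ?thesis using w(1) by blast
    qed
    then obtain w where w: "w \<in> carrier R" "\<And>v. v \<in> T ` carrier R \<Longrightarrow> \<exists>k\<in>K. v = k \<otimes> w"
      by blast
    have "\<exists>k. sylv \<phi> \<gamma> (ham_unit j) = scal k * \<Psi> w" if j: "j < 4" for j
    proof -
      obtain k where k: "k \<in> K" "T (std_basis ! j) = k \<otimes> w"
        using w(2)[of "T (std_basis ! j)"] std_basis(4)[OF j] by blast
      then have "\<Psi> (T (std_basis ! j)) = scal (\<kappa> k) * \<Psi> w"
        using w(1) K_subset by (auto simp: h_mult \<Psi>_K)
      then show ?thesis using \<Psi>_T[OF std_basis(4)[OF j]] std_basis(3)[OF j] by auto
    qed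
    then have "\<phi> = scal (h0 \<phi>)" by (rule sylv_not_rank_one)
    with \<phi> show False by contradiction
  qed
  then show ?thesis using rank by simp
qed

theorem sylvester_operator:
  fixes f g :: 'a
  defines "P \<equiv> UP (R\<lparr>carrier := K\<rparr>)"
  assumes f: "f \<in> carrier R" "f \<notin> K" and g: "g \<in> carrier R"
    and s: "s \<in> carrier R" "\<Psi> s = scal (h0 (\<Psi> f) + h0 (\<Psi> g))"
    and a: "a \<in> carrier R" "\<Psi> a = scal (vnorm (\<Psi> f))"
    and b: "b \<in> carrier R" "\<Psi> b = scal (vnorm (\<Psi> g))"
  defines "T \<equiv> \<lambda>x. f \<otimes> x \<oplus> x \<otimes> g"
  shows "op_charpoly R K T =
          (monom P s 0 \<ominus>\<^bsub>P\<^esub> monom P \<one> 1) [^]\<^bsub>P\<^esub> (2::nat) \<otimes>\<^bsub>P\<^esub>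
            ((monom P s 0 \<ominus>\<^bsub>P\<^esub> monom P \<one> 1) [^]\<^bsub>P\<^esub> (2::nat) \<oplus>\<^bsub>P\<^esub> monom P ([(2::nat)] \<cdot> (a \<oplus> b)) 0)
          \<oplus>\<^bsub>P\<^esub> monom P ((a \<ominus> b) [^] (2::nat)) 0"
    and "linear_iso R K T \<longleftrightarrow>
          s [^] (2::nat) \<otimes> (s [^] (2::nat) \<oplus> [(2::nat)] \<cdot> (a \<oplus> b)) \<oplus> (a \<ominus> b) [^] (2::nat) \<noteq> \<zero>"
    and "1 < op_rank R K T"
proof -
  have T: "T \<in> carrier R \<rightarrow> carrier R"
    unfolding T_def by (intro Pi_I a_closed m_closed f(1) g)
  have \<Psi>_T: "\<Psi> (T x) = sylv (\<Psi> f) (\<Psi> g) (\<Psi> x)" if x: "x \<in> carrier R" for x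
    unfolding T_def sylv_def h_add[OF m_closed[OF f(1) x] m_closed[OF x g]]
      h_mult[OF f(1) x] h_mult[OF x g] by (rule refl)
  show "1 < op_rank R K T"
    by (rule sylv_rank[OF T \<Psi>_T not_in_K[OF f]])
  have c: "\<Psi> ([(2::nat)] \<cdot> (a \<oplus> b)) = scal (2 * (vnorm (\<Psi> f) + vnorm (\<Psi> g)))"
    unfolding h_add_pow[OF a_closed[OF a(1) b(1)]] h_add[OF a(1) b(1)] a(2) b(2) of_nat_numeral mult_2 scal_hom by (rule refl)
  have d: "\<Psi> ((a \<ominus> b) [^] (2::nat)) = scal ((vnorm (\<Psi> f) - vnorm (\<Psi> g))\<^sup>2)"
    unfolding h_nat_pow[OF minus_closed[OF a(1) b(1)]] h_minus[OF a(1) b(1)] a(2) b(2) power2_eq_square scal_hom by (rule refl)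
  let ?e = "s [^] (2::nat) \<otimes> (s [^] (2::nat) \<oplus> [(2::nat)] \<cdot> (a \<oplus> b)) \<oplus> (a \<ominus> b) [^] (2::nat)"
  have e: "?e \<in> carrier R" using s a b by simp
  have "\<Psi> ?e = scal (sylv_det (\<Psi> f) (\<Psi> g))"
  proof -
    have "\<Psi> (s [^] (2::nat)) = scal ((h0 (\<Psi> f) + h0 (\<Psi> g))\<^sup>2)"
      unfolding h_nat_pow[OF s(1)] s(2) power2_eq_square scal_hom by (rule refl)
    then have "\<Psi> ?e = scal ((h0 (\<Psi> f) + h0 (\<Psi> g))\<^sup>2) *
        (scal ((h0 (\<Psi> f) + h0 (\<Psi> g))\<^sup>2) + scal (2 * (vnorm (\<Psi> f) + vnorm (\<Psi> g))))
        + scal ((vnorm (\<Psi> f) - vnorm (\<Psi> g))\<^sup>2)"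
      using s(1) a(1) b(1) by (simp only: h_add h_mult c d nat_pow_closed m_closed a_closed add.nat_pow_closed minus_closed)
    also have "\<dots> = scal (sylv_det (\<Psi> f) (\<Psi> g))"
      unfolding sylv_det_def by (simp only: scal_hom)
    finally show ?thesis .
  qed
  then have "?e = \<zero> \<longleftrightarrow> sylv_det (\<Psi> f) (\<Psi> g) = 0"
    using h_eq_iff[OF e zero_closed] scal_eq_iff[of "sylv_det (\<Psi> f) (\<Psi> g)" 0] by (simp add: h_zero)
  then show "linear_iso R K T \<longleftrightarrow> ?e \<noteq> \<zero>"
    using sylv_iso_iff[OF T \<Psi>_T] \<Psi>_in_HF f g by simp
  have sK: "s \<in> K" "\<kappa> s = h0 (\<Psi> f) + h0 (\<Psi> g)"
    by (rule K_I(1)[OF s], rule K_I(2)[OF s(2)])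
  have ab: "[(2::nat)] \<cdot> (a \<oplus> b) \<in> carrier R" "(a \<ominus> b) [^] (2::nat) \<in> carrier R"
    by (intro add.nat_pow_closed nat_pow_closed a_closed minus_closed a(1) b(1))+
  have cK: "[(2::nat)] \<cdot> (a \<oplus> b) \<in> K" "\<kappa> ([(2::nat)] \<cdot> (a \<oplus> b)) = 2 * (vnorm (\<Psi> f) + vnorm (\<Psi> g))"
    by (rule K_I(1)[OF ab(1) c], rule K_I(2)[OF c])
  have dK: "(a \<ominus> b) [^] (2::nat) \<in> K" "\<kappa> ((a \<ominus> b) [^] (2::nat)) = (vnorm (\<Psi> f) - vnorm (\<Psi> g))\<^sup>2"
    by (rule K_I(1)[OF ab(2) d], rule K_I(2)[OF d])
  note mon = poly_monom[OF sK(1), of 0] poly_monom[OF cK(1), of 0] poly_monom[OF dK(1), of 0]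
    poly_monom[OF one_in_K, of 1]
  let ?X = "monom P s 0 \<ominus>\<^bsub>P\<^esub> monom P \<one> 1"
  have X: "?X \<in> carrier P" "Km.poly_model ?X = [:h0 (\<Psi> f) + h0 (\<Psi> g):] - [:0, 1:]"
    unfolding P_def by (rule Pm.minus_closed[OF mon(1,7)])
      (simp only: Pm.h_minus[OF mon(1,7)] mon(2,8) sK \<kappa>_one monom_0 monom_Suc0[folded One_nat_def])
  let ?C = "monom P ([(2::nat)] \<cdot> (a \<oplus> b)) 0" and ?D = "monom P ((a \<ominus> b) [^] (2::nat)) 0"
  have C: "?C \<in> carrier P" "Km.poly_model ?C = [:2 * (vnorm (\<Psi> f) + vnorm (\<Psi> g)):]"
    unfolding P_def mon(4) cK(2) monom_0 by (rule mon(3), rule refl)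
  have D: "?D \<in> carrier P" "Km.poly_model ?D = [:(vnorm (\<Psi> f) - vnorm (\<Psi> g))\<^sup>2:]"
    unfolding P_def mon(6) dK(2) monom_0 by (rule mon(5), rule refl)
  note closed = Pm.nat_pow_closed Pm.m_closed Pm.a_closed
  show "op_charpoly R K T = ?X [^]\<^bsub>P\<^esub> (2::nat) \<otimes>\<^bsub>P\<^esub> (?X [^]\<^bsub>P\<^esub> (2::nat) \<oplus>\<^bsub>P\<^esub> ?C) \<oplus>\<^bsub>P\<^esub> ?D"
    using X C D unfolding P_def
    by (intro Pm.h_eqI poly_model_charpoly(1)[OF T \<Psi>_T] closed)
       (simp_all only: poly_model_charpoly(2)[OF T \<Psi>_T] det_pencil_sylv
         Pm.h_add Pm.h_mult Pm.h_nat_pow closed)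
qed

end

section \<open>Circular sets and their slices\<close>

lemma abs_sel_le_norm: "\<bar>qre q\<bar> \<le> norm q" "\<bar>qim1 q\<bar> \<le> norm q" "\<bar>qim2 q\<bar> \<le> norm q" "\<bar>qim3 q\<bar> \<le> norm q"
  unfolding norm_quat_def by (rule real_le_rsqrt, simp)+

lemma bounded_linear_sel [simp]:
  "bounded_linear qre" "bounded_linear qim1" "bounded_linear qim2" "bounded_linear qim3"
  by (rule bounded_linear_intro[where K = 1]; simp add: abs_sel_le_norm)+

lemmas sel_continuous [continuous_intros] =
  bounded_linear.continuous_on[OF bounded_linear_sel(1)]
  bounded_linear.continuous_on[OF bounded_linear_sel(2)]
  bounded_linear.continuous_on[OF bounded_linear_sel(3)]
  bounded_linear.continuous_on[OF bounded_linear_sel(4)]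

lemma sel_times:
  "qre (x * y) = qre x * qre y - qim1 x * qim1 y - qim2 x * qim2 y - qim3 x * qim3 y"
  "qim1 (x * y) = qre x * qim1 y + qim1 x * qre y + qim2 x * qim3 y - qim3 x * qim2 y"
  "qim2 (x * y) = qre x * qim2 y - qim1 x * qim3 y + qim2 x * qre y + qim3 x * qim1 y"
  "qim3 (x * y) = qre x * qim3 y + qim1 x * qim2 y - qim2 x * qim1 y + qim3 x * qre y"
  by (simp_all add: times_quat_def)

lemma sel_one: "qre 1 = 1" "qim1 1 = 0" "qim2 1 = 0" "qim3 1 = 0"
  by (simp_all add: one_quat_def)

lemma sel_of_real: "qre (of_real r) = r" "qim1 (of_real r) = 0" "qim2 (of_real r) = 0" "qim3 (of_real r) = 0"
  by (simp_all add: of_real_def sel_one)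

lemma imag_units_iff:
  "I \<in> imag_units \<longleftrightarrow> qre I = 0 \<and> (qim1 I)\<^sup>2 + (qim2 I)\<^sup>2 + (qim3 I)\<^sup>2 = 1"
proof
  assume "I \<in> imag_units"
  then have "I * I = -1" by (simp add: imag_units_def power2_eq_square)
  then have *: "(qre I)\<^sup>2 - (qim1 I)\<^sup>2 - (qim2 I)\<^sup>2 - (qim3 I)\<^sup>2 = -1"
    "qre I * qim1 I = 0" "qre I * qim2 I = 0" "qre I * qim3 I = 0"
    by (simp_all add: quat_eq_iff sel_times sel_one power2_eq_square mult.commute)
  have "qre I = 0"
  proof (rule ccontr)
    assume "qre I \<noteq> 0"
    then have "(qre I)\<^sup>2 = -1" using * by simp
    then show False using zero_le_power2[of "qre I"] by linarith
  qed
  then show "qre I = 0 \<and> (qim1 I)\<^sup>2 + (qim2 I)\<^sup>2 + (qim3 I)\<^sup>2 = 1" using *(1) by simp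
next
  assume "qre I = 0 \<and> (qim1 I)\<^sup>2 + (qim2 I)\<^sup>2 + (qim3 I)\<^sup>2 = 1"
  then show "I \<in> imag_units"
    by (auto simp: imag_units_def power2_eq_square quat_eq_iff sel_times sel_one)
qed

lemma imag_unit_square: "I \<in> imag_units \<Longrightarrow> I * I = -1"
  by (simp add: imag_units_def power2_eq_square)

lemma imag_unit_mult_left: "I \<in> imag_units \<Longrightarrow> I * (I * x) = - x"
  using imag_unit_square[of I] by (simp flip: mult.assoc)

lemma uminus_imag_units: "I \<in> imag_units \<Longrightarrow> - I \<in> imag_units"
  by (simp add: imag_units_iff)

lemma imag_unit_nonzero: "I \<in> imag_units \<Longrightarrow> I \<noteq> 0"
  by (auto simp: imag_units_iff)

definition qi :: quat where "qi = Quat 0 1 0 0"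
definition qj :: quat where "qj = Quat 0 0 1 0"
definition qk :: quat where "qk = Quat 0 0 0 1"

lemma q_sel [simp]:
  "qre qi = 0" "qim1 qi = 1" "qim2 qi = 0" "qim3 qi = 0"
  "qre qj = 0" "qim1 qj = 0" "qim2 qj = 1" "qim3 qj = 0"
  "qre qk = 0" "qim1 qk = 0" "qim2 qk = 0" "qim3 qk = 1"
  by (simp_all add: qi_def qj_def qk_def)

lemma q_imag_units [simp]: "qi \<in> imag_units" "qj \<in> imag_units" "qk \<in> imag_units"
  by (simp_all add: imag_units_iff)

definition pt :: "quat \<Rightarrow> complex \<Rightarrow> quat" where
  "pt I z = slice_pt I (Re z) (Im z)"

lemma slice_pt_eq_pt: "slice_pt I x y = pt I (Complex x y)"
  by (simp add: pt_def)

lemma slice_pt_scaleR: "slice_pt I x y = of_real x + y *\<^sub>R I"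
  by (simp add: slice_pt_def quat_eq_iff sel_times sel_of_real)

lemma pt_scaleR: "pt I z = of_real (Re z) + Im z *\<^sub>R I"
  by (simp add: pt_def slice_pt_scaleR)

lemma pt_uminus: "pt (- I) z = pt I (cnj z)"
  by (simp add: pt_scaleR)

definition qvec_norm :: "quat \<Rightarrow> real" where
  "qvec_norm q = sqrt ((qim1 q)\<^sup>2 + (qim2 q)\<^sup>2 + (qim3 q)\<^sup>2)"

text \<open>
The point of the closed upper half plane that represents the sphere of \<open>q\<close>; every quaternion \<open>q\<close> is
\<open>pt I (slice_coord q)\<close> for some imaginary unit \<open>I\<close>.
\<close>

definition slice_coord :: "quat \<Rightarrow> complex" where
  "slice_coord q = Complex (qre q) (qvec_norm q)"

lemma slice_coord_sel [simp]: "Re (slice_coord q) = qre q" "Im (slice_coord q) = qvec_norm q" "qvec_norm q \<ge> 0"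
  by (simp_all add: slice_coord_def qvec_norm_def)

lemma continuous_on_slice_coord [continuous_intros]: "continuous_on S slice_coord"
  unfolding slice_coord_def qvec_norm_def Complex_eq
  by (intro continuous_intros continuous_on_id)

lemma slice_coord_pt:
  assumes "I \<in> imag_units"
  shows "slice_coord (pt I z) = Complex (Re z) \<bar>Im z\<bar>"
proof -
  have "(qim1 I)\<^sup>2 + (qim2 I)\<^sup>2 + (qim3 I)\<^sup>2 = 1" "qre I = 0" using assms by (auto simp: imag_units_iff)
  moreover have "(Im z * qim1 I)\<^sup>2 + (Im z * qim2 I)\<^sup>2 + (Im z * qim3 I)\<^sup>2 =
      (Im z)\<^sup>2 * ((qim1 I)\<^sup>2 + (qim2 I)\<^sup>2 + (qim3 I)\<^sup>2)"
    by (simp add: power_mult_distrib algebra_simps)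
  ultimately show ?thesis
    by (simp add: slice_coord_def qvec_norm_def pt_scaleR sel_of_real)
qed

lemma slice_coord_pt_cases:
  assumes "I \<in> imag_units"
  shows "slice_coord (pt I z) = z \<or> slice_coord (pt I z) = cnj z"
  using slice_coord_pt[OF assms, of z] by (cases "Im z \<ge> 0") (auto simp: complex_eq_iff)

lemma pt_slice_coord: "\<exists>I\<in>imag_units. q = pt I (slice_coord q)"
proof (cases "qvec_norm q = 0")
  case True
  then have "qim1 q = 0 \<and> qim2 q = 0 \<and> qim3 q = 0"
    by (simp add: qvec_norm_def add_nonneg_eq_0_iff)
  with True show ?thesis
    by (intro bexI[of _ qi]) (simp_all add: pt_scaleR quat_eq_iff sel_of_real)
next
  case False
  define n where "n = qvec_norm q"
  have n: "n \<noteq> 0" "n\<^sup>2 = (qim1 q)\<^sup>2 + (qim2 q)\<^sup>2 + (qim3 q)\<^sup>2"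
    using False by (simp_all add: n_def qvec_norm_def)
  define I where "I = Quat 0 (qim1 q / n) (qim2 q / n) (qim3 q / n)"
  have "((qim1 q)\<^sup>2 + (qim2 q)\<^sup>2 + (qim3 q)\<^sup>2) / n\<^sup>2 = 1"
    using n by (metis divide_self power_not_zero)
  then have "I \<in> imag_units"
    by (simp add: I_def imag_units_iff power_divide add_divide_distrib)
  then show ?thesis
    using n by (intro bexI[of _ I]) (simp_all add: pt_scaleR quat_eq_iff sel_of_real I_def n_def)
qed

lemma sphere_of_iff: "q \<in> sphere_of p \<longleftrightarrow> slice_coord q = slice_coord p"
proof
  assume "q \<in> sphere_of p"
  then obtain J x y I where "J \<in> imag_units" "I \<in> imag_units" "q = slice_pt J x y" "p = slice_pt I x y"
    by (auto simp: sphere_of_def)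
  then show "slice_coord q = slice_coord p" by (simp add: slice_pt_eq_pt slice_coord_pt)
next
  assume *: "slice_coord q = slice_coord p"
  obtain I J where "I \<in> imag_units" "p = pt I (slice_coord p)" "J \<in> imag_units" "q = pt J (slice_coord q)"
    using pt_slice_coord by meson
  then show "q \<in> sphere_of p"
    using * unfolding sphere_of_def pt_def by auto
qed

text \<open>
The trace of a circular set on a slice, as a set of complex numbers.  All slices give the same
set (\<open>profile_iff\<close>).
\<close>

definition profile :: "quat set \<Rightarrow> complex set" where
  "profile A = {z. pt qi z \<in> A}"

lemma circular_pt:
  assumes "circular A" "I \<in> imag_units" "J \<in> imag_units" "pt I z \<in> A"
  shows "pt J z \<in> A"
  using assms by (auto simp: circular_def subset_iff sphere_of_iff slice_coord_pt)

lemma profile_iff: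
  assumes "circular A" "I \<in> imag_units"
  shows "z \<in> profile A \<longleftrightarrow> pt I z \<in> A"
  using circular_pt[OF assms(1) q_imag_units(1) assms(2)] circular_pt[OF assms q_imag_units(1)]
  by (auto simp: profile_def)

lemma profile_cnj_iff: "circular A \<Longrightarrow> cnj z \<in> profile A \<longleftrightarrow> z \<in> profile A"
  using profile_iff[of A "- qi" z] uminus_imag_units[of qi]
  by (simp add: profile_def pt_uminus)

lemma slice_coord_profile_iff: "circular A \<Longrightarrow> slice_coord q \<in> profile A \<longleftrightarrow> q \<in> A"
  using pt_slice_coord[of q] profile_iff[of A _ "slice_coord q"] by metis

lemma continuous_on_pt [continuous_intros]: "continuous_on S (pt I)"
  unfolding pt_scaleR[abs_def] by (intro continuous_intros)

lemma open_profile: "open A \<Longrightarrow> open (profile A)"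
  unfolding profile_def using open_vimage[OF _ continuous_on_pt, of A qi]
  by (simp add: vimage_def)

lemma profile_Int: "profile (A \<inter> B) = profile A \<inter> profile B"
  by (auto simp: profile_def)

lemma profile_mono: "A \<subseteq> B \<Longrightarrow> profile A \<subseteq> profile B"
  by (auto simp: profile_def)

definition spin :: "complex set \<Rightarrow> quat set" where
  "spin B = {q. slice_coord q \<in> B}"

lemma open_spin: "open B \<Longrightarrow> open (spin B)"
  unfolding spin_def using open_vimage[OF _ continuous_on_slice_coord, of B]
  by (simp add: vimage_def)

lemma circular_spin: "circular (spin B)"
  by (auto simp: circular_def spin_def sphere_of_iff)

lemma profile_spin: "(\<And>z. z \<in> B \<Longrightarrow> cnj z \<in> B) \<Longrightarrow> profile (spin B) = B"
  using slice_coord_pt_cases[of qi] by (auto simp: profile_def spin_def) (metis complex_cnj_cnj)+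

lemma circular_Int: "circular A \<Longrightarrow> circular B \<Longrightarrow> circular (A \<inter> B)"
  by (auto simp: circular_def)

lemma circular_subset_iff: "circular A \<Longrightarrow> circular B \<Longrightarrow> A \<subseteq> B \<longleftrightarrow> profile A \<subseteq> profile B"
  using slice_coord_profile_iff profile_mono by (metis subset_iff)

definition Re_ham :: "complex ham \<Rightarrow> quat" where
  "Re_ham x = Quat (Re (h0 x)) (Re (h1 x)) (Re (h2 x)) (Re (h3 x))"

definition Im_ham :: "complex ham \<Rightarrow> quat" where
  "Im_ham x = Quat (Im (h0 x)) (Im (h1 x)) (Im (h2 x)) (Im (h3 x))"

definition cnj_ham :: "complex ham \<Rightarrow> complex ham" where
  "cnj_ham x = Ham (cnj (h0 x)) (cnj (h1 x)) (cnj (h2 x)) (cnj (h3 x))"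

text \<open>
The value at a point of the slice of \<open>I\<close> of the slice function whose stem function takes the value \<open>x\<close> at
the corresponding complex number.
\<close>

definition lift :: "quat \<Rightarrow> complex ham \<Rightarrow> quat" where
  "lift I x = Re_ham x + I * Im_ham x"

lemma Re_Im_ham_sel [simp]:
  "qre (Re_ham x) = Re (h0 x)" "qim1 (Re_ham x) = Re (h1 x)" "qim2 (Re_ham x) = Re (h2 x)" "qim3 (Re_ham x) = Re (h3 x)"
  "qre (Im_ham x) = Im (h0 x)" "qim1 (Im_ham x) = Im (h1 x)" "qim2 (Im_ham x) = Im (h2 x)" "qim3 (Im_ham x) = Im (h3 x)"
  by (simp_all add: Re_ham_def Im_ham_def)

lemma cnj_ham_sel [simp]:
  "h0 (cnj_ham x) = cnj (h0 x)" "h1 (cnj_ham x) = cnj (h1 x)" "h2 (cnj_ham x) = cnj (h2 x)" "h3 (cnj_ham x) = cnj (h3 x)"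
  by (simp_all add: cnj_ham_def)

lemma Re_ham_Im_ham_cnj_ham [simp]: "Re_ham (cnj_ham x) = Re_ham x" "Im_ham (cnj_ham x) = - Im_ham x" "cnj_ham (cnj_ham x) = x"
  by (simp_all add: quat_eq_iff ham_eq_iff)

lemma cnj_ham_hom: "cnj_ham (x + y) = cnj_ham x + cnj_ham y" "cnj_ham (x * y) = cnj_ham x * cnj_ham y"
  by (simp_all add: ham_eq_iff ham_sel_times)

lemma Re_ham_Im_ham_add: "Re_ham (x + y) = Re_ham x + Re_ham y" "Im_ham (x + y) = Im_ham x + Im_ham y"
  by (simp_all add: quat_eq_iff)

lemma Re_ham_Im_ham_times:
  "Re_ham (x * y) = Re_ham x * Re_ham y - Im_ham x * Im_ham y" "Im_ham (x * y) = Re_ham x * Im_ham y + Im_ham x * Re_ham y"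
  by (simp_all add: quat_eq_iff ham_sel_times sel_times algebra_simps)

lemma ham_eq_Re_ham_Im_ham_iff: "x = y \<longleftrightarrow> Re_ham x = Re_ham y \<and> Im_ham x = Im_ham y"
  by (auto simp: ham_eq_iff quat_eq_iff complex_eq_iff)

lemma lift_add: "lift I (x + y) = lift I x + lift I y"
  by (simp add: lift_def Re_ham_Im_ham_add algebra_simps)

text \<open>
The values \<open>a + I b\<close> and \<open>a - I b\<close> on two opposite slices determine \<open>a\<close> and \<open>b\<close>.
\<close>

lemma lift_eqD:
  assumes I: "I \<in> imag_units" and "lift I x = lift I y" "lift (- I) x = lift (- I) y"
  shows "x = y"
proof -
  have "Re_ham x + Re_ham x = lift I x + lift (- I) x" "Re_ham y + Re_ham y = lift I y + lift (- I) y"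
    by (simp_all add: lift_def)
  then have re: "Re_ham x = Re_ham y" using assms by (simp add: quat_eq_iff)
  then have "I * Im_ham x = I * Im_ham y" using assms by (simp add: lift_def)
  then have "Im_ham x = Im_ham y" using imag_unit_nonzero[OF I] by simp
  with re show ?thesis by (simp add: ham_eq_Re_ham_Im_ham_iff)
qed

text \<open>
With \<open>x = a + i b\<close>, \<open>y = c + i d\<close> and \<open>w = a + I b\<close>, the rule \<open>w J = I w\<close> gives
\<open>w (c + J d) = w c + I w d = (a c - b d) + I (a d + b c)\<close>.
\<close>

lemma lift_mult_rotated:
  assumes I: "I \<in> imag_units" and J: "lift I x * J = I * lift I x"
  shows "lift I (x * y) = lift I x * lift J y"
proof -
  have II: "I * (I * z) = - z" for z using imag_unit_mult_left[OF I] .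
  have "lift I x * lift J y = lift I x * Re_ham y + (lift I x * J) * Im_ham y"
    by (simp add: lift_def[of J] distrib_left mult.assoc)
  also have "\<dots> = lift I x * Re_ham y + I * lift I x * Im_ham y"
    by (simp only: J)
  also have "\<dots> = lift I (x * y)"
    by (simp add: lift_def Re_ham_Im_ham_times algebra_simps II)
  finally show ?thesis ..
qed

lemma lift_scal_mult:
  assumes I: "I \<in> imag_units"
  shows "lift I (scal c * x) = lift I (scal c) * lift I x"
proof (rule lift_mult_rotated[OF I])
  have r: "Re_ham (scal c) = of_real (Re c)" "Im_ham (scal c) = of_real (Im c)"
    by (simp_all add: quat_eq_iff sel_of_real)
  show "lift I (scal c) * I = I * lift I (scal c)"
    unfolding lift_def r by (simp add: algebra_simps of_real_def)
qed

lemma lift_scal: "lift I (scal c) = pt I c"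
  by (simp add: lift_def pt_def slice_pt_def quat_eq_iff sel_times sel_of_real)

text \<open>
The star product evaluates the second factor on the slice of \<open>J = w\<^sup>-\<^sup>1 I w\<close>, where \<open>w\<close> is the value of
the first factor.  Since \<open>w J = I w\<close>, the previous identity turns it into the product of the stem
functions.  Zeros of the first factor satisfy \<open>w J = I w\<close> trivially.
\<close>

lemma star_prod_lift:
  assumes I: "I \<in> imag_units" and f: "f (pt I z) = lift I x"
    and g: "\<And>J. J \<in> imag_units \<Longrightarrow> g (pt J z) = lift J y"
  shows "star_prod f g (pt I z) = lift I (x * y)"
proof (cases "lift I x = 0")
  case True
  then have "lift I (x * y) = 0" using lift_mult_rotated[OF I, of x 0 y] by simp
  with True f show ?thesis by (simp add: star_prod_def)
next
  case False
  define a where "a = lift I x"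
  define J where "J = inverse a * I * a"
  have a: "a \<noteq> 0" using False by (simp add: a_def)
  have "a * J = I * a" using a by (simp add: J_def flip: mult.assoc)
  have "J * J = inverse a * I * (a * inverse a) * I * a"
    by (simp only: J_def mult.assoc)
  also have "\<dots> = inverse a * (I * I) * a"
    using a by (simp add: mult.assoc)
  also have "\<dots> = -1" using a imag_unit_square[OF I] by simp
  finally have J: "J \<in> imag_units" by (simp add: imag_units_def power2_eq_square)
  have "inverse a * pt I z * a = pt J z"
    using a by (simp add: pt_scaleR J_def algebra_simps of_real_def)
  then have "star_prod f g (pt I z) = a * lift J y"
    using a f g[OF J] by (simp add: star_prod_def a_def)
  also have "\<dots> = lift I (x * y)"
    unfolding a_def by (rule lift_mult_rotated[OF I, symmetric]) (use \<open>a * J = I * a\<close> in \<open>simp add: a_def\<close>)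
  finally show ?thesis .
qed

definition const_coords :: "quat \<Rightarrow> 'a::{comm_ring_1, real_algebra_1} ham" where
  "const_coords c = Ham (of_real (qre c)) (of_real (qim1 c)) (of_real (qim2 c)) (of_real (qim3 c))"

lemma lift_const_coords: "lift I (const_coords c) = c"
  by (simp add: lift_def const_coords_def quat_eq_iff sel_times)

lemma in_slice: "q \<in> slice I \<longleftrightarrow> (\<exists>z. q = pt I z)"
  unfolding slice_def slice_pt_eq_pt mem_Collect_eq by (metis complex_surj)

lemma slice_preserving_coords:
  assumes "\<And>I. I \<in> imag_units \<Longrightarrow> lift I x \<in> slice I"
  shows "h1 x = 0" "h2 x = 0" "h3 x = 0"
proof -
  have "lift qi x \<in> slice qi" "lift (- qi) x \<in> slice (- qi)" "lift qj x \<in> slice qj"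
    using assms[of qi] assms[of "- qi"] assms[of qj] uminus_imag_units[of qi] by auto
  then obtain a b c where "lift qi x = pt qi a" "lift (- qi) x = pt (- qi) b" "lift qj x = pt qj c"
    by (auto simp: in_slice)
  then show "h1 x = 0" "h2 x = 0" "h3 x = 0"
    by (simp_all add: lift_def pt_scaleR quat_eq_iff sel_times sel_of_real complex_eq_iff)
qed

section \<open>Slice regular functions and holomorphic stem functions\<close>

definition ham_comps :: "((complex \<Rightarrow> complex) \<Rightarrow> bool) \<Rightarrow> (complex \<Rightarrow> complex ham) \<Rightarrow> bool" where
  "ham_comps P \<phi> \<longleftrightarrow> P (\<lambda>z. h0 (\<phi> z)) \<and> P (\<lambda>z. h1 (\<phi> z)) \<and> P (\<lambda>z. h2 (\<phi> z)) \<and> P (\<lambda>z. h3 (\<phi> z))"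

definition has_stem :: "quat set \<Rightarrow> (quat \<Rightarrow> quat) \<Rightarrow> (complex \<Rightarrow> complex ham) \<Rightarrow> bool" where
  "has_stem A f \<phi> \<longleftrightarrow> (\<forall>I\<in>imag_units. \<forall>z\<in>profile A. f (pt I z) = lift I (\<phi> z))"

definition stem_function_on :: "complex set \<Rightarrow> (complex \<Rightarrow> complex ham) \<Rightarrow> bool" where
  "stem_function_on B \<phi> \<longleftrightarrow> (\<forall>z\<in>B. \<phi> (cnj z) = cnj_ham (\<phi> z))"

lemma has_derivative_Complex:
  "((\<lambda>p. Complex (fst p) (snd p)) has_derivative (\<lambda>h. Complex (fst h) (snd h))) F"
  unfolding Complex_eq by (auto intro!: derivative_eq_intros)

lemma open_vimage_Complex: "open B \<Longrightarrow> open {p. Complex (fst p) (snd p) \<in> B}"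
  using open_vimage[of B "\<lambda>p. Complex (fst p) (snd p)"]
  unfolding Complex_eq by (simp add: vimage_def continuous_intros)

text \<open>
The equations \<open>u\<^sub>y = - v\<^sub>x\<close> and \<open>v\<^sub>y = u\<^sub>x\<close> say that the real derivative is a complex multiplication.
\<close>

lemma has_field_derivative_CauchyRiemann:
  fixes u v :: "real \<times> real \<Rightarrow> real"
  assumes u: "(u has_derivative u') (at (Re z, Im z))" and v: "(v has_derivative v') (at (Re z, Im z))"
    and CR: "u' (0, 1) = - v' (1, 0)" "v' (0, 1) = u' (1, 0)"
  shows "((\<lambda>w. Complex (u (Re w, Im w)) (v (Re w, Im w)))
    has_field_derivative Complex (u' (1, 0)) (v' (1, 0))) (at z)"
proof -
  have p: "((\<lambda>w. (Re w, Im w)) has_derivative (\<lambda>h. (Re h, Im h))) (at z)"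
    by (auto intro!: derivative_eq_intros)
  have d: "((\<lambda>w. u (Re w, Im w)) has_derivative (\<lambda>h. u' (Re h, Im h))) (at z)"
    "((\<lambda>w. v (Re w, Im w)) has_derivative (\<lambda>h. v' (Re h, Im h))) (at z)"
    using diff_chain_at[OF p, of u u'] diff_chain_at[OF p, of v v'] u v by (simp_all add: o_def)
  have lin: "w' (a, b) = a * w' (1, 0) + b * w' (0, 1)" if "bounded_linear w'" for w' :: "real \<times> real \<Rightarrow> real" and a b
  proof -
    interpret bounded_linear w' by fact
    have "w' (a, b) = w' (a *\<^sub>R (1, 0) + b *\<^sub>R (0, 1))" by simp
    also have "\<dots> = a * w' (1, 0) + b * w' (0, 1)" unfolding add scaleR by simp
    finally show ?thesis .
  qed
  note l = lin[OF has_derivative_bounded_linear[OF u]] lin[OF has_derivative_bounded_linear[OF v]]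
  have "((\<lambda>w. Complex (u (Re w, Im w)) (v (Re w, Im w))) has_derivative
      (\<lambda>h. Complex (u' (Re h, Im h)) (v' (Re h, Im h)))) (at z)"
    unfolding Complex_eq by (auto intro!: derivative_eq_intros d)
  also have "(\<lambda>h. Complex (u' (Re h, Im h)) (v' (Re h, Im h))) = (*) (Complex (u' (1, 0)) (v' (1, 0)))"
  proof
    fix h
    show "Complex (u' (Re h, Im h)) (v' (Re h, Im h)) = Complex (u' (1, 0)) (v' (1, 0)) * h"
      using l(1)[of "Re h" "Im h"] l(2)[of "Re h" "Im h"] CR
      by (simp add: complex_eq_iff algebra_simps)
  qed
  finally show ?thesis by (simp add: has_field_derivative_def)
qed

text \<open>
The components are recovered from the restrictions to the slices of \<open>i\<close> and \<open>- i\<close> as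
\<open>F1 = (f\<^sub>i + f\<^sub>-\<^sub>i) / 2\<close> and \<open>F2 = - i (f\<^sub>i - f\<^sub>-\<^sub>i) / 2\<close>.  Hence they are differentiable, and the two
equations \<open>\<partial>\<^sub>x f\<^sub>I = - I \<partial>\<^sub>y f\<^sub>I\<close> for \<open>I = \<plusminus> i\<close> combine to the Cauchy-Riemann equations for \<open>F1\<close> and \<open>F2\<close>,
which then hold in each real coordinate.
\<close>

lemma slice_regular_imp_holomorphic:
  assumes A: "open A" "circular A" and f: "slice_regular A f"
  obtains \<phi> where "ham_comps (\<lambda>\<psi>. \<psi> holomorphic_on profile A) \<phi>" "stem_function_on UNIV \<phi>" "has_stem A f \<phi>"
proof -
  obtain F1 F2 :: "real \<Rightarrow> real \<Rightarrow> quat" where F: "\<And>x y. F1 x (- y) = F1 x y" "\<And>x y. F2 x (- y) = - F2 x y"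
    "\<And>I x y. I \<in> imag_units \<Longrightarrow> slice_pt I x y \<in> A \<Longrightarrow> f (slice_pt I x y) = F1 x y + I * F2 x y"
    using f unfolding slice_regular_def slice_function_def by blast
  define \<phi> where "\<phi> z = (if z \<in> profile A then
      Ham (Complex (qre (F1 (Re z) (Im z))) (qre (F2 (Re z) (Im z))))
          (Complex (qim1 (F1 (Re z) (Im z))) (qim1 (F2 (Re z) (Im z))))
          (Complex (qim2 (F1 (Re z) (Im z))) (qim2 (F2 (Re z) (Im z))))
          (Complex (qim3 (F1 (Re z) (Im z))) (qim3 (F2 (Re z) (Im z)))) else 0)" for z
  have ReIm: "Re_ham (\<phi> z) = F1 (Re z) (Im z)" "Im_ham (\<phi> z) = F2 (Re z) (Im z)" if "z \<in> profile A" for z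
    using that by (simp_all add: \<phi>_def quat_eq_iff)
  have rep: "has_stem A f \<phi>"
    unfolding has_stem_def
  proof (intro ballI)
    fix I z assume I: "I \<in> imag_units" and z: "z \<in> profile A"
    then have "slice_pt I (Re z) (Im z) \<in> A" using profile_iff[OF A(2) I, of z] by (simp add: pt_def)
    from F(3)[OF I this] show "f (pt I z) = lift I (\<phi> z)"
      by (simp add: pt_def lift_def ReIm[OF z])
  qed
  have sym: "stem_function_on UNIV \<phi>"
    unfolding stem_function_on_def
    by (auto simp: \<phi>_def profile_cnj_iff[OF A(2)] F(1,2) ham_eq_iff complex_eq_iff)
  have hol: "((\<lambda>w. Complex (s (F1 (Re w) (Im w))) (s (F2 (Re w) (Im w)))) field_differentiable (at z))"
    if z: "z \<in> profile A" and s: "bounded_linear s" for s :: "quat \<Rightarrow> real" and z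
  proof -
    have der: "\<exists>f'. ((\<lambda>p. f (slice_pt I (fst p) (snd p))) has_derivative f') (at (Re z, Im z)) \<and> f' (1, 0) = - I * f' (0, 1)"
      if I: "I \<in> imag_units" for I
    proof -
      have "slice_pt I (Re z) (Im z) \<in> A" using profile_iff[OF A(2) I, of z] z by (simp add: pt_def)
      then obtain f' where f': "((\<lambda>(u, v). f (slice_pt I u v)) has_derivative f') (at (Re z, Im z))"
          "(1/2) *\<^sub>R (f' (1, 0) + I * f' (0, 1)) = 0"
        using f I unfolding slice_regular_def by blast
      from f'(2) have "f' (1, 0) + I * f' (0, 1) = 0" by simp
      then have "f' (1, 0) = - I * f' (0, 1)" by (simp add: eq_neg_iff_add_eq_0)
      with f'(1) show ?thesis unfolding case_prod_beta' by blast
    qed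
    obtain d where d: "((\<lambda>p. f (slice_pt qi (fst p) (snd p))) has_derivative d) (at (Re z, Im z))"
        "d (1, 0) = - qi * d (0, 1)"
      using der[of qi] by auto
    obtain e where e: "((\<lambda>p. f (slice_pt (- qi) (fst p) (snd p))) has_derivative e) (at (Re z, Im z))"
        "e (1, 0) = qi * e (0, 1)"
      using der[of "- qi"] uminus_imag_units[of qi] by auto
    define D1 D2 where "D1 p = (1/2) *\<^sub>R (d p + e p)" and "D2 p = (1/2) *\<^sub>R (- qi * (d p - e p))" for p
    let ?B = "{p. Complex (fst p) (snd p) \<in> profile A}"
    have B: "open ?B" "(Re z, Im z) \<in> ?B"
      using z open_vimage_Complex[OF open_profile[OF A(1)]] by auto
    have FF: "f (slice_pt qi (fst p) (snd p)) = F1 (fst p) (snd p) + qi * F2 (fst p) (snd p)"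
      "f (slice_pt (- qi) (fst p) (snd p)) = F1 (fst p) (snd p) - qi * F2 (fst p) (snd p)" if "p \<in> ?B" for p
      using that F(3)[of qi] F(3)[of "- qi"] profile_iff[OF A(2), of "- qi" "Complex (fst p) (snd p)"]
        profile_iff[OF A(2), of "qi" "Complex (fst p) (snd p)"] uminus_imag_units[of qi]
      by (auto simp: slice_pt_eq_pt)
    have "((\<lambda>p. (1/2) *\<^sub>R (f (slice_pt qi (fst p) (snd p)) + f (slice_pt (- qi) (fst p) (snd p)))) has_derivative D1) (at (Re z, Im z))"
      unfolding D1_def by (intro derivative_intros d e)
    then have F1': "((\<lambda>p. F1 (fst p) (snd p)) has_derivative D1) (at (Re z, Im z))"
      by (rule has_derivative_transform_within_open[OF _ B]) (simp add: FF quat_eq_iff)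
    have "((\<lambda>p. (1/2) *\<^sub>R (- qi * (f (slice_pt qi (fst p) (snd p)) - f (slice_pt (- qi) (fst p) (snd p))))) has_derivative D2) (at (Re z, Im z))"
      unfolding D2_def by (intro derivative_intros d e)
    then have F2': "((\<lambda>p. F2 (fst p) (snd p)) has_derivative D2) (at (Re z, Im z))"
      by (rule has_derivative_transform_within_open[OF _ B]) (simp add: FF quat_eq_iff sel_times)
    have CR: "D1 (0, 1) = - D2 (1, 0)" "D2 (0, 1) = D1 (1, 0)"
      by (simp_all add: D1_def D2_def d(2) e(2) quat_eq_iff sel_times algebra_simps)
    interpret s: bounded_linear s by (rule s)
    have "((\<lambda>w. Complex (s (F1 (fst (Re w, Im w)) (snd (Re w, Im w)))) (s (F2 (fst (Re w, Im w)) (snd (Re w, Im w)))))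
        has_field_derivative Complex (s (D1 (1, 0))) (s (D2 (1, 0)))) (at z)"
      by (rule has_field_derivative_CauchyRiemann[where u = "\<lambda>p. s (F1 (fst p) (snd p))" and v = "\<lambda>p. s (F2 (fst p) (snd p))"
            and u' = "\<lambda>p. s (D1 p)" and v' = "\<lambda>p. s (D2 p)"])
         (auto intro!: s.has_derivative F1' F2' simp: CR linear_neg[OF s.linear])
    then show ?thesis by (auto simp: field_differentiable_def)
  qed
  have "ham_comps (\<lambda>\<psi>. \<psi> holomorphic_on profile A) \<phi>"
  proof -
    have *: "(\<lambda>z. t (\<phi> z)) holomorphic_on profile A"
      if s: "bounded_linear s" and t: "\<And>z. z \<in> profile A \<Longrightarrow> t (\<phi> z) = Complex (s (F1 (Re z) (Im z))) (s (F2 (Re z) (Im z)))"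
      for s t
    proof -
      have "(\<lambda>w. Complex (s (F1 (Re w) (Im w))) (s (F2 (Re w) (Im w)))) holomorphic_on profile A"
        unfolding holomorphic_on_def using hol[OF _ s] field_differentiable_at_within by blast
      then show ?thesis by (rule holomorphic_transform) (simp add: t)
    qed
    show ?thesis
      unfolding ham_comps_def
      by (intro conjI *[OF bounded_linear_sel(1)] *[OF bounded_linear_sel(2)]
          *[OF bounded_linear_sel(3)] *[OF bounded_linear_sel(4)]) (simp_all add: \<phi>_def)
  qed
  then show ?thesis using that rep sym by blast
qed

lemma Re_ham_Im_ham_sum:
  "Re_ham x = Re (h0 x) *\<^sub>R 1 + Re (h1 x) *\<^sub>R qi + Re (h2 x) *\<^sub>R qj + Re (h3 x) *\<^sub>R qk"
  "Im_ham x = Im (h0 x) *\<^sub>R 1 + Im (h1 x) *\<^sub>R qi + Im (h2 x) *\<^sub>R qj + Im (h3 x) *\<^sub>R qk"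
  by (simp_all add: quat_eq_iff sel_one)

text \<open>
By complex differentiability of the coordinates the derivative of \<open>f\<close> along the slice of \<open>I\<close> is
\<open>h \<mapsto> lift I (c h)\<close>, and \<open>lift I (i c) = I lift I c\<close>.
\<close>

lemma holomorphic_imp_slice_regular:
  assumes A: "open A" "circular A" and hol: "ham_comps (\<lambda>\<psi>. \<psi> holomorphic_on profile A) \<phi>"
    and sym: "stem_function_on (profile A) \<phi>" and rep: "has_stem A f \<phi>"
  shows "slice_regular A f"
  unfolding slice_regular_def
proof (intro conjI ballI allI impI)
  define F1 F2 where "F1 x y = (if Complex x y \<in> profile A then Re_ham (\<phi> (Complex x y)) else 0)"
    and "F2 x y = (if Complex x y \<in> profile A then Im_ham (\<phi> (Complex x y)) else 0)" for x y
  have c: "Complex x (- y) = cnj (Complex x y)" for x y by (simp add: complex_eq_iff)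
  have "F1 x (- y) = F1 x y" "F2 x (- y) = - F2 x y" for x y
    using sym unfolding F1_def F2_def c profile_cnj_iff[OF A(2)] by (auto simp: stem_function_on_def)
  moreover have "f (slice_pt I x y) = F1 x y + I * F2 x y" if "I \<in> imag_units" "slice_pt I x y \<in> A" for I x y
    using that rep profile_iff[OF A(2) that(1), of "Complex x y"]
    by (auto simp: slice_pt_eq_pt has_stem_def F1_def F2_def lift_def)
  ultimately show "slice_function A f"
    unfolding slice_function_def by blast
next
  fix I x y assume I: "I \<in> imag_units" and xy: "slice_pt I x y \<in> A"
  define z where "z = Complex x y"
  have z: "z \<in> profile A" using xy profile_iff[OF A(2) I] by (simp add: z_def slice_pt_eq_pt)
  have ex: "\<exists>c. (\<psi> has_field_derivative c) (at z)" if "\<psi> holomorphic_on profile A" for \<psi>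
    using that z open_profile[OF A(1)] holomorphic_on_imp_differentiable_at
    by (auto simp: field_differentiable_def)
  obtain c0 c1 c2 c3 where c:
    "((\<lambda>z. h0 (\<phi> z)) has_field_derivative c0) (at z)" "((\<lambda>z. h1 (\<phi> z)) has_field_derivative c1) (at z)"
    "((\<lambda>z. h2 (\<phi> z)) has_field_derivative c2) (at z)" "((\<lambda>z. h3 (\<phi> z)) has_field_derivative c3) (at z)"
    using hol ex unfolding ham_comps_def by metis
  have d: "((\<lambda>p. \<psi> (Complex (fst p) (snd p))) has_derivative (\<lambda>h. c * Complex (fst h) (snd h))) (at (x, y))"
    if "(\<psi> has_field_derivative c) (at z)" for \<psi> :: "complex \<Rightarrow> complex" and c
    using diff_chain_at[OF has_derivative_Complex, of \<psi> "(*) c" "(x, y)"] that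
    by (simp add: o_def z_def has_field_derivative_def)
  let ?\<phi> = "\<lambda>p. \<phi> (Complex (fst p) (snd p))"
  define D where "D h = Ham (c0 * Complex (fst h) (snd h)) (c1 * Complex (fst h) (snd h))
    (c2 * Complex (fst h) (snd h)) (c3 * Complex (fst h) (snd h))" for h :: "real \<times> real"
  have lift': "((\<lambda>p. lift I (?\<phi> p)) has_derivative (\<lambda>h. lift I (D h))) (at (x, y))"
    unfolding lift_def Re_ham_Im_ham_sum D_def ham.sel
    by (intro derivative_intros has_derivative_mult_right d c)
  let ?B = "{p. Complex (fst p) (snd p) \<in> profile A}"
  have B: "open ?B" "(x, y) \<in> ?B"
    using z open_vimage_Complex[OF open_profile[OF A(1)]] by (auto simp: z_def)
  have "((\<lambda>p. f (slice_pt I (fst p) (snd p))) has_derivative (\<lambda>h. lift I (D h))) (at (x, y))"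
    by (rule has_derivative_transform_within_open[OF lift' B])
      (use rep I in \<open>auto simp: has_stem_def slice_pt_eq_pt\<close>)
  moreover have "(1/2) *\<^sub>R (lift I (D (1, 0)) + I * lift I (D (0, 1))) = 0"
  proof -
    have "Re_ham (D (0, 1)) = - Im_ham (D (1, 0))" "Im_ham (D (0, 1)) = Re_ham (D (1, 0))"
      by (simp_all add: D_def quat_eq_iff)
    then show ?thesis
      by (simp add: lift_def distrib_left right_diff_distrib imag_unit_mult_left[OF I])
  qed
  ultimately show "\<exists>f'. ((\<lambda>(u, v). f (slice_pt I u v)) has_derivative f') (at (x, y)) \<and>
      (1/2) *\<^sub>R (f' (1, 0) + I * f' (0, 1)) = 0"
    unfolding case_prod_beta' by blast
qed

section \<open>Semi-regular functions and meromorphic stem functions\<close>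

lemma ham_comps_mono: "ham_comps P \<phi> \<Longrightarrow> (\<And>\<psi>. P \<psi> \<Longrightarrow> Q \<psi>) \<Longrightarrow> ham_comps Q \<phi>"
  by (simp add: ham_comps_def)

text \<open>
The stem function of \<open>Delta p\<close> for a point \<open>p\<close> on the sphere of \<open>z\<close>.
\<close>

definition sphere_poly :: "complex \<Rightarrow> complex \<Rightarrow> complex" where
  "sphere_poly z w = (w - z) * (w - cnj z)"

lemma pt_add: "pt I (a + b) = pt I a + pt I b"
  and pt_diff: "pt I (a - b) = pt I a - pt I b"
  and pt_of_real: "pt I (of_real r) = of_real r"
  and pt_of_real_mult: "pt I (of_real r * a) = of_real r * pt I a"
  by (simp_all add: pt_scaleR quat_eq_iff sel_of_real sel_times algebra_simps)

lemma Delta_pt: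
  assumes I: "I \<in> imag_units"
  shows "Delta p (pt I w) = lift I (scal (sphere_poly (slice_coord p) w))"
proof -
  have n: "(norm p)\<^sup>2 = (qre p)\<^sup>2 + (qvec_norm p)\<^sup>2"
    by (simp add: norm_quat_def qvec_norm_def algebra_simps)
  have sq: "pt I w * pt I w = pt I (w * w)"
    using lift_scal_mult[OF I, of w "scal w"] by (simp add: lift_scal flip: scal_hom)
  have "sphere_poly (slice_coord p) w = w * w - of_real (2 * qre p) * w + of_real ((norm p)\<^sup>2)"
    by (simp add: sphere_poly_def n[unfolded power2_eq_square] complex_eq_iff algebra_simps power2_eq_square)
  then have "pt I (sphere_poly (slice_coord p) w) = pt I (w * w) - of_real (2 * qre p) * pt I w + of_real ((norm p)\<^sup>2)"
    by (simp only: pt_add pt_diff pt_of_real_mult pt_of_real)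
  then show ?thesis
    by (simp only: Delta_def lift_scal power2_eq_square sq)
qed

lemma Delta_power_pt:
  assumes I: "I \<in> imag_units"
  shows "Delta p (pt I w) ^ m * lift I x = lift I (scal (sphere_poly (slice_coord p) w ^ m) * x)"
proof (induction m)
  case (Suc m)
  then show ?case
    using lift_scal_mult[OF I, of "sphere_poly (slice_coord p) w" "scal (sphere_poly (slice_coord p) w ^ m) * x"]
    by (simp add: Delta_pt[OF I] mult.assoc scal_hom)
qed simp

lemma sphere_poly_eq_0_iff: "sphere_poly z w = 0 \<longleftrightarrow> w = z \<or> w = cnj z"
  by (auto simp: sphere_poly_def)

lemma pt_in_sphere_iff:
  assumes "I \<in> imag_units"
  shows "pt I w \<in> sphere_of p \<longleftrightarrow> w = slice_coord p \<or> w = cnj (slice_coord p)"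
  using slice_coord_pt_cases[OF assms, of w] slice_coord_sel(3)[of p]
  by (auto simp: sphere_of_iff slice_coord_pt[OF assms] complex_eq_iff)

text \<open>
The pair \<open>(A, f)\<close> is semi-regular on \<open>W\<close> with stem function \<open>\<phi>\<close>.  The last condition says that the points
of \<open>W\<close> outside \<open>A\<close> are isolated in the profile.
\<close>

definition meromorphic_stem :: "quat set \<Rightarrow> quat set \<times> (quat \<Rightarrow> quat) \<Rightarrow> (complex \<Rightarrow> complex ham) \<Rightarrow> bool" where
  "meromorphic_stem W = (\<lambda>(A, f) \<phi>. A \<subseteq> W \<and> open A \<and> circular A \<and> ham_comps (\<lambda>\<psi>. \<psi> meromorphic_on profile W) \<phi> \<and>
     stem_function_on (profile W) \<phi> \<and> ham_comps (\<lambda>\<psi>. \<psi> holomorphic_on profile A) \<phi> \<and> has_stem A f \<phi> \<and>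
     (\<forall>z\<in>profile W. eventually (\<lambda>w. w \<in> profile A) (at z)))"

text \<open>
Near a missing sphere the function \<open>h = \<Delta>\<^sup>m f\<close> has a holomorphic stem function \<open>\<eta>\<close>, and uniqueness of
stem functions gives \<open>\<eta> = ((w - z) (w - cnj z))\<^sup>m \<phi>\<close> off the sphere.  So \<open>\<phi>\<close> agrees near \<open>z\<close> with a quotient
of holomorphic functions.
\<close>

lemma semi_regular_imp_meromorphic_stem:
  assumes W: "open W" "circular W" and f: "(A, f) \<in> semi_regular W"
  shows "\<exists>\<phi>. meromorphic_stem W (A, f) \<phi>"
proof -
  have A: "A \<subseteq> W" "open A" "circular A" "slice_regular A f"
    and poles: "\<forall>p\<in>W - A. \<exists>U m h. open U \<and> circular U \<and> p \<in> U \<and> U \<subseteq> W \<and>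
       U - sphere_of p \<subseteq> A \<and> slice_regular U h \<and> (\<forall>q\<in>U - sphere_of p. h q = Delta p q ^ m * f q)"
    using f unfolding semi_regular_def mem_Collect_eq prod.case by simp_all
  obtain \<phi> where \<phi>: "ham_comps (\<lambda>\<psi>. \<psi> holomorphic_on profile A) \<phi>" "stem_function_on UNIV \<phi>" "has_stem A f \<phi>"
    by (rule slice_regular_imp_holomorphic[OF A(2,3,4)])
  have local: "eventually (\<lambda>w. w \<in> profile A) (at z) \<and> ham_comps (\<lambda>\<psi>. \<psi> meromorphic_on {z}) \<phi>"
    if z: "z \<in> profile W" for z
  proof (cases "z \<in> profile A")
    case True
    have "eventually (\<lambda>w. w \<in> profile A) (at z)"
      using eventually_at_in_open'[OF open_profile[OF A(2)] True] .
    moreover have "ham_comps (\<lambda>\<psi>. \<psi> meromorphic_on {z}) \<phi>"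
      by (rule ham_comps_mono[OF \<phi>(1)])
        (intro analytic_on_imp_meromorphic_on holomorphic_on_imp_analytic_at[OF _ open_profile[OF A(2)] True])
    ultimately show ?thesis ..
  next
    case False
    define p where "p = pt qi z"
    have p: "p \<in> W - A" using z False by (simp add: p_def profile_def)
    obtain U m h where U: "open U" "circular U" "p \<in> U" "U \<subseteq> W" "U - sphere_of p \<subseteq> A"
      "slice_regular U h" "\<forall>q\<in>U - sphere_of p. h q = Delta p q ^ m * f q"
      using bspec[OF poles p] by (elim exE conjE) (rule that)
    obtain \<eta> where \<eta>: "ham_comps (\<lambda>\<psi>. \<psi> holomorphic_on profile U) \<eta>" "stem_function_on UNIV \<eta>" "has_stem U h \<eta>"
      by (rule slice_regular_imp_holomorphic[OF U(1,2,6)])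
    have zU: "z \<in> profile U" using U(3) by (simp add: p_def profile_def)
    have zp: "slice_coord p = z \<or> slice_coord p = cnj z" unfolding p_def by (rule slice_coord_pt_cases) simp
    let ?V = "profile U - {cnj z}"
    have ev: "eventually (\<lambda>w. w \<in> profile U \<and> w \<noteq> z \<and> w \<noteq> cnj z) (at z)"
    proof (cases "cnj z = z")
      case True
      show ?thesis
        by (rule eventually_mono[OF eventually_at_in_open[OF open_profile[OF U(1)] zU]]) (simp add: True)
    next
      case False
      then have "open ?V" "z \<in> ?V" using open_profile[OF U(1)] zU by (auto intro: open_Diff)
      then show ?thesis
        by (intro eventually_mono[OF eventually_at_in_open[of ?V z]]) auto
    qed
    have off: "w \<in> profile A" "\<eta> w = scal (sphere_poly z w ^ m) * \<phi> w"
      if w: "w \<in> profile U" "w \<noteq> z" "w \<noteq> cnj z" for w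
    proof -
      have sp: "sphere_poly (slice_coord p) w = sphere_poly z w" using zp by (auto simp: sphere_poly_def)
      have in_U: "pt I w \<in> U - sphere_of p" if "I \<in> imag_units" for I
        using w zp profile_iff[OF U(2) that, of w] by (auto simp: pt_in_sphere_iff[OF that])
      then show wA: "w \<in> profile A" using U(5) q_imag_units(1) by (auto simp: profile_def)
      have "lift I (\<eta> w) = lift I (scal (sphere_poly z w ^ m) * \<phi> w)" if I: "I \<in> imag_units" for I
        using bspec[OF U(7) in_U[OF I]] \<eta>(3) \<phi>(3) I w(1) wA Delta_power_pt[OF I, of p w m "\<phi> w"]
        by (auto simp: has_stem_def sp)
      then show "\<eta> w = scal (sphere_poly z w ^ m) * \<phi> w"
        using uminus_imag_units[of qi] by (intro lift_eqD[of qi]) auto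
    qed
    have "eventually (\<lambda>w. w \<in> profile A) (at z)"
      using ev by eventually_elim (use off in blast)
    moreover have "ham_comps (\<lambda>\<psi>. \<psi> meromorphic_on {z}) \<phi>"
    proof -
      have *: "t \<circ> \<phi> meromorphic_on {z}"
        if t: "(\<lambda>w. t (\<eta> w)) holomorphic_on profile U" and lin: "\<And>c x. t (scal c * x) = c * t x" for t
      proof -
        have "(\<lambda>w. t (\<eta> w)) meromorphic_on {z}"
          by (intro analytic_on_imp_meromorphic_on holomorphic_on_imp_analytic_at[OF t open_profile[OF U(1)] zU])
        then have m: "(\<lambda>w. t (\<eta> w) / sphere_poly z w ^ m) meromorphic_on {z}"
          unfolding sphere_poly_def by (intro meromorphic_intros)
        have "(t \<circ> \<phi>) meromorphic_on {z} \<longleftrightarrow> (\<lambda>w. t (\<eta> w) / sphere_poly z w ^ m) meromorphic_on {z}"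
        proof (rule meromorphic_on_cong)
          fix y assume "y \<in> {z}"
          then have "y = z" by simp
          show "eventually (\<lambda>w. (t \<circ> \<phi>) w = t (\<eta> w) / sphere_poly z w ^ m) (at y)"
            unfolding \<open>y = z\<close> using ev
          proof eventually_elim
            case (elim w)
            then show ?case using off(2)[of w] by (auto simp: lin sphere_poly_eq_0_iff)
          qed
        qed simp
        with m show ?thesis by simp
      qed
      show ?thesis
        using \<eta>(1) unfolding ham_comps_def
        by (intro conjI *[unfolded o_def]) (elim conjE, assumption, rule scal_mult_sel)+
    qed
    ultimately show ?thesis ..
  qed
  have "ham_comps (\<lambda>\<psi>. \<psi> meromorphic_on profile W) \<phi>"
    unfolding ham_comps_def
    by (intro conjI; subst meromorphic_on_meromorphic_at; use local in \<open>simp add: ham_comps_def\<close>)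
  moreover have "stem_function_on (profile W) \<phi>" using \<phi>(2) by (simp add: stem_function_on_def)
  ultimately show ?thesis
    unfolding meromorphic_stem_def split using A(1-3) \<phi>(1,3) local by (intro exI[of _ \<phi>] conjI ballI) simp_all
qed

text \<open>
Symmetry under conjugation makes the value independent of the way a quaternion is written as a
point of a slice; at real points it makes the imaginary part vanish.
\<close>

lemma stem_function_on_extension:
  assumes B: "\<And>z. z \<in> B \<Longrightarrow> cnj z \<in> B" and sym: "stem_function_on B \<phi>"
  shows "\<exists>h. \<forall>I\<in>imag_units. \<forall>z\<in>B. h (pt I z) = lift I (\<phi> z)"
proof (intro exI ballI)
  let ?h = "\<lambda>q. Re_ham (\<phi> (slice_coord q)) + inverse (qvec_norm q) *\<^sub>R (q - of_real (qre q)) * Im_ham (\<phi> (slice_coord q))"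
  fix I z assume I: "I \<in> imag_units" and z: "z \<in> B"
  have c: "\<phi> (cnj z) = cnj_ham (\<phi> z)" using sym z by (simp add: stem_function_on_def)
  have n: "qvec_norm (pt I z) = \<bar>Im z\<bar>" "qre (pt I z) = Re z"
    using slice_coord_pt[OF I, of z] by (simp_all add: complex_eq_iff)
  have v: "pt I z - of_real (Re z) = Im z *\<^sub>R I" by (simp add: pt_scaleR)
  consider "Im z > 0" | "Im z < 0" | "Im z = 0" by linarith
  then show "?h (pt I z) = lift I (\<phi> z)"
  proof cases
    case 1
    then have "slice_coord (pt I z) = z" by (simp add: slice_coord_pt[OF I] complex_eq_iff)
    with 1 show ?thesis by (simp add: n v lift_def)
  next
    case 2
    then have "slice_coord (pt I z) = cnj z" by (simp add: slice_coord_pt[OF I] complex_eq_iff)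
    with 2 show ?thesis by (simp add: n v lift_def c)
  next
    case 3
    then have "slice_coord (pt I z) = z" "cnj z = z" by (simp_all add: slice_coord_pt[OF I] complex_eq_iff)
    moreover from this c have "Im_ham (\<phi> z) = 0"
      by (metis Re_ham_Im_ham_cnj_ham(2) equal_neg_zero quat_eq_iff quat_sel_real_vector(1-4,9-12))
    ultimately show ?thesis by (simp add: lift_def)
  qed
qed

lemma meromorphic_clear_pole:
  assumes "\<psi> meromorphic_on {z}"
  shows "\<exists>n. \<forall>m\<ge>n. \<exists>c. ((\<lambda>w. (w - z) ^ m * \<psi> w) \<longlongrightarrow> c) (at z)"
proof -
  define F where "F = laurent_expansion \<psi> z"
  have F: "(\<lambda>w. \<psi> (z + w)) has_laurent_expansion F"
    using meromorphic_on_imp_has_laurent_expansion[OF assms] by (simp add: F_def)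
  show ?thesis
  proof (intro exI[of _ "nat (- fls_subdegree F)"] allI impI)
    fix m assume m: "m \<ge> nat (- fls_subdegree F)"
    have "(\<lambda>w. w ^ m * \<psi> (z + w)) has_laurent_expansion fls_X ^ m * F"
      by (intro laurent_expansion_intros F)
    then have e: "(\<lambda>w. (z + w - z) ^ m * \<psi> (z + w)) has_laurent_expansion fls_X ^ m * F"
      by simp
    have "fls_subdegree (fls_X ^ m * F) \<ge> 0"
    proof (cases "F = 0")
      case False
      then have "fls_subdegree (fls_X ^ m * F) = int m + fls_subdegree F"
        by (simp add: fls_subdegree_mult fls_subdegree_pow)
      then show ?thesis using m by linarith
    qed simp
    from has_laurent_expansion_imp_tendsto[OF e this]
    show "\<exists>c. ((\<lambda>w. (w - z) ^ m * \<psi> w) \<longlongrightarrow> c) (at z)" by blast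
  qed
qed

text \<open>
Every sufficiently high power is taken, so that one exponent can serve all four coordinates.  A real \<open>z\<close>,
where \<open>sphere_poly z\<close> has a double zero, is included.
\<close>

lemma meromorphic_clear_sphere:
  assumes m1: "\<psi> meromorphic_on {z}" and m2: "\<psi> meromorphic_on {cnj z}"
  shows "\<exists>n. \<forall>m\<ge>n. remove_sings (\<lambda>w. sphere_poly z w ^ m * \<psi> w) analytic_on {z, cnj z}"
proof -
  obtain n1 where n1: "\<And>m. m \<ge> n1 \<Longrightarrow> \<exists>c. ((\<lambda>w. (w - z) ^ m * \<psi> w) \<longlongrightarrow> c) (at z)"
    using meromorphic_clear_pole[OF m1] by blast
  obtain n2 where n2: "\<And>m. m \<ge> n2 \<Longrightarrow> \<exists>c. ((\<lambda>w. (w - cnj z) ^ m * \<psi> w) \<longlongrightarrow> c) (at (cnj z))"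
    using meromorphic_clear_pole[OF m2] by blast
  show ?thesis
  proof (intro exI[of _ "max n1 n2"] allI impI)
    fix m assume m: "m \<ge> max n1 n2"
    let ?g = "\<lambda>w. sphere_poly z w ^ m * \<psi> w"
    obtain c1 c2 where c: "((\<lambda>w. (w - z) ^ m * \<psi> w) \<longlongrightarrow> c1) (at z)"
        "((\<lambda>w. (w - cnj z) ^ m * \<psi> w) \<longlongrightarrow> c2) (at (cnj z))"
      using n1 n2 m by (meson max.bounded_iff)
    have "((\<lambda>w. (w - cnj z) ^ m * ((w - z) ^ m * \<psi> w)) \<longlongrightarrow> (z - cnj z) ^ m * c1) (at z)"
      by (intro tendsto_intros c)
    then have t1: "(?g \<longlongrightarrow> (z - cnj z) ^ m * c1) (at z)"
      by (simp add: sphere_poly_def power_mult_distrib mult_ac)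
    have "((\<lambda>w. (w - z) ^ m * ((w - cnj z) ^ m * \<psi> w)) \<longlongrightarrow> (cnj z - z) ^ m * c2) (at (cnj z))"
      by (intro tendsto_intros c)
    then have t2: "(?g \<longlongrightarrow> (cnj z - z) ^ m * c2) (at (cnj z))"
      by (simp add: sphere_poly_def power_mult_distrib mult_ac)
    have "?g meromorphic_on {z}" "?g meromorphic_on {cnj z}"
      unfolding sphere_poly_def by (intro meromorphic_intros m1 m2)+
    then have "isolated_singularity_at ?g z" "isolated_singularity_at ?g (cnj z)"
      by (simp_all add: meromorphic_at_iff)
    then have "remove_sings ?g analytic_on {z}" "remove_sings ?g analytic_on {cnj z}"
      using remove_sings_analytic_at t1 t2 by blast+
    then show "remove_sings ?g analytic_on {z, cnj z}"
      by (metis analytic_on_Un insert_is_Un)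
  qed
qed

lemma filterlim_cnj_at: "filterlim cnj (at (cnj z)) (at z)"
  by (rule filterlim_atI) (auto intro!: tendsto_intros simp: eventually_at_filter)

text \<open>
Around a missing sphere take a conjugation-invariant neighbourhood \<open>B\<close> of \<open>z\<close> and \<open>cnj z\<close> on which \<open>\<phi>\<close> has no
other singularities.  After multiplication by a high power of \<open>(w - z) (w - cnj z)\<close> the singularities are
removable.  The extended coordinates are still symmetric, by continuity, hence induce the required
slice regular function.
\<close>

lemma meromorphic_stem_imp_semi_regular:
  assumes W: "open W" "circular W" and r: "meromorphic_stem W (A, f) \<phi>"
  shows "(A, f) \<in> semi_regular W"
proof -
  have A: "A \<subseteq> W" "open A" "circular A" and mero: "ham_comps (\<lambda>\<psi>. \<psi> meromorphic_on profile W) \<phi>"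
    and sym: "stem_function_on (profile W) \<phi>" and hol: "ham_comps (\<lambda>\<psi>. \<psi> holomorphic_on profile A) \<phi>"
    and rp: "has_stem A f \<phi>"
    and cosp: "\<And>z. z \<in> profile W \<Longrightarrow> eventually (\<lambda>w. w \<in> profile A) (at z)"
    using r by (auto simp: meromorphic_stem_def)
  have "stem_function_on (profile A) \<phi>"
    using sym profile_mono[OF A(1)] by (auto simp: stem_function_on_def)
  then have reg: "slice_regular A f"
    by (rule holomorphic_imp_slice_regular[OF A(2,3) hol _ rp])
  have poles: "\<exists>U m h. open U \<and> circular U \<and> p \<in> U \<and> U \<subseteq> W \<and> U - sphere_of p \<subseteq> A \<and>
        slice_regular U h \<and> (\<forall>q\<in>U - sphere_of p. h q = Delta p q ^ m * f q)" if p: "p \<in> W - A" for p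
  proof -
    define z where "z = slice_coord p"
    have z: "z \<in> profile W" using p slice_coord_profile_iff[OF W(2)] by (simp add: z_def)
    then have cz: "cnj z \<in> profile W" using profile_cnj_iff[OF W(2)] by simp
    have "eventually (\<lambda>w. w \<in> profile W \<and> (w \<noteq> z \<longrightarrow> w \<in> profile A)) (nhds z)"
      using cosp[OF z] eventually_nhds_in_open[OF open_profile[OF W(1)] z]
      unfolding eventually_at_filter by eventually_elim simp
    then obtain B0 where B0: "open B0" "z \<in> B0" "\<And>w. w \<in> B0 \<Longrightarrow> w \<in> profile W \<and> (w \<noteq> z \<longrightarrow> w \<in> profile A)"
      unfolding eventually_nhds by blast
    \<comment> \<open>symmetrized so that it is the profile of a circular set\<close>
    define B where "B = B0 \<union> cnj -` B0"
    have "open (cnj -` B0)"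
      using B0(1) by (intro open_vimage continuous_intros)
    then have B: "open B" "z \<in> B" using B0 by (auto simp: B_def)
    have B_cnj: "cnj w \<in> B" if "w \<in> B" for w using that by (auto simp: B_def)
    have B_W: "w \<in> profile W" if "w \<in> B" for w
      using that B0(3)[of w] B0(3)[of "cnj w"] profile_cnj_iff[OF W(2)] by (auto simp: B_def)
    have B_A: "w \<in> profile A" if "w \<in> B" "w \<noteq> z" "w \<noteq> cnj z" for w
      using that B0(3)[of w] B0(3)[of "cnj w"] profile_cnj_iff[OF A(3), of w] by (auto simp: B_def)
    define U where "U = spin B"
    have pU: "profile U = B" unfolding U_def by (rule profile_spin) (rule B_cnj)
    have U: "open U" "circular U" "p \<in> U"
      unfolding U_def using B by (auto simp: open_spin circular_spin) (simp add: spin_def z_def)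
    have UW: "U \<subseteq> W" unfolding circular_subset_iff[OF U(2) W(2)] pU using B_W by auto
    have "ham_comps (\<lambda>\<psi>. \<exists>n. \<forall>m\<ge>n. remove_sings (\<lambda>w. sphere_poly z w ^ m * \<psi> w) analytic_on {z, cnj z}) \<phi>"
      by (rule ham_comps_mono[OF mero], rule meromorphic_clear_sphere)
         (use z cz in \<open>auto intro: meromorphic_on_subset\<close>)
    then obtain n0 n1 n2 n3 where n:
      "\<And>m. m \<ge> n0 \<Longrightarrow> remove_sings (\<lambda>w. sphere_poly z w ^ m * h0 (\<phi> w)) analytic_on {z, cnj z}"
      "\<And>m. m \<ge> n1 \<Longrightarrow> remove_sings (\<lambda>w. sphere_poly z w ^ m * h1 (\<phi> w)) analytic_on {z, cnj z}"
      "\<And>m. m \<ge> n2 \<Longrightarrow> remove_sings (\<lambda>w. sphere_poly z w ^ m * h2 (\<phi> w)) analytic_on {z, cnj z}"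
      "\<And>m. m \<ge> n3 \<Longrightarrow> remove_sings (\<lambda>w. sphere_poly z w ^ m * h3 (\<phi> w)) analytic_on {z, cnj z}"
      unfolding ham_comps_def by blast
    define m where "m = max (max n0 n1) (max n2 n3)"
    define clear where "clear \<psi> = remove_sings (\<lambda>w. sphere_poly z w ^ m * \<psi> w)" for \<psi>
    define \<eta> where "\<eta> w = Ham (clear (\<lambda>w. h0 (\<phi> w)) w) (clear (\<lambda>w. h1 (\<phi> w)) w)
      (clear (\<lambda>w. h2 (\<phi> w)) w) (clear (\<lambda>w. h3 (\<phi> w)) w)" for w
    have clear_eq: "clear \<psi> w = sphere_poly z w ^ m * \<psi> w" "clear \<psi> analytic_on {w}"
      if w: "w \<in> B" "w \<noteq> z" "w \<noteq> cnj z" and \<psi>: "\<psi> holomorphic_on profile A" for \<psi> w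
    proof -
      have "\<psi> analytic_on {w}"
        using B_A[OF w] \<psi> open_profile[OF A(2)] holomorphic_on_imp_analytic_at by blast
      then have "(\<lambda>w. sphere_poly z w ^ m * \<psi> w) analytic_on {w}"
        unfolding sphere_poly_def by (intro analytic_intros)
      then show "clear \<psi> w = sphere_poly z w ^ m * \<psi> w" "clear \<psi> analytic_on {w}"
        unfolding clear_def by (rule remove_sings_at_analytic, rule remove_sings_analytic_on)
    qed
    have clear_hol: "clear \<psi> holomorphic_on B"
      if "clear \<psi> analytic_on {z, cnj z}" "\<psi> holomorphic_on profile A" for \<psi>
    proof (rule analytic_imp_holomorphic)
      have "clear \<psi> analytic_on {w}" if "w \<in> B" for w
        using that clear_eq(2)[of w \<psi>] \<open>clear \<psi> analytic_on {z, cnj z}\<close> \<open>\<psi> holomorphic_on profile A\<close>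
        by (cases "w = z \<or> w = cnj z") (auto intro: analytic_on_subset)
      then show "clear \<psi> analytic_on B" by (meson analytic_on_analytic_at)
    qed
    have m_le: "m \<ge> n0" "m \<ge> n1" "m \<ge> n2" "m \<ge> n3" by (auto simp: m_def)
    have hol\<eta>: "ham_comps (\<lambda>\<psi>. \<psi> holomorphic_on B) \<eta>"
      using hol unfolding ham_comps_def \<eta>_def ham.sel
      by (intro conjI clear_hol n(1)[OF m_le(1), folded clear_def] n(2)[OF m_le(2), folded clear_def]
          n(3)[OF m_le(3), folded clear_def] n(4)[OF m_le(4), folded clear_def]) simp_all
    have \<eta>_eq: "\<eta> w = scal (sphere_poly z w ^ m) * \<phi> w" if "w \<in> B" "w \<noteq> z" "w \<noteq> cnj z" for w
      using hol clear_eq(1)[OF that] by (simp add: ham_comps_def \<eta>_def ham_eq_iff)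
    have sym_off: "\<eta> (cnj w) = cnj_ham (\<eta> w)" if w: "w \<in> B" "w \<noteq> z" "w \<noteq> cnj z" for w
    proof -
      have "cnj w \<noteq> z" "cnj w \<noteq> cnj z" using w by (auto simp: complex_eq_iff)
      then have "\<eta> (cnj w) = scal (sphere_poly z (cnj w) ^ m) * \<phi> (cnj w)"
        using \<eta>_eq[OF B_cnj] w by simp
      moreover have "\<phi> (cnj w) = cnj_ham (\<phi> w)" using sym B_W w by (simp add: stem_function_on_def)
      moreover have "sphere_poly z (cnj w) = cnj (sphere_poly z w)" by (simp add: sphere_poly_def mult.commute)
      moreover have "cnj_ham (scal (sphere_poly z w ^ m)) = scal (cnj (sphere_poly z w) ^ m)"
        by (simp add: ham_eq_iff)
      ultimately show ?thesis by (simp add: \<eta>_eq[OF w] cnj_ham_hom)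
    qed
    have sym\<eta>: "stem_function_on B \<eta>"
      unfolding stem_function_on_def
    proof (intro ballI)
      fix a assume a: "a \<in> B"
      have ev: "eventually (\<lambda>w. w \<in> B \<and> w \<noteq> z \<and> w \<noteq> cnj z) (at a)"
      proof -
        have "open (B - ({z, cnj z} - {a}))" "a \<in> B - ({z, cnj z} - {a})"
          using a B(1) by (auto intro!: open_Diff finite_imp_closed)
        from eventually_at_in_open[OF this] show ?thesis by eventually_elim auto
      qed
      have *: "t (\<eta> (cnj a)) = cnj (t (\<eta> a))"
        if t: "(\<lambda>w. t (\<eta> w)) holomorphic_on B" and tc: "\<And>x. t (cnj_ham x) = cnj (t x)" for t
      proof -
        have cont: "((\<lambda>w. t (\<eta> w)) \<longlongrightarrow> t (\<eta> b)) (at b)" if "b \<in> B" for b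
          using holomorphic_on_imp_continuous_on[OF t] B(1) that
          by (simp add: continuous_on_eq_continuous_at isCont_def)
        have "((\<lambda>w. t (\<eta> (cnj w))) \<longlongrightarrow> t (\<eta> (cnj a))) (at a)"
          by (rule filterlim_compose[OF cont[OF B_cnj[OF a]] filterlim_cnj_at])
        moreover have "((\<lambda>w. cnj (t (\<eta> w))) \<longlongrightarrow> cnj (t (\<eta> a))) (at a)"
          by (intro tendsto_intros cont a)
        moreover have "eventually (\<lambda>w. t (\<eta> (cnj w)) = cnj (t (\<eta> w))) (at a)"
          using ev by eventually_elim (simp add: sym_off tc)
        ultimately show ?thesis
          using tendsto_cong[of "\<lambda>w. t (\<eta> (cnj w))" "\<lambda>w. cnj (t (\<eta> w))" "at a"]
            tendsto_unique[OF trivial_limit_at] by blast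
      qed
      show "\<eta> (cnj a) = cnj_ham (\<eta> a)"
        using hol\<eta> *[of h0] *[of h1] *[of h2] *[of h3] by (simp add: ham_comps_def ham_eq_iff)
    qed
    obtain h where h: "\<And>I w. I \<in> imag_units \<Longrightarrow> w \<in> B \<Longrightarrow> h (pt I w) = lift I (\<eta> w)"
      using stem_function_on_extension[OF B_cnj sym\<eta>] by blast
    have "slice_regular U h"
      by (rule holomorphic_imp_slice_regular[OF U(1,2), of \<eta>])
        (use hol\<eta> sym\<eta> h in \<open>auto simp: pU has_stem_def\<close>)
    moreover have off: "q \<in> A \<and> h q = Delta p q ^ m * f q" if q: "q \<in> U - sphere_of p" for q
    proof -
      obtain I where I: "I \<in> imag_units" "q = pt I (slice_coord q)" using pt_slice_coord by blast
      define w where "w = slice_coord q"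
      have w: "w \<in> B" "w \<noteq> z" "w \<noteq> cnj z"
        using q pt_in_sphere_iff[OF I(1), of w p] I(2) by (auto simp: U_def spin_def w_def z_def)
      have wA: "w \<in> profile A" by (rule B_A[OF w])
      have q_eq: "q = pt I w" using I(2) by (simp add: w_def)
      have "h (pt I w) = lift I (\<eta> w)" "f (pt I w) = lift I (\<phi> w)"
        using h[OF I(1) w(1)] rp I(1) wA by (simp_all add: has_stem_def)
      then show ?thesis
        using wA Delta_power_pt[OF I(1), of p w m "\<phi> w"] profile_iff[OF A(3) I(1), of w]
        by (simp add: q_eq \<eta>_eq[OF w] z_def)
    qed
    ultimately show ?thesis
      using U UW by (intro exI[of _ U] exI[of _ m] exI[of _ h]) blast
  qed
  show ?thesis using A reg poles by (simp add: semi_regular_def)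
qed

section \<open>The identity principle and germs of stem functions\<close>

lemma open_eventually_at: "open {z :: 'a :: t1_space. eventually P (at z)}"
  unfolding open_subopen[of "{z. eventually P (at z)}"]
proof (rule ballI)
  fix z assume zP: "z \<in> {z. eventually P (at z)}"
  from zP obtain S where S: "open S" "z \<in> S" "\<And>w. w \<in> S \<Longrightarrow> w \<noteq> z \<Longrightarrow> P w"
    unfolding eventually_at_topological by auto
  have "w \<in> {z. eventually P (at z)}" if "w \<in> S" for w
  proof (cases "w = z")
    case False
    then have "open (S - {z})" "w \<in> S - {z}" using S that by (auto intro: open_Diff)
    then show ?thesis using S(3) unfolding eventually_at_topological by blast
  qed (use zP in simp)
  then show "\<exists>T. open T \<and> z \<in> T \<and> T \<subseteq> {z. eventually P (at z)}" using S by blast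
qed

text \<open>
A meromorphic function vanishes identically near a point or has no zero in a punctured neighbourhood.
Both alternatives are open conditions on the point.  The profile itself can fall apart
into two conjugate halves, so the connectedness argument runs in the quaternionic domain, along the
map \<open>slice_coord\<close>; symmetry carries the conclusion over to both halves.
\<close>

lemma meromorphic_identity:
  assumes W: "open W" "connected W" "circular W"
    and mero: "\<psi> meromorphic_on profile W" and sym: "\<And>z. z \<in> profile W \<Longrightarrow> \<psi> (cnj z) = cnj (\<psi> z)"
    and z0: "z0 \<in> profile W" "eventually (\<lambda>w. \<psi> w = 0) (at z0)" and z: "z \<in> profile W"
  shows "eventually (\<lambda>w. \<psi> w = 0) (at z)"
proof -
  define S T where "S = {q. eventually (\<lambda>w. \<psi> w = 0) (at (slice_coord q))}" and "T = {q. eventually (\<lambda>w. \<psi> w \<noteq> 0) (at (slice_coord q))}"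
  have op: "open S" "open T"
    using open_vimage[OF open_eventually_at continuous_on_slice_coord]
    unfolding S_def T_def vimage_def by simp_all
  have dichotomy: "q \<in> S \<or> q \<in> T" if "q \<in> W" for q
  proof -
    have "slice_coord q \<in> profile W" using that slice_coord_profile_iff[OF W(3)] by simp
    note lau = meromorphic_on_imp_has_laurent_expansion[OF mero this]
    show ?thesis
      using has_laurent_expansion_eventually_zero_iff[OF lau] has_laurent_expansion_eventually_nonzero_iff[OF lau]
      unfolding S_def T_def by auto
  qed
  have disj: "q \<notin> T" if "q \<in> S" for q
  proof
    assume "q \<in> T"
    with that have "eventually (\<lambda>w. \<psi> w = 0) (at (slice_coord q))" "eventually (\<lambda>w. \<psi> w \<noteq> 0) (at (slice_coord q))"
      by (auto simp: S_def T_def)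
    then have "eventually (\<lambda>w. False) (at (slice_coord q))" by eventually_elim simp
    then show False by simp
  qed
  have flip: "eventually (\<lambda>w. \<psi> w = 0) (at (cnj y))"
    if y: "y \<in> profile W" and ev: "eventually (\<lambda>w. \<psi> w = 0) (at y)" for y
  proof -
    have cy: "cnj y \<in> profile W" using y profile_cnj_iff[OF W(3)] by simp
    have "filterlim cnj (at y) (at (cnj y))" using filterlim_cnj_at[of "cnj y"] by simp
    then have "eventually (\<lambda>w. \<psi> (cnj w) = 0) (at (cnj y))"
      using ev by (rule eventually_compose_filterlim[rotated])
    moreover have "eventually (\<lambda>w. w \<in> profile W) (at (cnj y))"
      by (rule eventually_at_in_open'[OF open_profile[OF W(1)] cy])
    ultimately show ?thesis by eventually_elim (simp add: sym)
  qed
  have to_S: "pt qi y \<in> S \<longleftrightarrow> eventually (\<lambda>w. \<psi> w = 0) (at y)" if y: "y \<in> profile W" for y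
    using slice_coord_pt_cases[of qi y] flip[OF y] flip[of "cnj y"] y profile_cnj_iff[OF W(3)]
    by (auto simp: S_def)
  have "pt qi z0 \<in> S \<inter> W" using to_S z0 by (simp add: profile_def)
  moreover have "S \<inter> W = {} \<or> T \<inter> W = {}"
  proof (rule ccontr)
    assume "\<not> (S \<inter> W = {} \<or> T \<inter> W = {})"
    then have "S \<inter> W \<noteq> {}" "T \<inter> W \<noteq> {}" by auto
    moreover have "W \<subseteq> S \<union> T" using dichotomy by blast
    moreover have "S \<inter> T \<inter> W = {}" using disj by blast
    ultimately show False using connectedD[OF W(2) op] by blast
  qed
  ultimately have "W \<subseteq> S" using dichotomy by blast
  then show ?thesis using to_S[OF z] z by (auto simp: profile_def)
qed

definition laurent_ham :: "complex \<Rightarrow> (complex \<Rightarrow> complex ham) \<Rightarrow> complex fls ham" where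
  "laurent_ham z \<phi> = Ham (laurent_expansion (\<lambda>w. h0 (\<phi> w)) z) (laurent_expansion (\<lambda>w. h1 (\<phi> w)) z)
    (laurent_expansion (\<lambda>w. h2 (\<phi> w)) z) (laurent_expansion (\<lambda>w. h3 (\<phi> w)) z)"

lemma laurent_expansion_hom:
  assumes "\<phi> meromorphic_on A" "\<psi> meromorphic_on A" "z \<in> A"
  shows "laurent_expansion (\<lambda>w. \<phi> w + \<psi> w) z = laurent_expansion \<phi> z + laurent_expansion \<psi> z"
    and "laurent_expansion (\<lambda>w. \<phi> w - \<psi> w) z = laurent_expansion \<phi> z - laurent_expansion \<psi> z"
    and "laurent_expansion (\<lambda>w. \<phi> w * \<psi> w) z = laurent_expansion \<phi> z * laurent_expansion \<psi> z"
    and "laurent_expansion (\<lambda>w. - \<phi> w) z = - laurent_expansion \<phi> z"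
    and "laurent_expansion (\<lambda>w. inverse (\<phi> w)) z = inverse (laurent_expansion \<phi> z)"
  by (intro laurent_expansion_eqI laurent_expansion_intros
      meromorphic_on_imp_has_laurent_expansion[OF assms(1,3)]
      meromorphic_on_imp_has_laurent_expansion[OF assms(2,3)])+

lemma laurent_expansion_const: "laurent_expansion (\<lambda>_. c) z = fls_const c"
  by (intro laurent_expansion_eqI laurent_expansion_intros)

lemma laurent_ham_hom:
  assumes "ham_comps (\<lambda>\<psi>. \<psi> meromorphic_on A) \<phi>" "ham_comps (\<lambda>\<psi>. \<psi> meromorphic_on A) \<phi>'" "z \<in> A"
  shows "laurent_ham z (\<lambda>w. \<phi> w + \<phi>' w) = laurent_ham z \<phi> + laurent_ham z \<phi>'"
    and "laurent_ham z (\<lambda>w. \<phi> w * \<phi>' w) = laurent_ham z \<phi> * laurent_ham z \<phi>'"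
  using assms unfolding ham_comps_def
  by (simp_all add: laurent_ham_def ham_eq_iff ham_sel_times laurent_expansion_hom[of _ A] meromorphic_intros)

text \<open>
All functions are expanded at the base point \<open>z0\<close>.  It may be real, and it may be a pole of some of them.
\<close>

locale circular_domain_point =
  fixes W :: "quat set" and z0 :: complex
  assumes dom: "circular_domain W" and z0: "z0 \<in> profile W"
begin

lemma W: "open W" "connected W" "circular W"
  using dom by (simp_all add: circular_domain_def)

lemma semi_regular_iff_meromorphic_stem: "(A, f) \<in> semi_regular W \<longleftrightarrow> (\<exists>\<phi>. meromorphic_stem W (A, f) \<phi>)"
  using semi_regular_imp_meromorphic_stem[OF W(1,3)] meromorphic_stem_imp_semi_regular[OF W(1,3)] by blast

lemma meromorphic_stem_Int:
  assumes "meromorphic_stem W (A, f) \<phi>" "meromorphic_stem W (B, g) \<psi>"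
  shows "meromorphic_stem W (A \<inter> B, \<lambda>q. f q + g q) (\<lambda>z. \<phi> z + \<psi> z)"
    and "meromorphic_stem W (A \<inter> B, star_prod f g) (\<lambda>z. \<phi> z * \<psi> z)"
proof -
  have A: "A \<subseteq> W" "open A" "circular A" "ham_comps (\<lambda>\<psi>. \<psi> meromorphic_on profile W) \<phi>"
    "stem_function_on (profile W) \<phi>" "ham_comps (\<lambda>\<psi>. \<psi> holomorphic_on profile A) \<phi>" "has_stem A f \<phi>"
    "\<And>z. z \<in> profile W \<Longrightarrow> eventually (\<lambda>w. w \<in> profile A) (at z)"
    using assms(1) by (auto simp: meromorphic_stem_def)
  have B: "B \<subseteq> W" "open B" "circular B" "ham_comps (\<lambda>\<psi>. \<psi> meromorphic_on profile W) \<psi>"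
    "stem_function_on (profile W) \<psi>" "ham_comps (\<lambda>\<psi>. \<psi> holomorphic_on profile B) \<psi>" "has_stem B g \<psi>"
    "\<And>z. z \<in> profile W \<Longrightarrow> eventually (\<lambda>w. w \<in> profile B) (at z)"
    using assms(2) by (auto simp: meromorphic_stem_def)
  have AB: "A \<inter> B \<subseteq> W" "open (A \<inter> B)" "circular (A \<inter> B)"
    "\<And>z. z \<in> profile W \<Longrightarrow> eventually (\<lambda>w. w \<in> profile (A \<inter> B)) (at z)"
    using A(1-3) B(1-3) eventually_conj[OF A(8) B(8)] by (auto simp: circular_Int profile_Int)
  have hol: "ham_comps (\<lambda>\<psi>. \<psi> holomorphic_on profile (A \<inter> B)) \<phi>"
    by (rule ham_comps_mono[OF A(6)], erule holomorphic_on_subset) (simp add: profile_Int)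
  have hol': "ham_comps (\<lambda>\<psi>. \<psi> holomorphic_on profile (A \<inter> B)) \<psi>"
    by (rule ham_comps_mono[OF B(6)], erule holomorphic_on_subset) (simp add: profile_Int)
  have "ham_comps (\<lambda>\<psi>. \<psi> holomorphic_on profile (A \<inter> B)) (\<lambda>z. \<phi> z + \<psi> z)"
    "ham_comps (\<lambda>\<psi>. \<psi> meromorphic_on profile W) (\<lambda>z. \<phi> z + \<psi> z)"
    "ham_comps (\<lambda>\<psi>. \<psi> holomorphic_on profile (A \<inter> B)) (\<lambda>z. \<phi> z * \<psi> z)"
    "ham_comps (\<lambda>\<psi>. \<psi> meromorphic_on profile W) (\<lambda>z. \<phi> z * \<psi> z)"
    using hol hol' A(4) B(4) unfolding ham_comps_def ham_sel_simps ham_sel_times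
    by (auto intro!: holomorphic_intros meromorphic_intros)
  moreover have "stem_function_on (profile W) (\<lambda>z. \<phi> z + \<psi> z)" "stem_function_on (profile W) (\<lambda>z. \<phi> z * \<psi> z)"
    using A(5) B(5) by (simp_all add: stem_function_on_def cnj_ham_hom)
  moreover have "has_stem (A \<inter> B) (\<lambda>q. f q + g q) (\<lambda>z. \<phi> z + \<psi> z)"
    using A(7) B(7) by (simp add: has_stem_def profile_Int lift_add)
  moreover have "has_stem (A \<inter> B) (star_prod f g) (\<lambda>z. \<phi> z * \<psi> z)"
    unfolding has_stem_def profile_Int
    by (intro ballI star_prod_lift) (use A(7) B(7) in \<open>simp_all add: has_stem_def\<close>)
  ultimately show "meromorphic_stem W (A \<inter> B, \<lambda>q. f q + g q) (\<lambda>z. \<phi> z + \<psi> z)"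
    "meromorphic_stem W (A \<inter> B, star_prod f g) (\<lambda>z. \<phi> z * \<psi> z)"
    unfolding meromorphic_stem_def split using AB by simp_all
qed

lemma zero_laurent_imp_zero:
  assumes mero: "\<psi> meromorphic_on profile W" and sym: "\<And>z. z \<in> profile W \<Longrightarrow> \<psi> (cnj z) = cnj (\<psi> z)"
    and zero: "laurent_expansion \<psi> z0 = 0" and A: "open A" "A \<subseteq> profile W" "\<psi> holomorphic_on A" and z: "z \<in> A"
  shows "\<psi> z = 0"
proof -
  have "eventually (\<lambda>w. \<psi> w = 0) (at z0)"
    using has_laurent_expansion_eventually_zero_iff[OF meromorphic_on_imp_has_laurent_expansion[OF mero z0]] zero
    by simp
  then have "eventually (\<lambda>w. \<psi> w = 0) (at z)"
    using meromorphic_identity[OF W mero sym z0] z A(2) by blast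
  then have "(\<psi> \<longlongrightarrow> 0) (at z)" by (rule tendsto_eventually)
  moreover have "(\<psi> \<longlongrightarrow> \<psi> z) (at z)"
    using holomorphic_on_imp_continuous_on[OF A(3)] A(1) z
    by (simp add: continuous_on_eq_continuous_at isCont_def)
  ultimately show ?thesis using tendsto_unique[OF trivial_limit_at] by blast
qed

text \<open>
Agreement on the common domain forces agreement of the stem functions near \<open>z0\<close>, as the domains are
missing isolated points only.  The converse is the identity principle for the four coordinates of the
difference.
\<close>

lemma meromorphic_stem_agree_iff:
  assumes "meromorphic_stem W (A, f) \<phi>" "meromorphic_stem W (B, g) \<psi>"
  shows "(\<forall>q\<in>A \<inter> B. f q = g q) \<longleftrightarrow> laurent_ham z0 \<phi> = laurent_ham z0 \<psi>"
proof
  have A: "A \<subseteq> W" "open A" "circular A" "ham_comps (\<lambda>\<psi>. \<psi> meromorphic_on profile W) \<phi>"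
    "stem_function_on (profile W) \<phi>" "ham_comps (\<lambda>\<psi>. \<psi> holomorphic_on profile A) \<phi>" "has_stem A f \<phi>"
    "\<And>z. z \<in> profile W \<Longrightarrow> eventually (\<lambda>w. w \<in> profile A) (at z)"
    using assms(1) by (auto simp: meromorphic_stem_def)
  have B: "B \<subseteq> W" "open B" "circular B" "ham_comps (\<lambda>\<psi>. \<psi> meromorphic_on profile W) \<psi>"
    "stem_function_on (profile W) \<psi>" "ham_comps (\<lambda>\<psi>. \<psi> holomorphic_on profile B) \<psi>" "has_stem B g \<psi>"
    "\<And>z. z \<in> profile W \<Longrightarrow> eventually (\<lambda>w. w \<in> profile B) (at z)"
    using assms(2) by (auto simp: meromorphic_stem_def)
  {
    assume eq: "\<forall>q\<in>A \<inter> B. f q = g q"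
    have "\<phi> w = \<psi> w" if w: "w \<in> profile A" "w \<in> profile B" for w
    proof -
      have "lift I (\<phi> w) = lift I (\<psi> w)" if I: "I \<in> imag_units" for I
      proof -
        have "pt I w \<in> A \<inter> B" using w profile_iff[OF A(3) I] profile_iff[OF B(3) I] by simp
        with eq have "f (pt I w) = g (pt I w)" by (rule bspec)
        then show ?thesis using A(7) B(7) I w by (simp add: has_stem_def)
      qed
      then show ?thesis using uminus_imag_units[of qi] by (intro lift_eqD[of qi]) auto
    qed
    then have ev: "eventually (\<lambda>w. \<phi> w = \<psi> w) (at z0)"
      using eventually_conj[OF A(8)[OF z0] B(8)[OF z0]] by (auto elim: eventually_mono)
    show "laurent_ham z0 \<phi> = laurent_ham z0 \<psi>"
      unfolding laurent_ham_def ham.inject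
      by (intro conjI laurent_expansion_cong refl eventually_mono[OF ev]) simp_all
  next
    assume lau: "laurent_ham z0 \<phi> = laurent_ham z0 \<psi>"
    have eq: "\<phi> w = \<psi> w" if w: "w \<in> profile (A \<inter> B)" for w
    proof -
      have *: "t (\<phi> w) = t (\<psi> w)"
        if t: "(\<lambda>w. t (\<phi> w)) meromorphic_on profile W" "(\<lambda>w. t (\<psi> w)) meromorphic_on profile W"
          "(\<lambda>w. t (\<phi> w)) holomorphic_on profile A" "(\<lambda>w. t (\<psi> w)) holomorphic_on profile B"
          and tc: "\<And>x. t (cnj_ham x) = cnj (t x)"
          and tl: "laurent_expansion (\<lambda>w. t (\<phi> w)) z0 = laurent_expansion (\<lambda>w. t (\<psi> w)) z0" for t
      proof -
        have "t (\<phi> w) - t (\<psi> w) = 0"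
        proof (rule zero_laurent_imp_zero[where A = "profile (A \<inter> B)" and z = w and \<psi> = "\<lambda>w. t (\<phi> w) - t (\<psi> w)"])
          show "(\<lambda>w. t (\<phi> w) - t (\<psi> w)) meromorphic_on profile W"
            using t by (intro meromorphic_intros)
          show "t (\<phi> (cnj z)) - t (\<psi> (cnj z)) = cnj (t (\<phi> z) - t (\<psi> z))" if "z \<in> profile W" for z
            using A(5) B(5) that by (simp add: stem_function_on_def tc)
          show "laurent_expansion (\<lambda>w. t (\<phi> w) - t (\<psi> w)) z0 = 0"
            using tl by (simp add: laurent_expansion_hom(2)[OF t(1,2) z0])
          show "open (profile (A \<inter> B))" "profile (A \<inter> B) \<subseteq> profile W" "w \<in> profile (A \<inter> B)"
            using A(1,2) B(2) w by (auto intro!: open_profile profile_mono)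
          show "(\<lambda>w. t (\<phi> w) - t (\<psi> w)) holomorphic_on profile (A \<inter> B)"
            unfolding profile_Int
            by (intro holomorphic_intros holomorphic_on_subset[OF t(3)] holomorphic_on_subset[OF t(4)]) auto
        qed
        then show ?thesis by simp
      qed
      show ?thesis
        unfolding ham_eq_iff
        using A(4,6) B(4,6) lau *[of h0] *[of h1] *[of h2] *[of h3]
        by (simp add: ham_comps_def laurent_ham_def)
    qed
    show "\<forall>q\<in>A \<inter> B. f q = g q"
    proof
      fix q assume q: "q \<in> A \<inter> B"
      obtain I where I: "I \<in> imag_units" "q = pt I (slice_coord q)" using pt_slice_coord by blast
      define w where "w = slice_coord q"
      have q_eq: "q = pt I w" using I(2) by (simp add: w_def)
      have w: "w \<in> profile A" "w \<in> profile B"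
        using q slice_coord_profile_iff[OF A(3)] slice_coord_profile_iff[OF B(3)] by (auto simp: w_def)
      then have "f (pt I w) = g (pt I w)"
        using A(7) B(7) I(1) eq[of w] by (simp add: has_stem_def profile_Int)
      then show "f q = g q" by (simp only: q_eq)
    qed
  }
qed

text \<open>
The induced function is taken on the set of points where all coordinates are analytic, at the point and
at its conjugate.
\<close>

lemma stem_function_imp_meromorphic_stem:
  assumes mero: "ham_comps (\<lambda>\<psi>. \<psi> meromorphic_on profile W) \<phi>" and sym: "stem_function_on (profile W) \<phi>"
  shows "\<exists>A f. meromorphic_stem W (A, f) \<phi>"
proof -
  define an where "an w \<longleftrightarrow> ham_comps (\<lambda>\<psi>. \<psi> analytic_on {w}) \<phi>" for w
  define B0 where "B0 = {w \<in> profile W. an w}"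
  \<comment> \<open>intersected with its conjugate so that it is the profile of a circular set\<close>
  define B where "B = B0 \<inter> cnj -` B0"
  have op: "open {w. an w}"
  proof -
    have "open {w. \<psi> analytic_on {w}}" for \<psi> :: "complex \<Rightarrow> complex"
      unfolding open_subopen[of "{w. \<psi> analytic_on {w}}"]
    proof (rule ballI)
      fix w assume "w \<in> {w. \<psi> analytic_on {w}}"
      then obtain S where "open S" "w \<in> S" "\<psi> holomorphic_on S" by (auto simp: analytic_at)
      then show "\<exists>T. open T \<and> w \<in> T \<and> T \<subseteq> {w. \<psi> analytic_on {w}}"
        by (intro exI[of _ S]) (auto simp: analytic_at)
    qed
    then show ?thesis
      unfolding an_def ham_comps_def by (intro open_Collect_conj)
  qed
  have "B0 = profile W \<inter> {w. an w}" by (auto simp: B0_def)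
  then have "open B0" using op open_profile[OF W(1)] by auto
  then have B: "open B" unfolding B_def by (intro open_Int open_vimage continuous_intros)
  have B_cnj: "cnj w \<in> B" if "w \<in> B" for w using that by (auto simp: B_def)
  have B_W: "B \<subseteq> profile W" by (auto simp: B_def B0_def)
  have ev0: "eventually (\<lambda>w. w \<in> B0) (at z)" if z: "z \<in> profile W" for z
  proof -
    have *: "eventually (\<lambda>w. \<psi> analytic_on {w}) (at z)" if "\<psi> meromorphic_on profile W" for \<psi>
      using meromorphic_on_imp_analytic_cosparse[OF that] z by (rule eventually_cosparse_imp_eventually_at)
    have "eventually an (at z)"
      using mero unfolding an_def[abs_def] ham_comps_def by (intro eventually_conj *) simp_all
    moreover have "eventually (\<lambda>w. w \<in> profile W) (at z)"
      by (rule eventually_at_in_open'[OF open_profile[OF W(1)] z])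
    ultimately show ?thesis by eventually_elim (simp add: B0_def)
  qed
  have ev: "eventually (\<lambda>w. w \<in> B) (at z)" if z: "z \<in> profile W" for z
  proof -
    have "cnj z \<in> profile W" using z profile_cnj_iff[OF W(3)] by simp
    from ev0[OF this] have "eventually (\<lambda>w. cnj w \<in> B0) (at z)"
      by (rule eventually_compose_filterlim[OF _ filterlim_cnj_at])
    with ev0[OF z] show ?thesis by eventually_elim (simp add: B_def)
  qed
  define A where "A = spin B"
  have pA: "profile A = B" unfolding A_def by (rule profile_spin) (rule B_cnj)
  have A: "open A" "circular A" unfolding A_def using B by (simp_all add: open_spin circular_spin)
  have AW: "A \<subseteq> W" unfolding circular_subset_iff[OF A(2) W(3)] pA by (rule B_W)
  have "stem_function_on B \<phi>" using sym B_W by (auto simp: stem_function_on_def)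
  from stem_function_on_extension[OF B_cnj this] obtain h where
    h: "\<forall>I\<in>imag_units. \<forall>z\<in>B. h (pt I z) = lift I (\<phi> z)" by blast
  have "\<psi> holomorphic_on B" if "\<And>w. w \<in> B \<Longrightarrow> \<psi> analytic_on {w}" for \<psi>
    using that analytic_imp_holomorphic analytic_on_analytic_at by metis
  then have "ham_comps (\<lambda>\<psi>. \<psi> holomorphic_on B) \<phi>"
    unfolding ham_comps_def by (auto simp: B_def B0_def an_def ham_comps_def)
  then have "meromorphic_stem W (A, h) \<phi>"
    unfolding meromorphic_stem_def split has_stem_def pA using A AW mero sym h ev by simp
  then show ?thesis by blast
qed

section \<open>The ring of semi-regular functions\<close>

text \<open>
The choice of the stem function is harmless by \<open>meromorphic_stem_agree_iff\<close>.
\<close>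

definition germ :: "quat set \<times> (quat \<Rightarrow> quat) \<Rightarrow> complex fls ham" where
  "germ p = laurent_ham z0 (SOME \<phi>. meromorphic_stem W p \<phi>)"

lemma germ_eq: "meromorphic_stem W p \<phi> \<Longrightarrow> germ p = laurent_ham z0 \<phi>"
proof -
  assume r: "meromorphic_stem W p \<phi>"
  obtain A f where p: "p = (A, f)" by (cases p)
  have "meromorphic_stem W p (SOME \<phi>. meromorphic_stem W p \<phi>)" using someI[of "meromorphic_stem W p" \<phi>] r by simp
  from meromorphic_stem_agree_iff[OF this[unfolded p] r[unfolded p]] show ?thesis by (simp add: germ_def p)
qed

lemma semi_regular_meromorphic_stem:
  assumes "p \<in> semi_regular W"
  obtains A f \<phi> where "p = (A, f)" "meromorphic_stem W (A, f) \<phi>" "germ p = laurent_ham z0 \<phi>"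
  using assms semi_regular_iff_meromorphic_stem germ_eq by (cases p) metis

lemma meromorphic_stem_semi_regular: "meromorphic_stem W p \<phi> \<Longrightarrow> p \<in> semi_regular W"
  using semi_regular_iff_meromorphic_stem by (cases p) metis

lemma sem_eq_iff: "(p, q) \<in> sem_eq W \<longleftrightarrow> p \<in> semi_regular W \<and> q \<in> semi_regular W \<and> germ p = germ q"
proof (cases "p \<in> semi_regular W \<and> q \<in> semi_regular W")
  case True
  then have p: "p \<in> semi_regular W" and q: "q \<in> semi_regular W" by auto
  obtain A f \<phi> where A: "p = (A, f)" "meromorphic_stem W (A, f) \<phi>" "germ p = laurent_ham z0 \<phi>"
    by (rule semi_regular_meromorphic_stem[OF p])
  obtain B g \<psi> where B: "q = (B, g)" "meromorphic_stem W (B, g) \<psi>" "germ q = laurent_ham z0 \<psi>"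
    by (rule semi_regular_meromorphic_stem[OF q])
  show ?thesis
    using True A B meromorphic_stem_agree_iff[OF A(2) B(2)] by (simp add: sem_eq_def)
qed (auto simp: sem_eq_def)

text \<open>
The elements of the ring of semi-regular functions are exactly the nonempty fibres of \<open>germ\<close>.
\<close>

definition germ_class :: "complex fls ham \<Rightarrow> sem" where
  "germ_class e = {q \<in> semi_regular W. germ q = e}"

lemma sem_class_germ_class: "(D, f) \<in> semi_regular W \<Longrightarrow> sem_class W D f = germ_class (germ (D, f))"
  by (auto simp: sem_class_def germ_class_def sem_eq_iff)

lemma sem_class_meromorphic_stem: "meromorphic_stem W (D, f) \<phi> \<Longrightarrow> sem_class W D f = germ_class (laurent_ham z0 \<phi>)"
  using sem_class_germ_class[of D f] meromorphic_stem_semi_regular[of "(D, f)"] germ_eq[of "(D, f)"] by simp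

definition germs :: "complex fls ham set" where
  "germs = germ ` semi_regular W"

definition \<Psi> :: "sem \<Rightarrow> complex fls ham" where
  "\<Psi> X = germ (SOME p. p \<in> X)"

lemma \<Psi>_germ_class: "e \<in> germs \<Longrightarrow> \<Psi> (germ_class e) = e"
proof -
  assume "e \<in> germs"
  then have "\<exists>p. p \<in> germ_class e" by (auto simp: germs_def germ_class_def)
  then have "(SOME p. p \<in> germ_class e) \<in> germ_class e" by (rule someI_ex)
  then show ?thesis by (simp add: \<Psi>_def germ_class_def)
qed

lemma carrier_SEM: "carrier (SEM W) = germ_class ` germs"
proof -
  have "carrier (SEM W) = (\<Union>p\<in>semi_regular W. {sem_eq W `` {p}})"
    by (simp add: SEM_def quotient_def)
  also have "\<dots> = (\<Union>p\<in>semi_regular W. {germ_class (germ p)})"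
    by (intro SUP_cong refl) (auto simp: germ_class_def sem_eq_iff)
  also have "\<dots> = germ_class ` germs" by (auto simp: germs_def)
  finally show ?thesis .
qed

lemma SEM_elem: "X \<in> carrier (SEM W) \<Longrightarrow> X = germ_class (\<Psi> X) \<and> \<Psi> X \<in> germs"
  unfolding carrier_SEM using \<Psi>_germ_class by auto

lemma meromorphic_stem_in_germs: "meromorphic_stem W (A, f) \<phi> \<Longrightarrow> laurent_ham z0 \<phi> \<in> germs"
  using meromorphic_stem_semi_regular germ_eq by (metis germs_def imageI)

text \<open>
An operation on representatives that corresponds to an operation on germs is independent of the
representatives; the union in its definition is then a union of equal sets.
\<close>

lemma germ_class_op:
  assumes op: "\<And>A f \<phi> B g \<psi>. meromorphic_stem W (A, f) \<phi> \<Longrightarrow> meromorphic_stem W (B, g) \<psi> \<Longrightarrow>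
      meromorphic_stem W (A \<inter> B, opf f g) (\<lambda>z. opc (\<phi> z) (\<psi> z)) \<and>
      laurent_ham z0 (\<lambda>z. opc (\<phi> z) (\<psi> z)) = oph (laurent_ham z0 \<phi>) (laurent_ham z0 \<psi>)"
    and X: "e1 \<in> germs" "e2 \<in> germs"
  shows "(\<Union>(A, f)\<in>germ_class e1. \<Union>(B, g)\<in>germ_class e2. sem_class W (A \<inter> B) (opf f g)) = germ_class (oph e1 e2)"
    and "oph e1 e2 \<in> germs"
proof -
  have *: "sem_class W (fst p \<inter> fst q) (opf (snd p) (snd q)) = germ_class (oph e1 e2) \<and> oph e1 e2 \<in> germs"
    if "p \<in> germ_class e1" "q \<in> germ_class e2" for p q
  proof -
    have pq: "p \<in> semi_regular W" "germ p = e1" "q \<in> semi_regular W" "germ q = e2"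
      using that by (auto simp: germ_class_def)
    obtain A f \<phi> where A: "p = (A, f)" "meromorphic_stem W (A, f) \<phi>" "germ p = laurent_ham z0 \<phi>"
      by (rule semi_regular_meromorphic_stem[OF pq(1)])
    obtain B g \<psi> where B: "q = (B, g)" "meromorphic_stem W (B, g) \<psi>" "germ q = laurent_ham z0 \<psi>"
      by (rule semi_regular_meromorphic_stem[OF pq(3)])
    note o = op[OF A(2) B(2)]
    have "laurent_ham z0 (\<lambda>z. opc (\<phi> z) (\<psi> z)) = oph e1 e2" using o A(3) B(3) pq(2,4) by simp
    then show ?thesis
      using sem_class_meromorphic_stem[OF conjunct1[OF o]] meromorphic_stem_in_germs[OF conjunct1[OF o]] A(1) B(1) by simp
  qed
  obtain p q where pq: "p \<in> germ_class e1" "q \<in> germ_class e2"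
    using X by (auto simp: germs_def germ_class_def)
  show "oph e1 e2 \<in> germs" using *[OF pq] by simp
  have "(\<Union>(A, f)\<in>germ_class e1. \<Union>(B, g)\<in>germ_class e2. sem_class W (A \<inter> B) (opf f g)) =
      (\<Union>p\<in>germ_class e1. \<Union>q\<in>germ_class e2. sem_class W (fst p \<inter> fst q) (opf (snd p) (snd q)))"
    by (simp only: case_prod_beta')
  also have "\<dots> = (\<Union>p\<in>germ_class e1. \<Union>q\<in>germ_class e2. germ_class (oph e1 e2))"
    using * by (intro SUP_cong refl) simp
  also have "\<dots> = germ_class (oph e1 e2)" using pq by auto
  finally show "(\<Union>(A, f)\<in>germ_class e1. \<Union>(B, g)\<in>germ_class e2. sem_class W (A \<inter> B) (opf f g)) = germ_class (oph e1 e2)" .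
qed

lemma meromorphic_stem_meromorphic: "meromorphic_stem W (A, f) \<phi> \<Longrightarrow> ham_comps (\<lambda>\<psi>. \<psi> meromorphic_on profile W) \<phi>"
  by (simp add: meromorphic_stem_def)

lemma SEM_add_mult:
  assumes "X \<in> carrier (SEM W)" "Y \<in> carrier (SEM W)"
  shows "X \<oplus>\<^bsub>SEM W\<^esub> Y = germ_class (\<Psi> X + \<Psi> Y)" "\<Psi> X + \<Psi> Y \<in> germs"
    "X \<otimes>\<^bsub>SEM W\<^esub> Y = germ_class (\<Psi> X * \<Psi> Y)" "\<Psi> X * \<Psi> Y \<in> germs"
proof -
  note X = SEM_elem[OF assms(1)] and Y = SEM_elem[OF assms(2)]
  have fX: "germ_class (\<Psi> X) = X" by (rule sym[OF conjunct1[OF X]])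
  have fY: "germ_class (\<Psi> Y) = Y" by (rule sym[OF conjunct1[OF Y]])
  have op1: "meromorphic_stem W (A \<inter> B, \<lambda>q. f q + g q) (\<lambda>z. \<phi> z + \<psi> z) \<and>
      laurent_ham z0 (\<lambda>z. \<phi> z + \<psi> z) = laurent_ham z0 \<phi> + laurent_ham z0 \<psi>"
    if "meromorphic_stem W (A, f) \<phi>" "meromorphic_stem W (B, g) \<psi>" for A f \<phi> B g \<psi>
    using meromorphic_stem_Int(1)[OF that] laurent_ham_hom(1)[OF meromorphic_stem_meromorphic[OF that(1)] meromorphic_stem_meromorphic[OF that(2)] z0] by simp
  have op2: "meromorphic_stem W (A \<inter> B, star_prod f g) (\<lambda>z. \<phi> z * \<psi> z) \<and>
      laurent_ham z0 (\<lambda>z. \<phi> z * \<psi> z) = laurent_ham z0 \<phi> * laurent_ham z0 \<psi>"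
    if "meromorphic_stem W (A, f) \<phi>" "meromorphic_stem W (B, g) \<psi>" for A f \<phi> B g \<psi>
    using meromorphic_stem_Int(2)[OF that] laurent_ham_hom(2)[OF meromorphic_stem_meromorphic[OF that(1)] meromorphic_stem_meromorphic[OF that(2)] z0] by simp
  note a = germ_class_op[where opf = "\<lambda>f g q. f q + g q" and opc = "(+)" and oph = "(+)", OF op1 conjunct2[OF X] conjunct2[OF Y]]
  note m = germ_class_op[where opf = star_prod and opc = "(*)" and oph = "(*)", OF op2 conjunct2[OF X] conjunct2[OF Y]]
  show "\<Psi> X + \<Psi> Y \<in> germs" by (rule a(2))
  show "\<Psi> X * \<Psi> Y \<in> germs" by (rule m(2))
  have "X \<oplus>\<^bsub>SEM W\<^esub> Y = (\<Union>(A, f)\<in>X. \<Union>(B, g)\<in>Y. sem_class W (A \<inter> B) (\<lambda>q. f q + g q))"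
    by (simp add: SEM_def)
  also have "\<dots> = germ_class (\<Psi> X + \<Psi> Y)"
    using a(1) unfolding fX fY .
  finally show "X \<oplus>\<^bsub>SEM W\<^esub> Y = germ_class (\<Psi> X + \<Psi> Y)" .
  have "X \<otimes>\<^bsub>SEM W\<^esub> Y = (\<Union>(A, f)\<in>X. \<Union>(B, g)\<in>Y. sem_class W (A \<inter> B) (star_prod f g))"
    by (simp add: SEM_def)
  also have "\<dots> = germ_class (\<Psi> X * \<Psi> Y)"
    using m(1) unfolding fX fY .
  finally show "X \<otimes>\<^bsub>SEM W\<^esub> Y = germ_class (\<Psi> X * \<Psi> Y)" .
qed

lemma sem_const:
  "sem_const W c \<in> carrier (SEM W)" "\<Psi> (sem_const W c) = Ham (fls_const (of_real (qre c)))
     (fls_const (of_real (qim1 c))) (fls_const (of_real (qim2 c))) (fls_const (of_real (qim3 c)))"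
proof -
  have "has_stem W (\<lambda>_. c) (\<lambda>_. const_coords c)"
    by (simp add: has_stem_def lift_const_coords)
  moreover have "stem_function_on (profile W) (\<lambda>_. const_coords c)"
    by (simp add: stem_function_on_def ham_eq_iff const_coords_def)
  moreover have "ham_comps (\<lambda>\<psi>. \<psi> meromorphic_on profile W) (\<lambda>_. const_coords c)"
    "ham_comps (\<lambda>\<psi>. \<psi> holomorphic_on profile W) (\<lambda>_. const_coords c)"
    by (auto simp: ham_comps_def)
  ultimately have "meromorphic_stem W (W, \<lambda>_. c) (\<lambda>_. const_coords c)"
    unfolding meromorphic_stem_def split
    using W eventually_at_in_open'[OF open_profile[OF W(1)]] by simp
  then have "sem_const W c = germ_class (laurent_ham z0 (\<lambda>_. const_coords c))" "laurent_ham z0 (\<lambda>_. const_coords c) \<in> germs"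
    using sem_class_meromorphic_stem meromorphic_stem_in_germs by (auto simp: sem_const_def)
  then show "sem_const W c \<in> carrier (SEM W)" "\<Psi> (sem_const W c) = Ham (fls_const (of_real (qre c)))
     (fls_const (of_real (qim1 c))) (fls_const (of_real (qim2 c))) (fls_const (of_real (qim3 c)))"
    by (simp_all add: carrier_SEM \<Psi>_germ_class) (simp add: laurent_ham_def const_coords_def laurent_expansion_const)
qed

text \<open>
The scalars: expansions of meromorphic functions that commute with conjugation.
\<close>

definition stem_germs :: "complex fls set" where
  "stem_germs = {laurent_expansion \<psi> z0 |\<psi>. \<psi> meromorphic_on profile W \<and> (\<forall>z\<in>profile W. \<psi> (cnj z) = cnj (\<psi> z))}"

lemma stem_germs_closed:
  shows "0 \<in> stem_germs" "1 \<in> stem_germs" "a \<in> stem_germs \<Longrightarrow> b \<in> stem_germs \<Longrightarrow> a + b \<in> stem_germs" "a \<in> stem_germs \<Longrightarrow> b \<in> stem_germs \<Longrightarrow> a * b \<in> stem_germs"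
    "a \<in> stem_germs \<Longrightarrow> - a \<in> stem_germs" "a \<in> stem_germs \<Longrightarrow> inverse a \<in> stem_germs"
proof -
  have I: "a \<in> stem_germs" if "\<psi> meromorphic_on profile W" "\<And>z. z \<in> profile W \<Longrightarrow> \<psi> (cnj z) = cnj (\<psi> z)"
    "laurent_expansion \<psi> z0 = a" for \<psi> a
    using that unfolding stem_germs_def by blast
  show "0 \<in> stem_germs" by (rule I[of "\<lambda>_. 0"]) (auto simp: laurent_expansion_const)
  show "1 \<in> stem_germs" by (rule I[of "\<lambda>_. 1"]) (auto simp: laurent_expansion_const)
  {
    assume "a \<in> stem_germs"
    then obtain \<phi> where \<phi>: "a = laurent_expansion \<phi> z0" "\<phi> meromorphic_on profile W" "\<forall>z\<in>profile W. \<phi> (cnj z) = cnj (\<phi> z)"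
      unfolding stem_germs_def by blast
    show "- a \<in> stem_germs"
      by (rule I[of "\<lambda>w. - \<phi> w"])
        (simp_all add: \<phi> meromorphic_intros laurent_expansion_hom(4)[OF \<phi>(2,2) z0])
    show "inverse a \<in> stem_germs"
      by (rule I[of "\<lambda>w. inverse (\<phi> w)"])
        (simp_all add: \<phi> meromorphic_intros laurent_expansion_hom(5)[OF \<phi>(2,2) z0])
    assume "b \<in> stem_germs"
    then obtain \<psi> where \<psi>: "b = laurent_expansion \<psi> z0" "\<psi> meromorphic_on profile W" "\<forall>z\<in>profile W. \<psi> (cnj z) = cnj (\<psi> z)"
      unfolding stem_germs_def by blast
    show "a + b \<in> stem_germs"
      by (rule I[of "\<lambda>w. \<phi> w + \<psi> w"])
        (simp_all add: \<phi> \<psi> meromorphic_intros laurent_expansion_hom(1)[OF \<phi>(2) \<psi>(2) z0])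
    show "a * b \<in> stem_germs"
      by (rule I[of "\<lambda>w. \<phi> w * \<psi> w"])
        (simp_all add: \<phi> \<psi> meromorphic_intros laurent_expansion_hom(3)[OF \<phi>(2) \<psi>(2) z0])
  }
qed

lemma germs_eq: "germs = {q. h0 q \<in> stem_germs \<and> h1 q \<in> stem_germs \<and> h2 q \<in> stem_germs \<and> h3 q \<in> stem_germs}"
proof (rule equalityI; rule subsetI)
  fix e assume "e \<in> germs"
  then obtain p where p: "p \<in> semi_regular W" "e = germ p" by (auto simp: germs_def)
  obtain A f \<phi> where "p = (A, f)" and r: "meromorphic_stem W (A, f) \<phi>" "germ p = laurent_ham z0 \<phi>"
    by (rule semi_regular_meromorphic_stem[OF p(1)])
  then have m: "ham_comps (\<lambda>\<psi>. \<psi> meromorphic_on profile W) \<phi>" and sym: "stem_function_on (profile W) \<phi>"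
    by (simp_all add: meromorphic_stem_def)
  have "laurent_expansion (\<lambda>w. t (\<phi> w)) z0 \<in> stem_germs"
    if "(\<lambda>w. t (\<phi> w)) meromorphic_on profile W" "\<And>x. t (cnj_ham x) = cnj (t x)" for t
  proof -
    have "\<forall>z\<in>profile W. t (\<phi> (cnj z)) = cnj (t (\<phi> z))"
      using sym that(2) by (simp add: stem_function_on_def)
    with that(1) show ?thesis unfolding stem_germs_def mem_Collect_eq by (intro exI[of _ "\<lambda>w. t (\<phi> w)"] conjI refl)
  qed
  from this[of h0] this[of h1] this[of h2] this[of h3] m
  show "e \<in> {q. h0 q \<in> stem_germs \<and> h1 q \<in> stem_germs \<and> h2 q \<in> stem_germs \<and> h3 q \<in> stem_germs}"
    unfolding p(2) r(2) laurent_ham_def by (simp add: ham_comps_def)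
next
  fix e assume "e \<in> {q. h0 q \<in> stem_germs \<and> h1 q \<in> stem_germs \<and> h2 q \<in> stem_germs \<and> h3 q \<in> stem_germs}"
  then have *: "h0 e \<in> stem_germs" "h1 e \<in> stem_germs" "h2 e \<in> stem_germs" "h3 e \<in> stem_germs" by auto
  obtain \<phi>0 where 0: "h0 e = laurent_expansion \<phi>0 z0" "\<phi>0 meromorphic_on profile W" "\<forall>z\<in>profile W. \<phi>0 (cnj z) = cnj (\<phi>0 z)"
    using *(1) unfolding stem_germs_def by blast
  obtain \<phi>1 where 1: "h1 e = laurent_expansion \<phi>1 z0" "\<phi>1 meromorphic_on profile W" "\<forall>z\<in>profile W. \<phi>1 (cnj z) = cnj (\<phi>1 z)"
    using *(2) unfolding stem_germs_def by blast
  obtain \<phi>2 where 2: "h2 e = laurent_expansion \<phi>2 z0" "\<phi>2 meromorphic_on profile W" "\<forall>z\<in>profile W. \<phi>2 (cnj z) = cnj (\<phi>2 z)"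
    using *(3) unfolding stem_germs_def by blast
  obtain \<phi>3 where 3: "h3 e = laurent_expansion \<phi>3 z0" "\<phi>3 meromorphic_on profile W" "\<forall>z\<in>profile W. \<phi>3 (cnj z) = cnj (\<phi>3 z)"
    using *(4) unfolding stem_germs_def by blast
  let ?\<phi> = "\<lambda>w. Ham (\<phi>0 w) (\<phi>1 w) (\<phi>2 w) (\<phi>3 w)"
  have "ham_comps (\<lambda>\<psi>. \<psi> meromorphic_on profile W) ?\<phi>" "stem_function_on (profile W) ?\<phi>"
    using 0 1 2 3 by (simp_all add: ham_comps_def stem_function_on_def ham_eq_iff)
  from stem_function_imp_meromorphic_stem[OF this] obtain A f where "meromorphic_stem W (A, f) ?\<phi>" by blast
  from meromorphic_stem_in_germs[OF this] show "e \<in> germs"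
    by (simp add: laurent_ham_def flip: 0(1) 1(1) 2(1) 3(1))
qed

text \<open>
A slice preserving function takes values in the plane of \<open>I\<close> on the slice of \<open>I\<close>; comparing the slices of
\<open>i\<close>, \<open>- i\<close> and \<open>j\<close> leaves only the real coordinate of the stem function.  The converse needs the identity
principle to pass from the germ at \<open>z0\<close> to all points of the domain.
\<close>

lemma SEM_R_eq: "SEM_R W = {X \<in> carrier (SEM W). \<exists>a. \<Psi> X = scal a}"
proof (rule equalityI; rule subsetI)
  fix X assume "X \<in> SEM_R W"
  then obtain D f where X: "X \<in> carrier (SEM W)" "(D, f) \<in> X" "slice_preserving D f"
    by (auto simp: SEM_R_def)
  have "(D, f) \<in> germ_class (\<Psi> X)" using X(2) SEM_elem[OF X(1)] by simp
  then have sr: "(D, f) \<in> semi_regular W" "germ (D, f) = \<Psi> X" by (auto simp: germ_class_def)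
  obtain \<phi> where r: "meromorphic_stem W (D, f) \<phi>" using sr(1) semi_regular_iff_meromorphic_stem by blast
  then have D: "circular D" "has_stem D f \<phi>" "eventually (\<lambda>w. w \<in> profile D) (at z0)"
    using z0 by (auto simp: meromorphic_stem_def)
  have zero: "h1 (\<phi> w) = 0 \<and> h2 (\<phi> w) = 0 \<and> h3 (\<phi> w) = 0" if w: "w \<in> profile D" for w
  proof -
    have "lift I (\<phi> w) \<in> slice I" if I: "I \<in> imag_units" for I
    proof -
      have "pt I w \<in> D \<inter> slice I" using w profile_iff[OF D(1) I] by (auto simp: in_slice)
      then have "f (pt I w) \<in> slice I" using X(3) I by (auto simp: slice_preserving_def)
      then show ?thesis using D(2) I w by (simp add: has_stem_def)
    qed
    then show ?thesis using slice_preserving_coords by blast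
  qed
  have lz: "laurent_expansion \<psi> z0 = 0" if "\<And>w. w \<in> profile D \<Longrightarrow> \<psi> w = 0" for \<psi>
  proof -
    have "laurent_expansion \<psi> z0 = laurent_expansion (\<lambda>_. 0) z0"
      using D(3) that by (intro laurent_expansion_cong refl) (auto elim: eventually_mono)
    then show ?thesis by (simp add: laurent_expansion_const)
  qed
  have "\<Psi> X = scal (h0 (\<Psi> X))"
    using germ_eq[OF r] sr(2) lz zero by (simp add: laurent_ham_def ham_eq_iff)
  then show "X \<in> {X \<in> carrier (SEM W). \<exists>a. \<Psi> X = scal a}" using X(1) by blast
next
  fix X assume "X \<in> {X \<in> carrier (SEM W). \<exists>a. \<Psi> X = scal a}"
  then obtain a where X: "X \<in> carrier (SEM W)" "\<Psi> X = scal a" by blast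
  have X': "X = germ_class (\<Psi> X)" "\<Psi> X \<in> germs" using SEM_elem[OF X(1)] by auto
  then obtain p where p: "p \<in> semi_regular W" "germ p = \<Psi> X" by (auto simp: germs_def)
  then have pX: "p \<in> X" using X'(1) by (auto simp: germ_class_def)
  obtain D f \<phi> where r: "p = (D, f)" "meromorphic_stem W (D, f) \<phi>" "germ p = laurent_ham z0 \<phi>"
    by (rule semi_regular_meromorphic_stem[OF p(1)])
  then have lau: "laurent_ham z0 \<phi> = scal a" using p X by simp
  have D: "D \<subseteq> W" "open D" "circular D" "ham_comps (\<lambda>\<psi>. \<psi> meromorphic_on profile W) \<phi>"
    "stem_function_on (profile W) \<phi>" "ham_comps (\<lambda>\<psi>. \<psi> holomorphic_on profile D) \<phi>" "has_stem D f \<phi>"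
    using r(2) by (auto simp: meromorphic_stem_def)
  have zero: "t (\<phi> w) = 0" if "(\<lambda>w. t (\<phi> w)) meromorphic_on profile W" "(\<lambda>w. t (\<phi> w)) holomorphic_on profile D"
      "\<And>x. t (cnj_ham x) = cnj (t x)" "laurent_expansion (\<lambda>w. t (\<phi> w)) z0 = 0" and w: "w \<in> profile D" for t w
  proof (rule zero_laurent_imp_zero[where \<psi> = "\<lambda>w. t (\<phi> w)" and z = w and A = "profile D"])
    show "t (\<phi> (cnj z)) = cnj (t (\<phi> z))" if "z \<in> profile W" for z
      using D(5) that \<open>\<And>x. t (cnj_ham x) = cnj (t x)\<close> by (simp add: stem_function_on_def)
  qed (use that D profile_mono[OF D(1)] open_profile[OF D(2)] in auto)
  have \<phi>_scal: "\<phi> w = scal (h0 (\<phi> w))" if w: "w \<in> profile D" for w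
    using D(4,6) lau zero[of h1, OF _ _ _ _ w] zero[of h2, OF _ _ _ _ w] zero[of h3, OF _ _ _ _ w]
    by (simp add: ham_comps_def laurent_ham_def ham_eq_iff)
  have "slice_preserving D f"
    unfolding slice_preserving_def
  proof (intro ballI subsetI)
    fix I q assume I: "I \<in> imag_units" and "q \<in> f ` (D \<inter> slice I)"
    then obtain w where w: "pt I w \<in> D" "q = f (pt I w)" by (auto simp: in_slice)
    then have wD: "w \<in> profile D" using profile_iff[OF D(3) I] by simp
    then have "q = lift I (\<phi> w)" using w(2) D(7) I by (simp add: has_stem_def)
    also have "\<dots> = pt I (h0 (\<phi> w))" using \<phi>_scal[OF wD] lift_scal by metis
    finally show "q \<in> slice I" by (auto simp: in_slice)
  qed
  then show "X \<in> SEM_R W" using X(1) pX r(1) by (auto simp: SEM_R_def)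
qed

text \<open>
Sums and products of classes are the sums and products of germs, the germs are all quaternions over
\<open>stem_germs\<close>, and the slice preserving classes are those with scalar germ.
\<close>

lemma SEM_coords: "quaternion_coords (SEM W) \<Psi> (SEM_R W) stem_germs"
proof -
  have mem: "germ_class e \<in> carrier (SEM W)" if "e \<in> germs" for e using that by (simp add: carrier_SEM)
  have zero: "\<zero>\<^bsub>SEM W\<^esub> = sem_const W 0" and one: "\<one>\<^bsub>SEM W\<^esub> = sem_const W 1" by (simp_all add: SEM_def)
  have img: "\<Psi> ` carrier (SEM W) = germs"
    unfolding carrier_SEM image_image using \<Psi>_germ_class by (simp add: image_def)
  show ?thesis
  proof (unfold_locales, goal_cases)
    case (1 x y) then show ?case using SEM_add_mult(1,2) mem by simp
  next
    case (2 x y) then show ?case using SEM_add_mult(3,4) mem by simp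
  next
    case 3 show ?case unfolding zero by (rule sem_const)
  next
    case 4 show ?case unfolding one by (rule sem_const)
  next
    case (5 x y) then show ?case using SEM_add_mult(1,2) \<Psi>_germ_class by simp
  next
    case (6 x y) then show ?case using SEM_add_mult(3,4) \<Psi>_germ_class by simp
  next
    case 7 show ?case unfolding zero by (simp add: sem_const ham_eq_iff)
  next
    case 8 show ?case unfolding one by (simp add: sem_const ham_eq_iff sel_one)
  next
    case 9 show ?case by (rule inj_onI) (metis SEM_elem)
  next
    case (10 x)
    then have "- \<Psi> x \<in> germs" using SEM_elem[of x] by (auto simp: germs_eq stem_germs_closed)
    then show ?case by (intro bexI[of _ "germ_class (- \<Psi> x)"] \<Psi>_germ_class mem)
  next
    case 11 show ?case using img by (simp add: germs_eq)
  next
    case 12 show ?case by (rule SEM_R_eq)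
  qed (fact stem_germs_closed)+
qed

sublocale Q: quaternion_coords "SEM W" \<Psi> "SEM_R W" stem_germs
  by (rule SEM_coords)

text \<open>
The coordinates \<open>f\<^sub>0, \<dots>, f\<^sub>3\<close> of \<open>f\<close> are unique, so the definite description picks the element whose germ is
the conjugate quaternion.
\<close>

lemma sem_conj:
  assumes f: "f \<in> carrier (SEM W)"
  shows "sem_conj W f \<in> carrier (SEM W)" "\<Psi> (sem_conj W f) = qconj (\<Psi> f)"
proof -
  let ?R = "SEM W"
  define v where "v a b c = a \<otimes>\<^bsub>?R\<^esub> sem_const W (Quat 0 1 0 0) \<oplus>\<^bsub>?R\<^esub> b \<otimes>\<^bsub>?R\<^esub> sem_const W (Quat 0 0 1 0)
    \<oplus>\<^bsub>?R\<^esub> c \<otimes>\<^bsub>?R\<^esub> sem_const W (Quat 0 0 0 1)" for a b c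
  define P where "P c \<longleftrightarrow> (\<exists>f0\<in>SEM_R W. \<exists>f1\<in>SEM_R W. \<exists>f2\<in>SEM_R W. \<exists>f3\<in>SEM_R W.
     f = f0 \<oplus>\<^bsub>?R\<^esub> v f1 f2 f3 \<and> c = f0 \<ominus>\<^bsub>?R\<^esub> v f1 f2 f3)" for c
  have sc: "sem_conj W f = (THE c. P c)"
    by (simp add: sem_conj_def P_def v_def Let_def)
  have KR: "a \<in> carrier ?R" if "a \<in> SEM_R W" for a using that Q.K_subset by blast
  have v: "v a b c \<in> carrier ?R" "\<Psi> (v a b c) = Ham 0 (Q.\<kappa> a) (Q.\<kappa> b) (Q.\<kappa> c)"
    if "a \<in> SEM_R W" "b \<in> SEM_R W" "c \<in> SEM_R W" for a b c
    using that KR[OF that(1)] KR[OF that(2)] KR[OF that(3)]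
    by (simp_all add: v_def Q.h_add Q.h_mult sem_const Q.\<Psi>_K ham_eq_iff)
  have P_imp: "c \<in> carrier ?R \<and> \<Psi> c = qconj (\<Psi> f)" if "P c" for c
  proof -
    obtain f0 f1 f2 f3 where k: "f0 \<in> SEM_R W" "f1 \<in> SEM_R W" "f2 \<in> SEM_R W" "f3 \<in> SEM_R W"
      and eq: "f = f0 \<oplus>\<^bsub>?R\<^esub> v f1 f2 f3" "c = f0 \<ominus>\<^bsub>?R\<^esub> v f1 f2 f3"
      using \<open>P c\<close> unfolding P_def by blast
    note vv = v[OF k(2,3,4)]
    show ?thesis
      unfolding eq using vv KR[OF k(1)]
      by (simp add: Q.h_add Q.h_minus Q.\<Psi>_K[OF k(1)] qconj_def ham_eq_iff)
  qed
  have "\<exists>c. P c"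
  proof -
    have HF: "scal a \<in> Q.HF" if "a \<in> stem_germs" for a using that by (rule Q.HF_closed(4))
    define k where "k a = Q.elem (scal a)" for a
    have k: "k a \<in> SEM_R W" "Q.\<kappa> (k a) = a" "k a \<in> carrier ?R" "\<Psi> (k a) = scal a" if "a \<in> stem_germs" for a
      using Q.K_I[of "k a" a] Q.elem[OF HF[OF that]] by (simp_all add: k_def)
    have \<Psi>f: "h0 (\<Psi> f) \<in> stem_germs" "h1 (\<Psi> f) \<in> stem_germs" "h2 (\<Psi> f) \<in> stem_germs" "h3 (\<Psi> f) \<in> stem_germs"
      using Q.\<Psi>_in_HF[OF f] by (simp_all add: Q.HF_def)
    note kk = k(1)[OF \<Psi>f(1)] k(1)[OF \<Psi>f(2)] k(1)[OF \<Psi>f(3)] k(1)[OF \<Psi>f(4)]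
    have "f = k (h0 (\<Psi> f)) \<oplus>\<^bsub>?R\<^esub> v (k (h1 (\<Psi> f))) (k (h2 (\<Psi> f))) (k (h3 (\<Psi> f)))"
      using f v[OF kk(2,3,4)] k \<Psi>f by (intro Q.h_eqI) (simp_all add: Q.h_add ham_eq_iff)
    then show ?thesis unfolding P_def using kk by blast
  qed
  moreover have "c = d" if "P c" "P d" for c d
  proof (rule Q.h_eqI)
    note cd = P_imp[OF that(1)] P_imp[OF that(2)]
    show "c \<in> carrier ?R" "d \<in> carrier ?R" by (rule conjunct1[OF cd(1)], rule conjunct1[OF cd(2)])
    show "\<Psi> c = \<Psi> d" by (rule trans[OF conjunct2[OF cd(1)] sym[OF conjunct2[OF cd(2)]]])
  qed
  ultimately have "\<exists>!c. P c" by (rule ex_ex1I)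
  then have "P (THE c. P c)" by (rule theI')
  note P_imp[OF this]
  then show "sem_conj W f \<in> carrier ?R" "\<Psi> (sem_conj W f) = qconj (\<Psi> f)"
    unfolding sc by (rule conjunct1, rule conjunct2)
qed

lemma sem_scal:
  assumes f: "f \<in> carrier (SEM W)"
  shows "sem_scal W f \<in> carrier (SEM W)" "\<Psi> (sem_scal W f) = scal (h0 (\<Psi> f))"
proof -
  have half: "(1 / 2 :: quat) = of_real (1 / 2)" by simp
  have q: "qre (1 / 2) = 1 / 2" "qim1 (1 / 2) = 0" "qim2 (1 / 2) = 0" "qim3 (1 / 2) = 0"
    unfolding half sel_of_real by (rule refl)+
  have c: "\<Psi> (sem_const W (1 / 2)) = scal (fls_const (1 / 2))"
    by (simp add: sem_const q ham_eq_iff)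
  have h: "fls_const (1 / 2) * (x + x) = x" for x :: "complex fls"
  proof -
    have "fls_const (1 / 2) * (x + x) = (fls_const (1 / 2) + fls_const (1 / 2)) * x"
      by (simp add: algebra_simps)
    also have "fls_const (1 / 2) + fls_const (1 / 2) = (fls_const 1 :: complex fls)"
      by (simp add: fls_plus_const)
    finally show ?thesis by simp
  qed
  have half_two: "fls_const (1 / 2) * 2 = (1 :: complex fls)"
    using h[of 1] by simp
  show "sem_scal W f \<in> carrier (SEM W)"
    unfolding sem_scal_def using sem_const(1) sem_conj(1)[OF f] f by simp
  show "\<Psi> (sem_scal W f) = scal (h0 (\<Psi> f))"
    unfolding sem_scal_def using sem_const(1) sem_conj[OF f] f
    by (simp add: Q.h_mult Q.h_add c ham_eq_iff qconj_def half_two)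
qed

lemma sem_symm_vec:
  assumes f: "f \<in> carrier (SEM W)"
  shows "sem_symm W (sem_vec W f) \<in> carrier (SEM W)" "\<Psi> (sem_symm W (sem_vec W f)) = scal (vnorm (\<Psi> f))"
proof -
  have v: "sem_vec W f \<in> carrier (SEM W)" "\<Psi> (sem_vec W f) = hvec (\<Psi> f)"
    unfolding sem_vec_def using sem_scal[OF f] f by (simp_all add: Q.h_minus ham_eq_iff)
  show "sem_symm W (sem_vec W f) \<in> carrier (SEM W)" "\<Psi> (sem_symm W (sem_vec W f)) = scal (vnorm (\<Psi> f))"
    unfolding sem_symm_def using v sem_conj[OF v(1)] by (simp_all add: Q.h_mult hvec_times_qconj)
qed

end

text \<open>
Over the empty set there is only one class, and it is slice preserving.
\<close>

lemma SEM_nonempty_domain: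
  assumes "f \<in> carrier (SEM W) - SEM_R W"
  shows "W \<noteq> {}"
proof
  assume W: "W = {}"
  have f: "f \<in> semi_regular W // sem_eq W" "f \<notin> SEM_R W" using assms by (auto simp: SEM_def)
  then obtain p where p: "p \<in> semi_regular W" "f = sem_eq W `` {p}" by (auto simp: quotient_def)
  obtain D g where "p = (D, g)" by (cases p)
  with p W have "(D, g) \<in> f" "D = {}" by (auto simp: sem_eq_def semi_regular_def)
  then have "f \<in> SEM_R W" using f(1) by (auto simp: SEM_R_def SEM_def slice_preserving_def intro!: bexI[of _ "(D, g)"])
  with f(2) show False by simp
qed

theorem proposition5p1:
  fixes \<Omega> :: "quat set" and f g :: sem
  assumes "circular_domain \<Omega>"
    and "f \<in> carrier (SEM \<Omega>) - SEM_R \<Omega>"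
    and "g \<in> carrier (SEM \<Omega>) - SEM_R \<Omega>"
  shows
    "let R = SEM \<Omega>;
         K = SEM_R \<Omega>;
         S = sylvester \<Omega> f g;
         s = sem_scal \<Omega> f \<oplus>\<^bsub>R\<^esub> sem_scal \<Omega> g;
         a = sem_symm \<Omega> (sem_vec \<Omega> f);
         b = sem_symm \<Omega> (sem_vec \<Omega> g);
         P = UP (R\<lparr>carrier := K\<rparr>);
         C = (\<lambda>c. monom P c 0);
         X = monom P \<one>\<^bsub>R\<^esub> 1
     in op_charpoly R K S =
          (C s \<ominus>\<^bsub>P\<^esub> X) [^]\<^bsub>P\<^esub> (2::nat) \<otimes>\<^bsub>P\<^esub>
            ((C s \<ominus>\<^bsub>P\<^esub> X) [^]\<^bsub>P\<^esub> (2::nat) \<oplus>\<^bsub>P\<^esub> C ([(2::nat)] \<cdot>\<^bsub>R\<^esub> (a \<oplus>\<^bsub>R\<^esub> b)))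
          \<oplus>\<^bsub>P\<^esub> C ((a \<ominus>\<^bsub>R\<^esub> b) [^]\<^bsub>R\<^esub> (2::nat)) \<and>
        (linear_iso R K S \<longleftrightarrow>
          s [^]\<^bsub>R\<^esub> (2::nat) \<otimes>\<^bsub>R\<^esub>
            (s [^]\<^bsub>R\<^esub> (2::nat) \<oplus>\<^bsub>R\<^esub> [(2::nat)] \<cdot>\<^bsub>R\<^esub> (a \<oplus>\<^bsub>R\<^esub> b))
          \<oplus>\<^bsub>R\<^esub> (a \<ominus>\<^bsub>R\<^esub> b) [^]\<^bsub>R\<^esub> (2::nat) \<noteq> \<zero>\<^bsub>R\<^esub>) \<and>
        1 < op_rank R K S"
proof -
  obtain q where q: "q \<in> \<Omega>" using SEM_nonempty_domain[OF assms(2)] by blast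
  have "circular \<Omega>" using assms(1) by (simp add: circular_domain_def)
  then have "slice_coord q \<in> profile \<Omega>" using q by (simp add: slice_coord_profile_iff)
  then interpret circular_domain_point \<Omega> "slice_coord q"
    using assms(1) by unfold_locales
  have f: "f \<in> carrier (SEM \<Omega>)" "f \<notin> SEM_R \<Omega>" and g: "g \<in> carrier (SEM \<Omega>)"
    using assms(2,3) by auto
  have S: "sylvester \<Omega> f g = (\<lambda>x. f \<otimes>\<^bsub>SEM \<Omega>\<^esub> x \<oplus>\<^bsub>SEM \<Omega>\<^esub> x \<otimes>\<^bsub>SEM \<Omega>\<^esub> g)"
    by (rule ext) (rule sylvester_def)
  have s: "sem_scal \<Omega> f \<oplus>\<^bsub>SEM \<Omega>\<^esub> sem_scal \<Omega> g \<in> carrier (SEM \<Omega>)"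
    "\<Psi> (sem_scal \<Omega> f \<oplus>\<^bsub>SEM \<Omega>\<^esub> sem_scal \<Omega> g) = scal (h0 (\<Psi> f) + h0 (\<Psi> g))"
    using sem_scal[OF f(1)] sem_scal[OF g] by (simp_all add: Q.h_add scal_hom)
  show ?thesis
    unfolding Let_def S
    using Q.sylvester_operator[OF f g s sem_symm_vec[OF f(1)] sem_symm_vec[OF g]] by blast
qed

end
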